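(* Assume that there exist $\kappa>0$ and $s\ge0$ such that the continuously differentiable maps $\mathcal M_i,\mathcal H_i$ satisfy $|\mathcal M_i(x)|$, $|\mathcal M_i'(x)|$, $|\mathcal H_i(x)|$, $|\mathcal H_i'(x)|\le\kappa(1+|x|^s)$ for all $i=1,\ldots,k$ and all $x\in\mathbf R^m$. Let $\bar X_{0:k|k}^{j,N_j,\tau}$ be the $j$-th iterate of the EnKS-4DVAR algorithm with finite difference step $\tau>0$ and ensemble sizes $N_1,N_2,\ldots\ge2$, and let $x^j=x_{0:k}^j$ be the $j$-th iterate of the Levenberg-Marquardt method, both defined in the context. Then for each $j$, $$\lim_{\min\{N_1,\ldots,N_j\}\to\infty}\ \lim_{\tau\to0}\bar X_{0:k|k}^{j,N_j,\tau}=x^j\quad\text{in probability};$$ that is, for fixed ensemble sizes $\bar X_{0:k|k}^{j,N_j,\tau}$ converges in probability as $\tau\to0$, $\tau>0$, and the limit converges in probability to $x^j$ as $\min\{N_1,\ldots,N_j\}\to\infty$.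
   Context: Norms: $|\cdot|$ is the Euclidean norm of a vector or the spectral norm of a matrix; $|v|_A^2=v^{\mathrm T}Av$. Data: integers $k,m,d_i\ge1$; continuously differentiable maps $\mathcal M_i:\mathbf R^m\to\mathbf R^m$, $\mathcal H_i:\mathbf R^m\to\mathbf R^{d_i}$ with Jacobians $\mathcal M_i',\mathcal H_i'$; fixed vectors $x_{\mathrm b},\mu_i\in\mathbf R^m$, $y_i\in\mathbf R^{d_i}$; symmetric positive definite matrices $B,Q_i\in\mathbf R^{m\times m}$, $R_i\in\mathbf R^{d_i\times d_i}$, $i=1,\ldots,k$; a constant $\gamma>0$; a deterministic initial approximation $x_{0:k}^0=(x_0^0,\ldots,x_k^0)$ with $x_i^0\in\mathbf R^m$. Levenberg-Marquardt (LM) method: for $j=1,2,\ldots$, $x_{0:k}^j$ is the minimizer over $x_{0:k}=(x_0,\ldots,x_k)$ of $$|x_0-x_{\mathrm b}|_{B^{-1}}^2+\sum_{i=1}^k\left|x_i-\mathcal M_i(x_{i-1}^{j-1})-\mathcal M_i'(x_{i-1}^{j-1})(x_{i-1}-x_{i-1}^{j-1})-\mu_i\right|_{Q_i^{-1}}^2+\sum_{i=1}^k\left|y_i-\mathcal H_i(x_i^{j-1})-\mathcal H_i'(x_i^{j-1})(x_i-x_i^{j-1})\right|_{R_i^{-1}}^2+\sum_{i=1}^k\gamma|x_i-x_i^{j-1}|^2.$$ EnKS-4DVAR algorithm. Put $$\tilde{\mathcal H}_i(x)=\begin{bmatrix}\mathcal H_i(x)\\ x\end{bmatrix},\quad \tilde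 R_i=\begin{bmatrix}R_i&0\\ 0&\frac1\gamma I_m\end{bmatrix}.$$ Random inputs (the same for all $\tau$ and all ensemble sizes): for $j,n=1,2,\ldots$ and $i=1,\dots,k$, mutually independent random vectors $X_{0|0}^{j,n}\sim N(x_{\mathrm b},B)$, $V_i^{j,n}\sim N(0,Q_i)$, $\tilde W_i^{j,n}\sim N(0,\tilde R_i)$. Set $\bar X_{0:k|k}^{0,N_0,\tau}=x_{0:k}^0$. For $j=1,2,\ldots$ let $z_i^\tau$ denote the $i$-th block of $\bar X_{0:k|k}^{j-1,N_{j-1},\tau}$. Start from $X_{0:0|0}^{j,n,\tau}=X_{0|0}^{j,n}$, $n=1,\ldots,N_j$. For $i=1,\ldots,k$: with $X_{i-1|i-1}^{j,n,\tau}$ the last block of $X_{0:i-1|i-1}^{j,n,\tau}$, set $$X_{i|i-1}^{j,n,\tau}=\frac{\mathcal M_i\left(z_{i-1}^\tau+\tau(X_{i-1|i-1}^{j,n,\tau}-z_{i-1}^\tau)\right)-\mathcal M_i(z_{i-1}^\tau)}{\tau}+\mathcal M_i(z_{i-1}^\tau)+\mu_i+V_i^{j,n};$$ let $X_{0:i|i-1}^{j,n,\tau}$ be $X_{0:i-1|i-1}^{j,n,\tau}$ with the block $X_{i|i-1}^{j,n,\tau}$ appended; let $\bar X_{0:i|i-1}^{j,\tau},\bar X_{i|i-1}^{j,\tau}$ be the sample means over $n=1,\ldots,N_j$; put $$h_i^{j,n,\tau}=\frac{\tilde{\mathcal H}_i\left(z_i^\tau+\tau(X_{i|i-1}^{j,n,\tau}-\bar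 X_{i|i-1}^{j,\tau})\right)-\tilde{\mathcal H}_i(z_i^\tau)}{\tau},\qquad \tilde y_i^\tau=\begin{bmatrix}y_i\\ z_i^\tau\end{bmatrix},$$ $$A_i^\tau=\frac1{N_j-1}\sum_{n=1}^{N_j}(X_{0:i|i-1}^{j,n,\tau}-\bar X_{0:i|i-1}^{j,\tau})(h_i^{j,n,\tau})^{\mathrm T},\qquad D_i^\tau=\frac1{N_j-1}\sum_{n=1}^{N_j}h_i^{j,n,\tau}(h_i^{j,n,\tau})^{\mathrm T},$$ $$X_{0:i|i}^{j,n,\tau}=X_{0:i|i-1}^{j,n,\tau}+A_i^\tau(D_i^\tau+\tilde R_i)^{-1}\left(\tilde y_i^\tau-\tilde W_i^{j,n}-\tilde{\mathcal H}_i(z_i^\tau)-\frac{\tilde{\mathcal H}_i\left(z_i^\tau+\tau(X_{i|i-1}^{j,n,\tau}-z_i^\tau)\right)-\tilde{\mathcal H}_i(z_i^\tau)}{\tau}\right).$$ The next iterate is $\bar X_{0:k|k}^{j,N_j,\tau}=\frac1{N_j}\sum_{n=1}^{N_j}X_{0:k|k}^{j,n,\tau}$. *)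

theory Defs
  imports
    "HOL-Probability.Probability"
    "Jordan_Normal_Form.Gauss_Jordan_Elimination"
begin

text \<open>
  The observation dimensions \<open>d i\<close> vary with \<open>i\<close>, so vectors and matrices are those of
  \<^theory>\<open>Jordan_Normal_Form.Matrix\<close>, with explicit dimensions. The homonymous objects of
  HOL-Analysis are hidden.
\<close>

hide_type (open) Finite_Cartesian_Product.vec
hide_const (open) Finite_Cartesian_Product.vec Finite_Cartesian_Product.mat
  Finite_Cartesian_Product.row Finite_Cartesian_Product.transpose Determinants.det
unbundle no vec_syntax
no_notation inner (infix "\<bullet>" 70)


section \<open>Vectors and matrices\<close>

definition vnorm :: "real vec \<Rightarrow> real" where
  "vnorm v = sqrt (v \<bullet> v)"

definition spectral_norm :: "real mat \<Rightarrow> real" where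
  "spectral_norm A = (SUP v \<in> {v \<in> carrier_vec (dim_col A). vnorm v \<le> 1}. vnorm (A *\<^sub>v v))"

definition wnorm_sq :: "real mat \<Rightarrow> real vec \<Rightarrow> real" where
  "wnorm_sq A v = v \<bullet> (A *\<^sub>v v)"

definition sym_pos_def :: "nat \<Rightarrow> real mat \<Rightarrow> bool" where
  "sym_pos_def n A \<longleftrightarrow>
     A \<in> carrier_mat n n \<and> transpose_mat A = A \<and>
     (\<forall>v \<in> carrier_vec n. v \<noteq> 0\<^sub>v n \<longrightarrow> v \<bullet> (A *\<^sub>v v) > 0)"

text \<open>Only used for invertible matrices.\<close>

definition minv :: "real mat \<Rightarrow> real mat" where
  "minv A = the (mat_inverse A)"


section \<open>Continuously differentiable maps between spaces of vectors\<close>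

definition has_jacobian ::
    "nat \<Rightarrow> nat \<Rightarrow> (real vec \<Rightarrow> real vec) \<Rightarrow> real mat \<Rightarrow> real vec \<Rightarrow> bool" where
  "has_jacobian n p F J x \<longleftrightarrow>
     J \<in> carrier_mat p n \<and>
     (\<forall>\<epsilon>>0. \<exists>\<delta>>0. \<forall>h \<in> carrier_vec n.
        vnorm h < \<delta> \<longrightarrow> vnorm (F (x + h) - F x - J *\<^sub>v h) \<le> \<epsilon> * vnorm h)"

text \<open>\<open>F\<close> is a \<open>C\<^sup>1\<close> map from \<open>\<real>\<^sup>n\<close> to \<open>\<real>\<^sup>p\<close> with Jacobian \<open>F'\<close>.\<close>

definition C1_map ::
    "nat \<Rightarrow> nat \<Rightarrow> (real vec \<Rightarrow> real vec) \<Rightarrow> (real vec \<Rightarrow> real mat) \<Rightarrow> bool" where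
  "C1_map n p F F' \<longleftrightarrow>
     F \<in> carrier_vec n \<rightarrow> carrier_vec p \<and>
     (\<forall>x \<in> carrier_vec n. has_jacobian n p F (F' x) x) \<and>
     (\<forall>x \<in> carrier_vec n. \<forall>\<epsilon>>0. \<exists>\<delta>>0. \<forall>x' \<in> carrier_vec n.
        vnorm (x' - x) < \<delta> \<longrightarrow> spectral_norm (F' x' - F' x) < \<epsilon>)"

text \<open>The bound \<open>\<kappa> (1 + |x|\<^sup>s)\<close>. The case distinction gives \<open>|x|\<^sup>0 = 1\<close> also for \<open>x = 0\<close>,
  where \<^const>\<open>powr\<close> yields \<open>0\<close>.\<close>

definition growth_bound :: "real \<Rightarrow> real \<Rightarrow> real vec \<Rightarrow> real" where
  "growth_bound \<kappa> s x = \<kappa> * (1 + (if s = 0 then 1 else vnorm x powr s))"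


section \<open>Random vectors\<close>

text \<open>The Borel \<open>\<sigma>\<close>-algebra of \<open>\<real>\<^sup>n\<close>, transported from the product \<open>\<sigma>\<close>-algebra along the
  coordinate map.\<close>

definition borel_vec :: "nat \<Rightarrow> real vec measure" where
  "borel_vec n =
     vimage_algebra (carrier_vec n) (\<lambda>v. \<lambda>a\<in>{..<n}. v $ a) (\<Pi>\<^sub>M a\<in>{..<n}. (borel :: real measure))"

text \<open>\<open>X \<sim> N(\<mu>, \<Sigma>)\<close> for positive definite \<open>\<Sigma>\<close>: every nonzero linear functional \<open>u \<bullet> X\<close> is normal
  with mean \<open>u \<bullet> \<mu>\<close> and variance \<open>u \<bullet> \<Sigma> u > 0\<close>.\<close>

definition normal_vec ::
    "'w measure \<Rightarrow> nat \<Rightarrow> real vec \<Rightarrow> real mat \<Rightarrow> ('w \<Rightarrow> real vec) \<Rightarrow> bool" where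
  "normal_vec P n \<mu> \<Sigma> X \<longleftrightarrow>
     X \<in> P \<rightarrow>\<^sub>M borel_vec n \<and>
     (\<forall>u \<in> carrier_vec n. u \<noteq> 0\<^sub>v n \<longrightarrow>
        distributed P lborel (\<lambda>\<omega>. u \<bullet> X \<omega>) (normal_density (u \<bullet> \<mu>) (sqrt (u \<bullet> (\<Sigma> *\<^sub>v u)))))"

text \<open>Composite vectors \<open>x\<^bsub>0:k\<^esub> = (x\<^sub>0, \<dots>, x\<^sub>k)\<close> are functions from the block index; only the
  blocks \<open>0, \<dots>, k\<close> are relevant.\<close>

definition blocks_norm :: "nat \<Rightarrow> (nat \<Rightarrow> real vec) \<Rightarrow> real" where
  "blocks_norm k x = sqrt (\<Sum>l\<le>k. (vnorm (x l))\<^sup>2)"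

definition random_blocks :: "'w measure \<Rightarrow> nat \<Rightarrow> nat \<Rightarrow> ('w \<Rightarrow> nat \<Rightarrow> real vec) \<Rightarrow> bool" where
  "random_blocks P m k X \<longleftrightarrow> (\<forall>l\<le>k. (\<lambda>\<omega>. X \<omega> l) \<in> P \<rightarrow>\<^sub>M borel_vec m)"

text \<open>Convergence in probability, along the filter \<open>F\<close>, of random composite vectors with blocks
  \<open>0, \<dots>, k\<close> in \<open>\<real>\<^sup>m\<close>.\<close>

definition conv_in_prob ::
    "'w measure \<Rightarrow> nat \<Rightarrow> nat \<Rightarrow> 't filter \<Rightarrow> ('t \<Rightarrow> 'w \<Rightarrow> nat \<Rightarrow> real vec)
      \<Rightarrow> ('w \<Rightarrow> nat \<Rightarrow> real vec) \<Rightarrow> bool" where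
  "conv_in_prob P m k F X Y \<longleftrightarrow>
     (\<forall>\<^sub>F t in F. random_blocks P m k (X t)) \<and> random_blocks P m k Y \<and>
     (\<forall>\<epsilon>>0. ((\<lambda>t. measure P {\<omega> \<in> space P. blocks_norm k (\<lambda>l. X t \<omega> l - Y \<omega> l) > \<epsilon>}) \<longlongrightarrow> 0) F)"


section \<open>The Levenberg-Marquardt method\<close>

text \<open>\<open>z\<close> is the previous iterate, \<open>x\<close> the argument of the objective function.\<close>

definition lm_objective ::
    "nat \<Rightarrow> (nat \<Rightarrow> real vec \<Rightarrow> real vec) \<Rightarrow> (nat \<Rightarrow> real vec \<Rightarrow> real mat)
      \<Rightarrow> (nat \<Rightarrow> real vec \<Rightarrow> real vec) \<Rightarrow> (nat \<Rightarrow> real vec \<Rightarrow> real mat)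
      \<Rightarrow> real vec \<Rightarrow> (nat \<Rightarrow> real vec) \<Rightarrow> (nat \<Rightarrow> real vec)
      \<Rightarrow> real mat \<Rightarrow> (nat \<Rightarrow> real mat) \<Rightarrow> (nat \<Rightarrow> real mat) \<Rightarrow> real
      \<Rightarrow> (nat \<Rightarrow> real vec) \<Rightarrow> (nat \<Rightarrow> real vec) \<Rightarrow> real" where
  "lm_objective k M M' H H' xb \<mu> y B Q R \<gamma> z x =
     wnorm_sq (minv B) (x 0 - xb)
     + (\<Sum>i=1..k. wnorm_sq (minv (Q i))
          (x i - M i (z (i - 1)) - M' i (z (i - 1)) *\<^sub>v (x (i - 1) - z (i - 1)) - \<mu> i))
     + (\<Sum>i=1..k. wnorm_sq (minv (R i))
          (y i - H i (z i) - H' i (z i) *\<^sub>v (x i - z i)))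
     + (\<Sum>i=1..k. \<gamma> * (vnorm (x i - z i))\<^sup>2)"

primrec lm_iterate ::
    "nat \<Rightarrow> nat \<Rightarrow> (nat \<Rightarrow> real vec \<Rightarrow> real vec) \<Rightarrow> (nat \<Rightarrow> real vec \<Rightarrow> real mat)
      \<Rightarrow> (nat \<Rightarrow> real vec \<Rightarrow> real vec) \<Rightarrow> (nat \<Rightarrow> real vec \<Rightarrow> real mat)
      \<Rightarrow> real vec \<Rightarrow> (nat \<Rightarrow> real vec) \<Rightarrow> (nat \<Rightarrow> real vec)
      \<Rightarrow> real mat \<Rightarrow> (nat \<Rightarrow> real mat) \<Rightarrow> (nat \<Rightarrow> real mat) \<Rightarrow> real
      \<Rightarrow> (nat \<Rightarrow> real vec) \<Rightarrow> nat \<Rightarrow> (nat \<Rightarrow> real vec)" where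
  "lm_iterate k m M M' H H' xb \<mu> y B Q R \<gamma> x0 0 = x0"
| "lm_iterate k m M M' H H' xb \<mu> y B Q R \<gamma> x0 (Suc j) =
     (THE x. is_arg_min
        (lm_objective k M M' H H' xb \<mu> y B Q R \<gamma>
           (lm_iterate k m M M' H H' xb \<mu> y B Q R \<gamma> x0 j))
        (\<lambda>x. x \<in> (\<Pi>\<^sub>E l\<in>{0..k}. carrier_vec m)) x)"


section \<open>The EnKS-4DVAR algorithm\<close>

definition aug_obs :: "(real vec \<Rightarrow> real vec) \<Rightarrow> real vec \<Rightarrow> real vec" where
  "aug_obs h x = h x @\<^sub>v x"

definition aug_cov :: "nat \<Rightarrow> nat \<Rightarrow> real \<Rightarrow> real mat \<Rightarrow> real mat" where
  "aug_cov p m \<gamma> S = four_block_mat S (0\<^sub>m p m) (0\<^sub>m m p) ((1 / \<gamma>) \<cdot>\<^sub>m 1\<^sub>m m)"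

definition diff_quot :: "real \<Rightarrow> (real vec \<Rightarrow> real vec) \<Rightarrow> real vec \<Rightarrow> real vec \<Rightarrow> real vec" where
  "diff_quot \<tau> F z u = (1 / \<tau>) \<cdot>\<^sub>v (F (z + \<tau> \<cdot>\<^sub>v u) - F z)"

definition sample_mean :: "nat \<Rightarrow> nat \<Rightarrow> (nat \<Rightarrow> real vec) \<Rightarrow> real vec" where
  "sample_mean m N X = vec m (\<lambda>a. (\<Sum>n=1..N. X n $ a) / real N)"

text \<open>\<open>1/(N-1) \<Sum>\<^sub>n u\<^sub>n v\<^sub>n\<^sup>T\<close> for \<open>u\<^sub>n \<in> \<real>\<^sup>r\<close>, \<open>v\<^sub>n \<in> \<real>\<^sup>c\<close>; the vectors are not centered here.\<close>

definition sample_outer ::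
    "nat \<Rightarrow> nat \<Rightarrow> nat \<Rightarrow> (nat \<Rightarrow> real vec) \<Rightarrow> (nat \<Rightarrow> real vec) \<Rightarrow> real mat" where
  "sample_outer r c N u v =
     mat r c (\<lambda>(a, b). (\<Sum>n=1..N. u n $ a * v n $ b) / (real N - 1))"

text \<open>
  One step of the smoother. The argument \<open>E n l\<close> is block \<open>l\<close> of the \<open>n\<close>-th ensemble member: of
  \<open>X\<^bsub>0:i-1|i-1\<^esub>\<close> in the forecast, and of \<open>X\<^bsub>0:i|i-1\<^esub>\<close> in the analysis. The maps \<open>Mi\<close>, \<open>Ht\<close>, the
  vectors \<open>\<mu>i\<close>, \<open>yt\<close>, \<open>V\<close>, \<open>W\<close> and the matrix \<open>Rt\<close> are those of index \<open>i\<close> (tilde versions for \<open>Ht\<close>,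
  \<open>yt\<close>, \<open>W\<close>, \<open>Rt\<close>), and \<open>q\<close> is the dimension \<open>d i + m\<close> of the augmented observation.
\<close>

definition enks_forecast ::
    "nat \<Rightarrow> real \<Rightarrow> (real vec \<Rightarrow> real vec) \<Rightarrow> real vec \<Rightarrow> (nat \<Rightarrow> real vec)
      \<Rightarrow> (nat \<Rightarrow> real vec) \<Rightarrow> (nat \<Rightarrow> nat \<Rightarrow> real vec) \<Rightarrow> (nat \<Rightarrow> nat \<Rightarrow> real vec)" where
  "enks_forecast i \<tau> Mi \<mu>i z V E =
     (\<lambda>n. (E n)(i := diff_quot \<tau> Mi (z (i - 1)) (E n (i - 1) - z (i - 1))
                        + Mi (z (i - 1)) + \<mu>i + V n))"

text \<open>The gain \<open>A (D + Rt)\<^sup>-\<^sup>1\<close> is applied blockwise: \<open>A l\<close> consists of the rows of \<open>A\<close> that belong to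
  block \<open>l\<close>.\<close>

definition enks_analysis ::
    "nat \<Rightarrow> nat \<Rightarrow> nat \<Rightarrow> real \<Rightarrow> nat \<Rightarrow> (real vec \<Rightarrow> real vec) \<Rightarrow> real mat \<Rightarrow> real vec
      \<Rightarrow> (nat \<Rightarrow> real vec) \<Rightarrow> (nat \<Rightarrow> real vec) \<Rightarrow> (nat \<Rightarrow> nat \<Rightarrow> real vec)
      \<Rightarrow> (nat \<Rightarrow> nat \<Rightarrow> real vec)" where
  "enks_analysis m q i \<tau> N Ht Rt yt z W E =
     (let Ebar = (\<lambda>l. sample_mean m N (\<lambda>n. E n l));
          h = (\<lambda>n. diff_quot \<tau> Ht (z i) (E n i - Ebar i));
          A = (\<lambda>l. sample_outer m q N (\<lambda>n. E n l - Ebar l) h);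
          D = sample_outer q q N h h
      in (\<lambda>n l. E n l + (A l * minv (D + Rt)) *\<^sub>v
            (yt - W n - Ht (z i) - diff_quot \<tau> Ht (z i) (E n i - z i))))"

text \<open>\<open>enks_ensemble \<dots> i n l\<close> is block \<open>l \<le> i\<close> of member \<open>n\<close> of the analysis ensemble \<open>X\<^bsub>0:i|i\<^esub>\<close>, for
  the inputs \<open>X0 n\<close>, \<open>V i n\<close>, \<open>W i n\<close> of one outer iteration linearized at \<open>z\<close>. Blocks \<open>l > i\<close> are
  meaningless and get overwritten by the later forecasts.\<close>

primrec enks_ensemble ::
    "nat \<Rightarrow> (nat \<Rightarrow> nat) \<Rightarrow> (nat \<Rightarrow> real vec \<Rightarrow> real vec) \<Rightarrow> (nat \<Rightarrow> real vec \<Rightarrow> real vec)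
      \<Rightarrow> (nat \<Rightarrow> real vec) \<Rightarrow> (nat \<Rightarrow> real vec) \<Rightarrow> (nat \<Rightarrow> real mat) \<Rightarrow> real
      \<Rightarrow> real \<Rightarrow> nat \<Rightarrow> (nat \<Rightarrow> real vec)
      \<Rightarrow> (nat \<Rightarrow> real vec) \<Rightarrow> (nat \<Rightarrow> nat \<Rightarrow> real vec) \<Rightarrow> (nat \<Rightarrow> nat \<Rightarrow> real vec)
      \<Rightarrow> nat \<Rightarrow> (nat \<Rightarrow> nat \<Rightarrow> real vec)" where
  "enks_ensemble m d M H \<mu> y R \<gamma> \<tau> N z X0 V W 0 = (\<lambda>n l. X0 n)"
| "enks_ensemble m d M H \<mu> y R \<gamma> \<tau> N z X0 V W (Suc i) =
     enks_analysis m (d (Suc i) + m) (Suc i) \<tau> N (aug_obs (H (Suc i)))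
       (aug_cov (d (Suc i)) m \<gamma> (R (Suc i))) (y (Suc i) @\<^sub>v z (Suc i)) z (W (Suc i))
       (enks_forecast (Suc i) \<tau> (M (Suc i)) (\<mu> (Suc i)) z (V (Suc i))
          (enks_ensemble m d M H \<mu> y R \<gamma> \<tau> N z X0 V W i))"

text \<open>The iterates for one realization \<open>X0 j n\<close>, \<open>V j i n\<close>, \<open>W j i n\<close> of the random inputs; \<open>N j\<close> is
  the ensemble size in iteration \<open>j\<close>.\<close>

primrec enks_iterate ::
    "nat \<Rightarrow> nat \<Rightarrow> (nat \<Rightarrow> nat) \<Rightarrow> (nat \<Rightarrow> real vec \<Rightarrow> real vec) \<Rightarrow> (nat \<Rightarrow> real vec \<Rightarrow> real vec)
      \<Rightarrow> (nat \<Rightarrow> real vec) \<Rightarrow> (nat \<Rightarrow> real vec) \<Rightarrow> (nat \<Rightarrow> real mat) \<Rightarrow> real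
      \<Rightarrow> (nat \<Rightarrow> real vec)
      \<Rightarrow> (nat \<Rightarrow> nat \<Rightarrow> real vec) \<Rightarrow> (nat \<Rightarrow> nat \<Rightarrow> nat \<Rightarrow> real vec)
      \<Rightarrow> (nat \<Rightarrow> nat \<Rightarrow> nat \<Rightarrow> real vec)
      \<Rightarrow> real \<Rightarrow> (nat \<Rightarrow> nat) \<Rightarrow> nat \<Rightarrow> (nat \<Rightarrow> real vec)" where
  "enks_iterate k m d M H \<mu> y R \<gamma> x0 X0 V W \<tau> N 0 = x0"
| "enks_iterate k m d M H \<mu> y R \<gamma> x0 X0 V W \<tau> N (Suc j) =
     (\<lambda>l. sample_mean m (N (Suc j)) (\<lambda>n.
        enks_ensemble m d M H \<mu> y R \<gamma> \<tau> (N (Suc j))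
          (enks_iterate k m d M H \<mu> y R \<gamma> x0 X0 V W \<tau> N j)
          (X0 (Suc j)) (V (Suc j)) (W (Suc j)) k n l))"

text \<open>Indices of the random inputs: \<open>Init j n\<close>, \<open>Model j i n\<close> and \<open>Obs j i n\<close> stand for
  \<open>X\<^bsub>0|0\<^esub>\<^bsup>j,n\<^esup>\<close>, \<open>V\<^sub>i\<^bsup>j,n\<^esup>\<close> and \<open>W\<^sub>i\<^bsup>j,n\<^esup>\<close> (with tilde).\<close>

datatype input_index = Init nat nat | Model nat nat nat | Obs nat nat nat

primrec input_dim :: "nat \<Rightarrow> (nat \<Rightarrow> nat) \<Rightarrow> input_index \<Rightarrow> nat" where
  "input_dim m d (Init j n) = m"
| "input_dim m d (Model j i n) = m"
| "input_dim m d (Obs j i n) = d i + m"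

primrec input_family ::
    "(nat \<Rightarrow> nat \<Rightarrow> 'w \<Rightarrow> real vec) \<Rightarrow> (nat \<Rightarrow> nat \<Rightarrow> nat \<Rightarrow> 'w \<Rightarrow> real vec)
      \<Rightarrow> (nat \<Rightarrow> nat \<Rightarrow> nat \<Rightarrow> 'w \<Rightarrow> real vec) \<Rightarrow> input_index \<Rightarrow> 'w \<Rightarrow> real vec" where
  "input_family X0 V W (Init j n) = X0 j n"
| "input_family X0 V W (Model j i n) = V j i n"
| "input_family X0 V W (Obs j i n) = W j i n"

definition input_indices :: "nat \<Rightarrow> input_index set" where
  "input_indices k =
     {Init j n | j n. j \<ge> 1 \<and> n \<ge> 1}
     \<union> {Model j i n | j i n. j \<ge> 1 \<and> i \<in> {1..k} \<and> n \<ge> 1}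
     \<union> {Obs j i n | j i n. j \<ge> 1 \<and> i \<in> {1..k} \<and> n \<ge> 1}"

text \<open>The filter \<open>min {N\<^sub>1, \<dots>, N\<^sub>j} \<rightarrow> \<infinity>\<close> on sequences of admissible ensemble sizes.\<close>

definition admissible_sizes :: "(nat \<Rightarrow> nat) set" where
  "admissible_sizes = {N. \<forall>i\<ge>1. N i \<ge> 2}"

definition sizes_at_top :: "nat \<Rightarrow> (nat \<Rightarrow> nat) filter" where
  "sizes_at_top j =
     inf (filtercomap (\<lambda>N. Min (N ` {1..j})) at_top) (principal admissible_sizes)"

end

theory Submission
  imports Defs "Jordan_Normal_Form.Determinant" "HOL-Real_Asymp.Real_Asymp"
begin

text \<open>
  For fixed ensemble sizes the iterates converge pathwise as \<open>\<tau> \<rightarrow> 0\<close>: by the mean value theorem and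
  continuity of the Jacobians, difference quotients at converging base points and directions
  converge, and \<open>D + R\<close> stays invertible. The limit is the algorithm linearized at its own previous
  iterate. There, every step acts on the members of the ensemble by one affine map, so that the
  sample means and covariances obey a closed recursion whose only inputs are the sample means and
  covariances of the random vectors. Those converge by the weak law of large numbers, and the limiting
  recursion is the Kalman smoother, whose mean minimizes the Levenberg-Marquardt objective.
\<close>

section \<open>Componentwise limits of vectors and matrices\<close>

text \<open>The obstacle is dependence. After one analysis step all members of a finite ensemble
  share a gain computed from the whole ensemble, and the linearization point of the next outer
  iteration is random as well, so no law of large numbers applies to the members themselves. It is
  applied to the raw inputs only; everything after that is a continuous function of finitely many
  averages. To make this literal, convergence in probability becomes ordinary convergence along a
  filter on pairs (sizes, outcome), and the large-ensemble argument is a deterministic limit theorem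
  along an arbitrary filter. Sample cross-covariances between the ensemble and fresh noise vanish
  only in the limit, so the induction over time carries them as an invariant. The Kalman recursion
  is matched with the objective through a bilinear form tested on block vectors, which avoids
  inverting a matrix with (k+1)m rows. The stacked observation (H x, x) with noise covariance
  diag(R, 1/\<gamma>) turns the Levenberg-Marquardt penalty into an ordinary observation
  term.\<close>

definition vec_tendsto :: "nat \<Rightarrow> ('t \<Rightarrow> real vec) \<Rightarrow> real vec \<Rightarrow> 't filter \<Rightarrow> bool" where
  "vec_tendsto n X x F \<longleftrightarrow> x \<in> carrier_vec n \<and> (\<forall>\<^sub>F t in F. X t \<in> carrier_vec n) \<and>
     (\<forall>a<n. ((\<lambda>t. X t $ a) \<longlongrightarrow> x $ a) F)"

definition mat_tendsto ::
    "nat \<Rightarrow> nat \<Rightarrow> ('t \<Rightarrow> real mat) \<Rightarrow> real mat \<Rightarrow> 't filter \<Rightarrow> bool" where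
  "mat_tendsto r c X x F \<longleftrightarrow> x \<in> carrier_mat r c \<and> (\<forall>\<^sub>F t in F. X t \<in> carrier_mat r c) \<and>
     (\<forall>a<r. \<forall>b<c. ((\<lambda>t. X t $$ (a, b)) \<longlongrightarrow> x $$ (a, b)) F)"

text \<open>The entry formula \<open>f\<close> has to agree with \<open>X\<close> only eventually,
  because the entries of sums, products and inverses are given by their formulas only once the
  dimensions are right.\<close>

lemma vec_tendstoI:
  assumes "x \<in> carrier_vec n"
    and "\<forall>\<^sub>F t in F. X t \<in> carrier_vec n \<and> (\<forall>a<n. X t $ a = f t a)"
    and "\<And>a. a < n \<Longrightarrow> ((\<lambda>t. f t a) \<longlongrightarrow> x $ a) F"
  shows "vec_tendsto n X x F"
  unfolding vec_tendsto_def
proof (intro conjI allI impI)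
  show "\<forall>\<^sub>F t in F. X t \<in> carrier_vec n"
    using assms(2) by (rule eventually_mono) simp
  fix a assume a: "a < n"
  have "\<forall>\<^sub>F t in F. X t $ a = f t a"
    using assms(2) by (rule eventually_mono) (use a in simp)
  with assms(3)[OF a] show "((\<lambda>t. X t $ a) \<longlongrightarrow> x $ a) F"
    by (simp add: tendsto_cong)
qed (rule assms(1))

lemma mat_tendstoI:
  assumes "x \<in> carrier_mat r c"
    and "\<forall>\<^sub>F t in F. X t \<in> carrier_mat r c \<and> (\<forall>a<r. \<forall>b<c. X t $$ (a, b) = f t a b)"
    and "\<And>a b. a < r \<Longrightarrow> b < c \<Longrightarrow> ((\<lambda>t. f t a b) \<longlongrightarrow> x $$ (a, b)) F"
  shows "mat_tendsto r c X x F"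
  unfolding mat_tendsto_def
proof (intro conjI allI impI)
  show "\<forall>\<^sub>F t in F. X t \<in> carrier_mat r c"
    using assms(2) by (rule eventually_mono) simp
  fix a b assume a: "a < r" "b < c"
  have "\<forall>\<^sub>F t in F. X t $$ (a, b) = f t a b"
    using assms(2) by (rule eventually_mono) (use a in simp)
  with assms(3)[OF a] show "((\<lambda>t. X t $$ (a, b)) \<longlongrightarrow> x $$ (a, b)) F"
    by (simp add: tendsto_cong)
qed (rule assms(1))

lemma vec_tendstoD:
  assumes "vec_tendsto n X x F"
  shows "x \<in> carrier_vec n" "\<forall>\<^sub>F t in F. X t \<in> carrier_vec n"
    "a < n \<Longrightarrow> ((\<lambda>t. X t $ a) \<longlongrightarrow> x $ a) F"
  using assms unfolding vec_tendsto_def by auto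

lemma mat_tendstoD:
  assumes "mat_tendsto r c X x F"
  shows "x \<in> carrier_mat r c" "\<forall>\<^sub>F t in F. X t \<in> carrier_mat r c"
    "a < r \<Longrightarrow> b < c \<Longrightarrow> ((\<lambda>t. X t $$ (a, b)) \<longlongrightarrow> x $$ (a, b)) F"
  using assms unfolding mat_tendsto_def by auto

lemma vec_tendsto_cong:
  assumes "vec_tendsto n X x F" and "\<forall>\<^sub>F t in F. X t = Y t"
  shows "vec_tendsto n Y x F"
proof (rule vec_tendstoI)
  show "x \<in> carrier_vec n"
    by (rule vec_tendstoD(1)[OF assms(1)])
  show "\<forall>\<^sub>F t in F. Y t \<in> carrier_vec n \<and> (\<forall>a<n. Y t $ a = X t $ a)"
    using assms(2) vec_tendstoD(2)[OF assms(1)] by eventually_elim auto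
qed (rule vec_tendstoD(3)[OF assms(1)])

lemma mat_tendsto_cong:
  assumes "mat_tendsto r c X x F" and "\<forall>\<^sub>F t in F. X t = Y t"
  shows "mat_tendsto r c Y x F"
proof (rule mat_tendstoI)
  show "x \<in> carrier_mat r c"
    by (rule mat_tendstoD(1)[OF assms(1)])
  show "\<forall>\<^sub>F t in F. Y t \<in> carrier_mat r c \<and> (\<forall>a<r. \<forall>b<c. Y t $$ (a, b) = X t $$ (a, b))"
    using assms(2) mat_tendstoD(2)[OF assms(1)] by eventually_elim auto
qed (rule mat_tendstoD(3)[OF assms(1)])

lemma vec_tendsto_const: "x \<in> carrier_vec n \<Longrightarrow> vec_tendsto n (\<lambda>_. x) x F"
  unfolding vec_tendsto_def by auto

lemma mat_tendsto_const: "x \<in> carrier_mat r c \<Longrightarrow> mat_tendsto r c (\<lambda>_. x) x F"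
  unfolding mat_tendsto_def by auto

lemma vec_tendsto_add:
  assumes "vec_tendsto n X x F" "vec_tendsto n Y y F"
  shows "vec_tendsto n (\<lambda>t. X t + Y t) (x + y) F"
proof (rule vec_tendstoI)
  show "x + y \<in> carrier_vec n"
    using vec_tendstoD(1)[OF assms(1)] vec_tendstoD(1)[OF assms(2)] by simp
  show "\<forall>\<^sub>F t in F. X t + Y t \<in> carrier_vec n \<and> (\<forall>a<n. (X t + Y t) $ a = X t $ a + Y t $ a)"
    using vec_tendstoD(2)[OF assms(1)] vec_tendstoD(2)[OF assms(2)] by eventually_elim auto
  fix a assume "a < n"
  then show "((\<lambda>t. X t $ a + Y t $ a) \<longlongrightarrow> (x + y) $ a) F"
    using vec_tendstoD(1)[OF assms(1)] vec_tendstoD(3)[OF assms(1), of a]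
      vec_tendstoD(1)[OF assms(2)] vec_tendstoD(3)[OF assms(2), of a]
    by (simp add: tendsto_add)
qed

lemma vec_tendsto_diff:
  assumes "vec_tendsto n X x F" "vec_tendsto n Y y F"
  shows "vec_tendsto n (\<lambda>t. X t - Y t) (x - y) F"
proof (rule vec_tendstoI)
  show "x - y \<in> carrier_vec n"
    using vec_tendstoD(1)[OF assms(1)] vec_tendstoD(1)[OF assms(2)] by simp
  show "\<forall>\<^sub>F t in F. X t - Y t \<in> carrier_vec n \<and> (\<forall>a<n. (X t - Y t) $ a = X t $ a - Y t $ a)"
    using vec_tendstoD(2)[OF assms(1)] vec_tendstoD(2)[OF assms(2)] by eventually_elim auto
  fix a assume "a < n"
  then show "((\<lambda>t. X t $ a - Y t $ a) \<longlongrightarrow> (x - y) $ a) F"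
    using vec_tendstoD(1)[OF assms(1)] vec_tendstoD(3)[OF assms(1), of a]
      vec_tendstoD(1)[OF assms(2)] vec_tendstoD(3)[OF assms(2), of a]
    by (simp add: tendsto_diff)
qed

lemma vec_tendsto_smult:
  assumes "(f \<longlongrightarrow> c) F" "vec_tendsto n X x F"
  shows "vec_tendsto n (\<lambda>t. f t \<cdot>\<^sub>v X t) (c \<cdot>\<^sub>v x) F"
proof (rule vec_tendstoI)
  show "c \<cdot>\<^sub>v x \<in> carrier_vec n"
    using vec_tendstoD(1)[OF assms(2)] by simp
  show "\<forall>\<^sub>F t in F. f t \<cdot>\<^sub>v X t \<in> carrier_vec n \<and> (\<forall>a<n. (f t \<cdot>\<^sub>v X t) $ a = f t * X t $ a)"
    using vec_tendstoD(2)[OF assms(2)] by eventually_elim auto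
  fix a assume "a < n"
  then show "((\<lambda>t. f t * X t $ a) \<longlongrightarrow> (c \<cdot>\<^sub>v x) $ a) F"
    using vec_tendstoD(1)[OF assms(2)] vec_tendstoD(3)[OF assms(2), of a]
      assms(1) by (simp add: tendsto_mult)
qed

lemma vec_tendsto_append:
  assumes "vec_tendsto n X x F" "vec_tendsto p Y y F"
  shows "vec_tendsto (n + p) (\<lambda>t. X t @\<^sub>v Y t) (x @\<^sub>v y) F"
proof (rule vec_tendstoI)
  show "x @\<^sub>v y \<in> carrier_vec (n + p)"
    using vec_tendstoD(1)[OF assms(1)] vec_tendstoD(1)[OF assms(2)] by simp
  show "\<forall>\<^sub>F t in F. X t @\<^sub>v Y t \<in> carrier_vec (n + p) \<and>
      (\<forall>a<n+p. (X t @\<^sub>v Y t) $ a = (if a < n then X t $ a else Y t $ (a - n)))"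
    using vec_tendstoD(2)[OF assms(1)] vec_tendstoD(2)[OF assms(2)]
    by eventually_elim (auto simp: append_vec_def Let_def)
  fix a assume "a < n + p"
  then show "((\<lambda>t. if a < n then X t $ a else Y t $ (a - n)) \<longlongrightarrow> (x @\<^sub>v y) $ a) F"
    using vec_tendstoD(1)[OF assms(1)] vec_tendstoD(3)[OF assms(1), of a]
      vec_tendstoD(1)[OF assms(2)] vec_tendstoD(3)[OF assms(2), of "a - n"]
    by (cases "a < n") auto
qed

lemma mat_tendsto_add:
  assumes "mat_tendsto r c X x F" "mat_tendsto r c Y y F"
  shows "mat_tendsto r c (\<lambda>t. X t + Y t) (x + y) F"
proof (rule mat_tendstoI)
  show "x + y \<in> carrier_mat r c"
    using mat_tendstoD(1)[OF assms(1)] mat_tendstoD(1)[OF assms(2)] by simp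
  show "\<forall>\<^sub>F t in F. X t + Y t \<in> carrier_mat r c \<and>
      (\<forall>a<r. \<forall>b<c. (X t + Y t) $$ (a, b) = X t $$ (a, b) + Y t $$ (a, b))"
    using mat_tendstoD(2)[OF assms(1)] mat_tendstoD(2)[OF assms(2)] by eventually_elim auto
  fix a b assume "a < r" "b < c"
  then show "((\<lambda>t. X t $$ (a, b) + Y t $$ (a, b)) \<longlongrightarrow> (x + y) $$ (a, b)) F"
    using mat_tendstoD(1)[OF assms(1)] mat_tendstoD(3)[OF assms(1), of a b]
      mat_tendstoD(1)[OF assms(2)] mat_tendstoD(3)[OF assms(2), of a b]
    by (simp add: tendsto_add)
qed

lemma mat_tendsto_transpose:
  assumes "mat_tendsto r c X x F"
  shows "mat_tendsto c r (\<lambda>t. transpose_mat (X t)) (transpose_mat x) F"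
proof (rule mat_tendstoI)
  show "transpose_mat x \<in> carrier_mat c r"
    using mat_tendstoD(1)[OF assms] by simp
  show "\<forall>\<^sub>F t in F. transpose_mat (X t) \<in> carrier_mat c r \<and>
      (\<forall>a<c. \<forall>b<r. transpose_mat (X t) $$ (a, b) = X t $$ (b, a))"
    using mat_tendstoD(2)[OF assms] by eventually_elim auto
  fix a b assume "a < c" "b < r"
  then show "((\<lambda>t. X t $$ (b, a)) \<longlongrightarrow> transpose_mat x $$ (a, b)) F"
    using mat_tendstoD(1)[OF assms] mat_tendstoD(3)[OF assms, of b a] by simp
qed

lemma mat_tendsto_mult:
  assumes "mat_tendsto r p X x F" "mat_tendsto p c Y y F"
  shows "mat_tendsto r c (\<lambda>t. X t * Y t) (x * y) F"
proof (rule mat_tendstoI)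
  show "x * y \<in> carrier_mat r c"
    using mat_tendstoD(1)[OF assms(1)] mat_tendstoD(1)[OF assms(2)] by simp
  show "\<forall>\<^sub>F t in F. X t * Y t \<in> carrier_mat r c \<and>
      (\<forall>a<r. \<forall>b<c. (X t * Y t) $$ (a, b) = (\<Sum>l\<in>{0..<p}. X t $$ (a, l) * Y t $$ (l, b)))"
    using mat_tendstoD(2)[OF assms(1)] mat_tendstoD(2)[OF assms(2)]
    by eventually_elim (auto simp: scalar_prod_def intro!: sum.cong)
  fix a b assume ab: "a < r" "b < c"
  have "((\<lambda>t. \<Sum>l\<in>{0..<p}. X t $$ (a, l) * Y t $$ (l, b)) \<longlongrightarrow>
      (\<Sum>l\<in>{0..<p}. x $$ (a, l) * y $$ (l, b))) F"
    using ab by (intro tendsto_sum tendsto_mult mat_tendstoD(3)[OF assms(1)]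
        mat_tendstoD(3)[OF assms(2)]) auto
  then show "((\<lambda>t. \<Sum>l\<in>{0..<p}. X t $$ (a, l) * Y t $$ (l, b)) \<longlongrightarrow> (x * y) $$ (a, b)) F"
    using mat_tendstoD(1)[OF assms(1)] mat_tendstoD(1)[OF assms(2)] ab
    by (auto simp: scalar_prod_def)
qed

lemma vec_tendsto_mult_mat_vec:
  assumes "mat_tendsto r c X x F" "vec_tendsto c Y y F"
  shows "vec_tendsto r (\<lambda>t. X t *\<^sub>v Y t) (x *\<^sub>v y) F"
proof (rule vec_tendstoI)
  show "x *\<^sub>v y \<in> carrier_vec r"
    using mat_tendstoD(1)[OF assms(1)] vec_tendstoD(1)[OF assms(2)] by simp
  show "\<forall>\<^sub>F t in F. X t *\<^sub>v Y t \<in> carrier_vec r \<and>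
      (\<forall>a<r. (X t *\<^sub>v Y t) $ a = (\<Sum>l\<in>{0..<c}. X t $$ (a, l) * Y t $ l))"
    using mat_tendstoD(2)[OF assms(1)] vec_tendstoD(2)[OF assms(2)]
    by eventually_elim (auto simp: scalar_prod_def intro!: sum.cong)
  fix a assume ab: "a < r"
  have "((\<lambda>t. \<Sum>l\<in>{0..<c}. X t $$ (a, l) * Y t $ l) \<longlongrightarrow>
      (\<Sum>l\<in>{0..<c}. x $$ (a, l) * y $ l)) F"
    using ab by (intro tendsto_sum tendsto_mult mat_tendstoD(3)[OF assms(1)]
        vec_tendstoD(3)[OF assms(2)]) auto
  then show "((\<lambda>t. \<Sum>l\<in>{0..<c}. X t $$ (a, l) * Y t $ l) \<longlongrightarrow> (x *\<^sub>v y) $ a) F"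
    using mat_tendstoD(1)[OF assms(1)] vec_tendstoD(1)[OF assms(2)] ab
    by (auto simp: scalar_prod_def)
qed

lemma vec_tendsto_sample_mean:
  assumes "\<And>n. n \<in> {1..N} \<Longrightarrow> vec_tendsto m (X n) (x n) F"
  shows "vec_tendsto m (\<lambda>t. sample_mean m N (\<lambda>n. X n t)) (sample_mean m N x) F"
proof (rule vec_tendstoI)
  show "\<forall>\<^sub>F t in F. sample_mean m N (\<lambda>n. X n t) \<in> carrier_vec m \<and>
      (\<forall>a<m. sample_mean m N (\<lambda>n. X n t) $ a = (\<Sum>n=1..N. X n t $ a) / real N)"
    by (simp add: sample_mean_def)
  fix a assume "a < m"
  then show "((\<lambda>t. (\<Sum>n=1..N. X n t $ a) / real N) \<longlongrightarrow> sample_mean m N x $ a) F"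
    using vec_tendstoD(3)[OF assms] unfolding sample_mean_def divide_inverse
    by (auto intro!: tendsto_intros)
qed (simp add: sample_mean_def)

lemma mat_tendsto_sample_outer:
  assumes "\<And>n. n \<in> {1..N} \<Longrightarrow> vec_tendsto r (X n) (x n) F"
    and "\<And>n. n \<in> {1..N} \<Longrightarrow> vec_tendsto c (Y n) (y n) F"
  shows "mat_tendsto r c (\<lambda>t. sample_outer r c N (\<lambda>n. X n t) (\<lambda>n. Y n t)) (sample_outer r c N x y) F"
proof (rule mat_tendstoI)
  show "\<forall>\<^sub>F t in F. sample_outer r c N (\<lambda>n. X n t) (\<lambda>n. Y n t) \<in> carrier_mat r c \<and>
      (\<forall>a<r. \<forall>b<c. sample_outer r c N (\<lambda>n. X n t) (\<lambda>n. Y n t) $$ (a, b) =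
        (\<Sum>n=1..N. X n t $ a * Y n t $ b) / (real N - 1))"
    by (simp add: sample_outer_def)
  fix a b assume "a < r" "b < c"
  then show "((\<lambda>t. (\<Sum>n=1..N. X n t $ a * Y n t $ b) / (real N - 1)) \<longlongrightarrow>
      sample_outer r c N x y $$ (a, b)) F"
    using vec_tendstoD(3)[OF assms(1)] vec_tendstoD(3)[OF assms(2)]
    unfolding sample_outer_def divide_inverse
    by (auto intro!: tendsto_intros)
qed (simp add: sample_outer_def)


section \<open>Inverse matrices\<close>

lemma minv_props:
  assumes A: "A \<in> carrier_mat n n" and "det A \<noteq> 0"
  shows "minv A \<in> carrier_mat n n" "A * minv A = 1\<^sub>m n" "minv A * A = 1\<^sub>m n"
proof -
  \<comment> \<open>\<open>mat_inverse\<close> returns \<open>None\<close> only on matrices that are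
    no units of the matrix ring, and a nonzero determinant excludes that.\<close>
  obtain B where B: "mat_inverse A = Some B"
    using mat_inverse(1)[OF A, of "()"] det_non_zero_imp_unit[OF A \<open>det A \<noteq> 0\<close>, of "()"]
    by (cases "mat_inverse A") auto
  then show "minv A \<in> carrier_mat n n" "A * minv A = 1\<^sub>m n" "minv A * A = 1\<^sub>m n"
    using mat_inverse(2)[OF A B] unfolding minv_def by auto
qed

lemma minv_unique:
  assumes A: "A \<in> carrier_mat n n" and B: "B \<in> carrier_mat n n" and AB: "A * B = 1\<^sub>m n"
  shows "minv A = B"
proof -
  have "det A * det B = 1"
    using det_mult[OF A B] AB by simp
  then have "det A \<noteq> 0"
    by auto
  note inv = minv_props[OF A this]
  have "minv A = minv A * (A * B)"
    using AB inv(1) by simp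
  also have "\<dots> = minv A * A * B"
    using assoc_mult_mat[OF inv(1) A B] by simp
  finally show ?thesis
    using inv(3) B by simp
qed

text \<open>Cramer's rule. \<open>minv\<close> is computed by Gauss-Jordan elimination, whose pivot
  choices hide continuity; the adjugate shows every entry as a quotient of determinants.\<close>

lemma minv_eq_adj_mat:
  assumes A: "A \<in> carrier_mat n n" and "det A \<noteq> 0"
  shows "minv A = (1 / det A) \<cdot>\<^sub>m adj_mat A"
proof (rule minv_unique[OF A])
  show "(1 / det A) \<cdot>\<^sub>m adj_mat A \<in> carrier_mat n n"
    using adj_mat(1)[OF A] by simp
  show "A * ((1 / det A) \<cdot>\<^sub>m adj_mat A) = 1\<^sub>m n"
    using mult_smult_distrib[OF A adj_mat(1)[OF A]] adj_mat(2)[OF A] \<open>det A \<noteq> 0\<close>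
    by (auto intro!: eq_matI)
qed

lemma tendsto_det:
  assumes "mat_tendsto n n A A0 F"
  shows "((\<lambda>t. det (A t)) \<longlongrightarrow> det A0) F"
proof -
  have A0: "A0 \<in> carrier_mat n n"
    by (rule mat_tendstoD(1)[OF assms])
  have "((\<lambda>t. \<Sum>p\<in>{p. p permutes {0..<n}}. signof p * (\<Prod>i=0..<n. A t $$ (i, p i))) \<longlongrightarrow>
      (\<Sum>p\<in>{p. p permutes {0..<n}}. signof p * (\<Prod>i=0..<n. A0 $$ (i, p i)))) F"
    by (intro tendsto_sum tendsto_mult tendsto_prod tendsto_const mat_tendstoD(3)[OF assms])
      (auto dest: permutes_in_image)
  moreover have "\<forall>\<^sub>F t in F. det (A t) =
      (\<Sum>p\<in>{p. p permutes {0..<n}}. signof p * (\<Prod>i=0..<n. A t $$ (i, p i)))"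
    using mat_tendstoD(2)[OF assms] by eventually_elim (simp add: det_def')
  ultimately show ?thesis
    using A0 by (simp add: tendsto_cong det_def')
qed

lemma mat_tendsto_delete:
  assumes "mat_tendsto n n A A0 F" and "i < n" "j < n"
  shows "mat_tendsto (n - 1) (n - 1) (\<lambda>t. mat_delete (A t) i j) (mat_delete A0 i j) F"
proof (rule mat_tendstoI)
  have A0: "A0 \<in> carrier_mat n n"
    by (rule mat_tendstoD(1)[OF assms(1)])
  then show "mat_delete A0 i j \<in> carrier_mat (n - 1) (n - 1)"
    by (simp add: mat_delete_def)
  show "\<forall>\<^sub>F t in F. mat_delete (A t) i j \<in> carrier_mat (n - 1) (n - 1) \<and>
      (\<forall>a<n - 1. \<forall>b<n - 1. mat_delete (A t) i j $$ (a, b) =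
         A t $$ (if a < i then a else Suc a, if b < j then b else Suc b))"
    using mat_tendstoD(2)[OF assms(1)] by eventually_elim (auto simp: mat_delete_def)
  fix a b assume "a < n - 1" "b < n - 1"
  then show "((\<lambda>t. A t $$ (if a < i then a else Suc a, if b < j then b else Suc b)) \<longlongrightarrow>
      mat_delete A0 i j $$ (a, b)) F"
    using mat_tendstoD(3)[OF assms(1), of "if a < i then a else Suc a" "if b < j then b else Suc b"]
      A0 assms(2,3)
    by (auto simp: mat_delete_def)
qed

text \<open>Continuity of the determinant makes \<open>A t\<close> eventually invertible, and there
  Cramer's rule applies. The unspecified value of \<open>minv\<close> at singular matrices is met
  only outside an eventual set.\<close>

lemma mat_tendsto_minv:
  assumes A: "mat_tendsto n n A A0 F" and "det A0 \<noteq> 0"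
  shows "mat_tendsto n n (\<lambda>t. minv (A t)) (minv A0) F"
proof (rule mat_tendstoI)
  have A0: "A0 \<in> carrier_mat n n"
    by (rule mat_tendstoD(1)[OF A])
  note A0_inv = minv_eq_adj_mat[OF A0 assms(2)]
  show "minv A0 \<in> carrier_mat n n"
    by (rule minv_props(1)[OF A0 assms(2)])
  have "\<forall>\<^sub>F t in F. det (A t) \<noteq> 0"
    using tendsto_det[OF A] assms(2) by (rule tendsto_imp_eventually_ne)
  with mat_tendstoD(2)[OF A]
  show "\<forall>\<^sub>F t in F. minv (A t) \<in> carrier_mat n n \<and> (\<forall>a<n. \<forall>b<n. minv (A t) $$ (a, b) =
      1 / det (A t) * ((-1)^(b + a) * det (mat_delete (A t) b a)))"
  proof eventually_elim
    case (elim t)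
    then show ?case
      using minv_eq_adj_mat[OF elim] minv_props(1)[OF elim]
      by (auto simp: adj_mat_def cofactor_def)
  qed
  fix a b assume ab: "a < n" "b < n"
  have "((\<lambda>t. 1 / det (A t) * ((-1)^(b + a) * det (mat_delete (A t) b a))) \<longlongrightarrow>
      1 / det A0 * ((-1)^(b + a) * det (mat_delete A0 b a))) F"
    using assms(2) ab
    by (intro tendsto_mult tendsto_divide tendsto_const tendsto_det[OF A]
        tendsto_det[OF mat_tendsto_delete[OF A]]) auto
  then show "((\<lambda>t. 1 / det (A t) * ((-1)^(b + a) * det (mat_delete (A t) b a))) \<longlongrightarrow>
      minv A0 $$ (a, b)) F"
    using A0 ab unfolding A0_inv by (auto simp: adj_mat_def cofactor_def)
qed

text \<open>A nonzero kernel vector would make the quadratic form vanish.\<close>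

lemma det_nonzeroI:
  assumes A: "(A :: real mat) \<in> carrier_mat n n"
    and "\<And>v. v \<in> carrier_vec n \<Longrightarrow> v \<noteq> 0\<^sub>v n \<Longrightarrow> v \<bullet> (A *\<^sub>v v) > 0"
  shows "det A \<noteq> 0"
proof
  assume "det A = 0"
  then obtain v where "v \<in> carrier_vec n" "v \<noteq> 0\<^sub>v n" "A *\<^sub>v v = 0\<^sub>v n"
    using det_0_iff_vec_prod_zero_field[OF A] by auto
  then show False
    using assms(2)[of v] by simp
qed


section \<open>Continuously differentiable maps\<close>

lemma vnorm_eq:
  assumes "v \<in> carrier_vec n"
  shows "vnorm v = sqrt (\<Sum>a<n. (v $ a)\<^sup>2)"
  using assms unfolding vnorm_def scalar_prod_def
  by (auto simp: power2_eq_square atLeast0LessThan)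

lemma vnorm_nonneg: "0 \<le> vnorm v"
  unfolding vnorm_def scalar_prod_def by (auto intro!: sum_nonneg)

lemma abs_index_le_vnorm:
  assumes "v \<in> carrier_vec n" "a < n"
  shows "\<bar>v $ a\<bar> \<le> vnorm v"
proof -
  have "(v $ a)\<^sup>2 \<le> (\<Sum>a<n. (v $ a)\<^sup>2)"
    using assms(2) by (intro member_le_sum) auto
  then show ?thesis
    unfolding vnorm_eq[OF assms(1)] by (metis real_sqrt_abs real_sqrt_le_mono)
qed

lemma vnorm_smult: "vnorm (c \<cdot>\<^sub>v v) = \<bar>c\<bar> * vnorm v"
proof -
  have "vnorm (c \<cdot>\<^sub>v v) = sqrt (\<Sum>a<dim_vec v. c\<^sup>2 * (v $ a)\<^sup>2)"
    using vnorm_eq[of "c \<cdot>\<^sub>v v" "dim_vec v"] by (simp add: power_mult_distrib)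
  then show ?thesis
    using vnorm_eq[of v "dim_vec v"]
    by (simp add: sum_distrib_left[symmetric] real_sqrt_mult)
qed

lemma vnorm_le_sum_abs:
  assumes "v \<in> carrier_vec n"
  shows "vnorm v \<le> (\<Sum>a<n. \<bar>v $ a\<bar>)"
  unfolding vnorm_eq[OF assms]
  using L2_set_le_sum_abs[of "\<lambda>a. v $ a" "{..<n}"] by (simp add: L2_set_def)

text \<open>Evaluating at a unit vector selects a column. The supremum is meaningful only over a
  bounded set, so the crude bound by the sum of all absolute entries comes first. This turns
  continuity of the Jacobian in spectral norm into continuity of its entries.\<close>

lemma abs_entry_le_spectral_norm:
  assumes A: "A \<in> carrier_mat r c" and a: "a < r" and b: "b < c"
  shows "\<bar>A $$ (a, b)\<bar> \<le> spectral_norm A"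
proof -
  let ?S = "{v \<in> carrier_vec (dim_col A). vnorm v \<le> 1}"
  have "vnorm (A *\<^sub>v v) \<le> (\<Sum>a<r. \<Sum>b<c. \<bar>A $$ (a, b)\<bar>)" if "v \<in> ?S" for v
  proof -
    have v: "v \<in> carrier_vec c" "vnorm v \<le> 1"
      using that A by auto
    have "vnorm (A *\<^sub>v v) \<le> (\<Sum>a<r. \<bar>(A *\<^sub>v v) $ a\<bar>)"
      using A v by (intro vnorm_le_sum_abs) simp
    also have "\<dots> \<le> (\<Sum>a<r. \<Sum>b<c. \<bar>A $$ (a, b)\<bar>)"
    proof (rule sum_mono)
      fix a assume "a \<in> {..<r}"
      then have "(A *\<^sub>v v) $ a = (\<Sum>b<c. A $$ (a, b) * v $ b)"
        using A v by (auto simp: scalar_prod_def atLeast0LessThan)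
      also have "\<bar>\<dots>\<bar> \<le> (\<Sum>b<c. \<bar>A $$ (a, b) * v $ b\<bar>)"
        by (rule sum_abs)
      also have "\<dots> \<le> (\<Sum>b<c. \<bar>A $$ (a, b)\<bar>)"
      proof (rule sum_mono)
        fix b assume "b \<in> {..<c}"
        then have "\<bar>v $ b\<bar> \<le> 1"
          using abs_index_le_vnorm[OF v(1), of b] v(2) by auto
        then show "\<bar>A $$ (a, b) * v $ b\<bar> \<le> \<bar>A $$ (a, b)\<bar>"
          by (auto simp: abs_mult intro: mult_left_le)
      qed
      finally show "\<bar>(A *\<^sub>v v) $ a\<bar> \<le> (\<Sum>b<c. \<bar>A $$ (a, b)\<bar>)" .
    qed
    finally show ?thesis .
  qed
  then have bdd: "bdd_above ((\<lambda>v. vnorm (A *\<^sub>v v)) ` ?S)"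
    by (intro bdd_aboveI2)
  have "vnorm (unit_vec c b) = 1"
    using b by (simp add: vnorm_def)
  then have unit: "unit_vec c b \<in> ?S"
    using A by auto
  have "\<bar>A $$ (a, b)\<bar> = \<bar>(A *\<^sub>v unit_vec c b) $ a\<bar>"
    using A a b by simp
  also have "\<dots> \<le> vnorm (A *\<^sub>v unit_vec c b)"
    using A a by (intro abs_index_le_vnorm[of _ r]) auto
  also have "\<dots> \<le> spectral_norm A"
    unfolding spectral_norm_def by (rule cSUP_upper[OF unit bdd])
  finally show ?thesis .
qed

lemma tendsto_vnorm_diff:
  assumes "vec_tendsto n X x F"
  shows "((\<lambda>t. vnorm (X t - x)) \<longlongrightarrow> 0) F"
proof -
  have "\<forall>\<^sub>F t in F. sqrt (\<Sum>a<n. (X t $ a - x $ a)\<^sup>2) = vnorm (X t - x)"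
    using vec_tendstoD(2)[OF assms]
  proof eventually_elim
    case (elim t)
    then show ?case
      using vec_tendstoD(1)[OF assms] vnorm_eq[of "X t - x" n] by simp
  qed
  moreover have "((\<lambda>t. sqrt (\<Sum>a<n. (X t $ a - x $ a)\<^sup>2)) \<longlongrightarrow> sqrt (\<Sum>a<n. (x $ a - x $ a)\<^sup>2)) F"
    by (intro tendsto_intros vec_tendstoD(3)[OF assms]) simp
  ultimately show ?thesis
    by (simp add: tendsto_cong)
qed

lemma C1_map_closed:
  assumes "C1_map n p f f'" "x \<in> carrier_vec n"
  shows "f x \<in> carrier_vec p" "f' x \<in> carrier_mat p n"
  using assms unfolding C1_map_def has_jacobian_def by auto

lemma C1_map_jacobianE:
  assumes "C1_map n p f f'" "x \<in> carrier_vec n" "0 < e"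
  obtains \<delta> where "\<delta> > 0" "\<And>h. h \<in> carrier_vec n \<Longrightarrow> vnorm h < \<delta> \<Longrightarrow>
      vnorm (f (x + h) - f x - f' x *\<^sub>v h) \<le> e * vnorm h"
proof -
  have "has_jacobian n p f (f' x) x"
    using assms(1,2) unfolding C1_map_def by auto
  then have "\<exists>\<delta>>0. \<forall>h \<in> carrier_vec n.
      vnorm h < \<delta> \<longrightarrow> vnorm (f (x + h) - f x - f' x *\<^sub>v h) \<le> e * vnorm h"
    using assms(3) unfolding has_jacobian_def by simp
  then show thesis
    using that by blast
qed

lemma C1_map_tendsto_jacobian:
  assumes C1: "C1_map n p f f'" and X: "vec_tendsto n X x F"
  shows "mat_tendsto p n (\<lambda>t. f' (X t)) (f' x) F"
  unfolding mat_tendsto_def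
proof (intro conjI allI impI)
  have x: "x \<in> carrier_vec n"
    by (rule vec_tendstoD(1)[OF X])
  show f'x: "f' x \<in> carrier_mat p n"
    by (rule C1_map_closed(2)[OF C1 x])
  show "\<forall>\<^sub>F t in F. f' (X t) \<in> carrier_mat p n"
    using vec_tendstoD(2)[OF X] by (rule eventually_mono) (rule C1_map_closed(2)[OF C1])
  fix a b assume ab: "a < p" "b < n"
  show "((\<lambda>t. f' (X t) $$ (a, b)) \<longlongrightarrow> f' x $$ (a, b)) F"
  proof (rule tendstoI)
    fix e :: real assume "0 < e"
    then obtain \<delta> where "\<delta> > 0" and \<delta>: "\<And>x'. x' \<in> carrier_vec n \<Longrightarrow> vnorm (x' - x) < \<delta> \<Longrightarrow>
        spectral_norm (f' x' - f' x) < e"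
      using C1 x unfolding C1_map_def by blast
    have "\<forall>\<^sub>F t in F. vnorm (X t - x) < \<delta>"
      using order_tendstoD(2)[OF tendsto_vnorm_diff[OF X] \<open>\<delta> > 0\<close>] .
    with vec_tendstoD(2)[OF X]
    show "\<forall>\<^sub>F t in F. dist (f' (X t) $$ (a, b)) (f' x $$ (a, b)) < e"
    proof eventually_elim
      case (elim t)
      have "f' (X t) \<in> carrier_mat p n"
        by (rule C1_map_closed(2)[OF C1 elim(1)])
      then have "\<bar>f' (X t) $$ (a, b) - f' x $$ (a, b)\<bar> \<le> spectral_norm (f' (X t) - f' x)"
        using abs_entry_le_spectral_norm[of "f' (X t) - f' x" p n a b] f'x ab
        by (simp add: minus_carrier_mat)
      then show ?case
        using \<delta>[OF elim] by (simp add: dist_real_def)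
    qed
  qed
qed

lemma C1_map_tendsto:
  assumes C1: "C1_map n p f f'" and X: "vec_tendsto n X x F"
  shows "vec_tendsto p (\<lambda>t. f (X t)) (f x) F"
  unfolding vec_tendsto_def
proof (intro conjI allI impI)
  have x: "x \<in> carrier_vec n"
    by (rule vec_tendstoD(1)[OF X])
  show fx: "f x \<in> carrier_vec p"
    by (rule C1_map_closed(1)[OF C1 x])
  show "\<forall>\<^sub>F t in F. f (X t) \<in> carrier_vec p"
    using vec_tendstoD(2)[OF X] by (rule eventually_mono) (rule C1_map_closed(1)[OF C1])
  fix a assume a: "a < p"
  \<comment> \<open>Continuity needs no small constant: with 1 in place of \<epsilon> the remainder
    is already at most \<open>vnorm h\<close>, which tends to 0.\<close>
  obtain \<delta> where "\<delta> > 0" and \<delta>: "\<And>h. h \<in> carrier_vec n \<Longrightarrow> vnorm h < \<delta> \<Longrightarrow>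
      vnorm (f (x + h) - f x - f' x *\<^sub>v h) \<le> 1 * vnorm h"
    by (rule C1_map_jacobianE[OF C1 x, of 1]) auto
  define h where "h = (\<lambda>t. X t - x)"
  have h: "vec_tendsto n h (0\<^sub>v n) F"
    using vec_tendsto_diff[OF X vec_tendsto_const[OF x]] x unfolding h_def
    by (simp add: minus_cancel_vec)
  have lin: "((\<lambda>t. (f' x *\<^sub>v h t) $ a) \<longlongrightarrow> 0) F"
    using vec_tendstoD(3)[OF vec_tendsto_mult_mat_vec[OF mat_tendsto_const h] a]
      C1_map_closed(2)[OF C1 x] a by simp
  have "((\<lambda>t. f (X t) $ a - f x $ a - (f' x *\<^sub>v h t) $ a) \<longlongrightarrow> 0) F"
  proof (rule Lim_null_comparison)
    show "((\<lambda>t. vnorm (h t)) \<longlongrightarrow> 0) F"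
      using tendsto_vnorm_diff[OF X] unfolding h_def .
    have "\<forall>\<^sub>F t in F. vnorm (h t) < \<delta>"
      using order_tendstoD(2)[OF tendsto_vnorm_diff[OF X] \<open>\<delta> > 0\<close>] unfolding h_def .
    with vec_tendstoD(2)[OF X]
    show "\<forall>\<^sub>F t in F. norm (f (X t) $ a - f x $ a - (f' x *\<^sub>v h t) $ a) \<le> vnorm (h t)"
    proof eventually_elim
      case (elim t)
      have ht: "h t \<in> carrier_vec n" and xh: "x + h t = X t"
        using elim(1) x unfolding h_def by auto
      have "f (X t) - f x - f' x *\<^sub>v h t \<in> carrier_vec p"
        using C1_map_closed[OF C1 x] C1_map_closed[OF C1 elim(1)] ht by auto
      then have "\<bar>(f (X t) - f x - f' x *\<^sub>v h t) $ a\<bar> \<le> vnorm (h t)"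
        using abs_index_le_vnorm[OF _ a] \<delta>[OF ht elim(2)] xh by fastforce
      then show ?case
        using C1_map_closed[OF C1 x] C1_map_closed[OF C1 elim(1)] ht a by simp
    qed
  qed
  then have "((\<lambda>t. f (X t) $ a - f x $ a - (f' x *\<^sub>v h t) $ a + (f' x *\<^sub>v h t) $ a + f x $ a)
      \<longlongrightarrow> 0 + 0 + f x $ a) F"
    by (intro tendsto_add lin tendsto_const)
  then show "((\<lambda>t. f (X t) $ a) \<longlongrightarrow> f x $ a) F"
    by simp
qed

text \<open>Restriction of one component to a line, so that the one-dimensional mean value theorem
  becomes available.\<close>

lemma C1_map_directional_derivative:
  assumes C1: "C1_map n p f f'" and z: "z \<in> carrier_vec n" and u: "u \<in> carrier_vec n"
    and a: "a < p"
  shows "((\<lambda>r. f (z + r \<cdot>\<^sub>v u) $ a) has_real_derivative (f' (z + r \<cdot>\<^sub>v u) *\<^sub>v u) $ a) (at r)"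
proof -
  let ?x = "z + r \<cdot>\<^sub>v u"
  have x: "?x \<in> carrier_vec n"
    using z u by simp
  show ?thesis
    unfolding has_field_derivative_def has_derivative_within_alt
  proof (intro conjI allI impI bounded_linear_mult_right)
    fix e :: real assume "0 < e"
    \<comment> \<open>The summand 1 keeps the quotient meaningful for \<open>u = 0\<close>.\<close>
    then have "0 < e / (vnorm u + 1)"
      using vnorm_nonneg[of u] by simp
    then obtain \<delta> where "\<delta> > 0" and \<delta>: "\<And>h. h \<in> carrier_vec n \<Longrightarrow> vnorm h < \<delta> \<Longrightarrow>
        vnorm (f (?x + h) - f ?x - f' ?x *\<^sub>v h) \<le> e / (vnorm u + 1) * vnorm h"
      by (rule C1_map_jacobianE[OF C1 x]) blast
    have "norm (f (z + q \<cdot>\<^sub>v u) $ a - f ?x $ a - (f' ?x *\<^sub>v u) $ a * (q - r)) \<le> e * norm (q - r)"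
      if q: "norm (q - r) < \<delta> / (vnorm u + 1)" for q
    proof -
      let ?h = "(q - r) \<cdot>\<^sub>v u"
      have h: "?h \<in> carrier_vec n" and xh: "?x + ?h = z + q \<cdot>\<^sub>v u"
        using z u by (auto simp: algebra_simps)
      have le: "vnorm ?h \<le> \<bar>q - r\<bar> * (vnorm u + 1)"
        by (simp add: vnorm_smult mult_left_mono)
      also have "\<dots> < \<delta>"
        using q vnorm_nonneg[of u] by (simp add: pos_less_divide_eq)
      finally have "vnorm (f (?x + ?h) - f ?x - f' ?x *\<^sub>v ?h) \<le> e / (vnorm u + 1) * vnorm ?h"
        by (rule \<delta>[OF h])
      also have "\<dots> \<le> e / (vnorm u + 1) * (\<bar>q - r\<bar> * (vnorm u + 1))"
        using le \<open>0 < e / (vnorm u + 1)\<close> by (intro mult_left_mono) auto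
      also have "\<dots> = e * \<bar>q - r\<bar>"
        using vnorm_nonneg[of u] by simp
      finally have bound: "vnorm (f (z + q \<cdot>\<^sub>v u) - f ?x - f' ?x *\<^sub>v ?h) \<le> e * \<bar>q - r\<bar>"
        unfolding xh .
      have c: "f (z + q \<cdot>\<^sub>v u) \<in> carrier_vec p" "f ?x \<in> carrier_vec p" "f' ?x \<in> carrier_mat p n"
        using C1_map_closed[OF C1] z u by auto
      have "\<bar>(f (z + q \<cdot>\<^sub>v u) - f ?x - f' ?x *\<^sub>v ?h) $ a\<bar> \<le> e * \<bar>q - r\<bar>"
        using abs_index_le_vnorm[of "f (z + q \<cdot>\<^sub>v u) - f ?x - f' ?x *\<^sub>v ?h" p a] bound c h a
        by auto
      then show ?thesis
        using c u a mult_mat_vec[OF c(3) u] by (simp add: mult.commute)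
    qed
    then show "\<exists>d>0. \<forall>q\<in>UNIV. norm (q - r) < d \<longrightarrow>
        norm (f (z + q \<cdot>\<^sub>v u) $ a - f ?x $ a - (f' ?x *\<^sub>v u) $ a * (q - r)) \<le> e * norm (q - r)"
      using \<open>\<delta> > 0\<close> vnorm_nonneg[of u]
      by (intro exI[of _ "\<delta> / (vnorm u + 1)"]) auto
  qed
qed

text \<open>The base point \<open>z t\<close> moves together with the step, since it is the previous
  iterate for the same step. Differentiability at \<open>z0\<close> alone would not control such
  quotients; an intermediate point plus continuity of the Jacobian does.\<close>

lemma C1_map_tendsto_diff_quot:
  assumes C1: "C1_map n p f f'" and z: "vec_tendsto n z z0 F" and u: "vec_tendsto n u u0 F"
    and \<tau>: "(\<tau> \<longlongrightarrow> 0) F" "\<forall>\<^sub>F t in F. \<tau> t > 0"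
  shows "vec_tendsto p (\<lambda>t. diff_quot (\<tau> t) f (z t) (u t)) (f' z0 *\<^sub>v u0) F"
  unfolding vec_tendsto_def
proof (intro conjI allI impI)
  have z0: "z0 \<in> carrier_vec n"
    by (rule vec_tendstoD(1)[OF z])
  show "f' z0 *\<^sub>v u0 \<in> carrier_vec p"
    using C1_map_closed(2)[OF C1 z0] vec_tendstoD(1)[OF u] by simp
  show "\<forall>\<^sub>F t in F. diff_quot (\<tau> t) f (z t) (u t) \<in> carrier_vec p"
    using vec_tendstoD(2)[OF z] vec_tendstoD(2)[OF u]
    by eventually_elim
      (auto simp: diff_quot_def intro!: minus_carrier_vec C1_map_closed(1)[OF C1])
  fix a assume a: "a < p"
  \<comment> \<open>The mean value theorem holds for each component separately, so the intermediate
    point depends on \<open>a\<close> as well as on \<open>t\<close>. It lies between 0 and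
    \<open>\<tau> t\<close> and therefore tends to 0.\<close>
  define Q where "Q = (\<lambda>t \<xi>. 0 < \<xi> \<and> \<xi> < \<tau> t \<and>
    diff_quot (\<tau> t) f (z t) (u t) $ a = (f' (z t + \<xi> \<cdot>\<^sub>v u t) *\<^sub>v u t) $ a)"
  have "\<forall>\<^sub>F t in F. \<exists>\<xi>. Q t \<xi>"
    using vec_tendstoD(2)[OF z] vec_tendstoD(2)[OF u] \<tau>(2)
  proof eventually_elim
    case (elim t)
    obtain \<xi> where \<xi>: "0 < \<xi>" "\<xi> < \<tau> t"
      "f (z t + \<tau> t \<cdot>\<^sub>v u t) $ a - f (z t + 0 \<cdot>\<^sub>v u t) $ a =
        (\<tau> t - 0) * (f' (z t + \<xi> \<cdot>\<^sub>v u t) *\<^sub>v u t) $ a"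
      using MVT2[OF elim(3), of "\<lambda>r. f (z t + r \<cdot>\<^sub>v u t) $ a"
          "\<lambda>r. (f' (z t + r \<cdot>\<^sub>v u t) *\<^sub>v u t) $ a"]
        C1_map_directional_derivative[OF C1 elim(1,2) a]
      by (metis (no_types, lifting))
    have "z t + 0 \<cdot>\<^sub>v u t = z t"
      using elim by (intro eq_vecI) auto
    moreover have "f (z t + \<tau> t \<cdot>\<^sub>v u t) \<in> carrier_vec p" "f (z t) \<in> carrier_vec p"
      using elim by (auto intro!: C1_map_closed(1)[OF C1])
    ultimately have "Q t \<xi>"
      using \<xi> a elim(3) by (auto simp: Q_def diff_quot_def)
    then show ?case ..
  qed
  then have Q: "\<forall>\<^sub>F t in F. Q t (SOME \<xi>. Q t \<xi>)"
    by (rule eventually_mono) (rule someI_ex)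
  define \<xi> where "\<xi> = (\<lambda>t. SOME \<xi>. Q t \<xi>)"
  have "(\<xi> \<longlongrightarrow> 0) F"
  proof (rule tendsto_sandwich[OF _ _ tendsto_const \<tau>(1)])
    show "\<forall>\<^sub>F t in F. 0 \<le> \<xi> t" "\<forall>\<^sub>F t in F. \<xi> t \<le> \<tau> t"
      using Q unfolding \<xi>_def Q_def by (auto elim!: eventually_mono)
  qed
  then have "vec_tendsto n (\<lambda>t. z t + \<xi> t \<cdot>\<^sub>v u t) (z0 + 0 \<cdot>\<^sub>v u0) F"
    by (intro vec_tendsto_add vec_tendsto_smult z u)
  moreover have "z0 + 0 \<cdot>\<^sub>v u0 = z0"
    using z0 vec_tendstoD(1)[OF u] by (intro eq_vecI) auto
  ultimately have "vec_tendsto n (\<lambda>t. z t + \<xi> t \<cdot>\<^sub>v u t) z0 F"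
    by simp
  from vec_tendstoD(3)[OF vec_tendsto_mult_mat_vec[OF C1_map_tendsto_jacobian[OF C1 this] u] a]
  have "((\<lambda>t. (f' (z t + \<xi> t \<cdot>\<^sub>v u t) *\<^sub>v u t) $ a) \<longlongrightarrow> (f' z0 *\<^sub>v u0) $ a) F" .
  moreover have "\<forall>\<^sub>F t in F. diff_quot (\<tau> t) f (z t) (u t) $ a =
      (f' (z t + \<xi> t \<cdot>\<^sub>v u t) *\<^sub>v u t) $ a"
    using Q unfolding \<xi>_def by (rule eventually_mono) (simp add: Q_def)
  ultimately show "((\<lambda>t. diff_quot (\<tau> t) f (z t) (u t) $ a) \<longlongrightarrow> (f' z0 *\<^sub>v u0) $ a) F"
    by (simp add: tendsto_cong)
qed

text \<open>The step is frozen here and base point and direction vary. This is the continuity from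
  which measurability of the iterates is derived. At \<tau> = 0 the factor \<open>1 / \<tau>\<close>
  is 0 and both sides are zero vectors.\<close>

lemma C1_map_tendsto_diff_quot_const:
  assumes C1: "C1_map n p f f'" and z: "vec_tendsto n z z0 F" and u: "vec_tendsto n u u0 F"
  shows "vec_tendsto p (\<lambda>t. diff_quot \<tau> f (z t) (u t)) (diff_quot \<tau> f z0 u0) F"
  unfolding diff_quot_def
  by (intro vec_tendsto_smult vec_tendsto_diff vec_tendsto_add C1_map_tendsto[OF C1] z u
      tendsto_const)

lemma aug_obs_tendsto:
  assumes "C1_map n p f f'" "vec_tendsto n X x F"
  shows "vec_tendsto (p + n) (\<lambda>t. aug_obs f (X t)) (aug_obs f x) F"
  unfolding aug_obs_def by (intro vec_tendsto_append C1_map_tendsto[OF assms(1)] assms(2))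

text \<open>The lower block of \<open>aug_obs f\<close> is the identity, whose difference quotient
  is exact for every nonzero step.\<close>

lemma diff_quot_aug_obs:
  assumes C1: "C1_map n p f f'" and "z \<in> carrier_vec n" "u \<in> carrier_vec n" and "\<tau> \<noteq> 0"
  shows "diff_quot \<tau> (aug_obs f) z u = diff_quot \<tau> f z u @\<^sub>v u"
proof (rule eq_vecI)
  have c: "f z \<in> carrier_vec p" "f (z + \<tau> \<cdot>\<^sub>v u) \<in> carrier_vec p"
    using assms by (auto intro!: C1_map_closed(1)[OF C1])
  then show "dim_vec (diff_quot \<tau> (aug_obs f) z u) = dim_vec (diff_quot \<tau> f z u @\<^sub>v u)"
    using assms unfolding diff_quot_def aug_obs_def by simp
  fix a assume "a < dim_vec (diff_quot \<tau> f z u @\<^sub>v u)"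
  then show "diff_quot \<tau> (aug_obs f) z u $ a = (diff_quot \<tau> f z u @\<^sub>v u) $ a"
    using assms c unfolding diff_quot_def aug_obs_def by (auto simp: append_vec_def Let_def)
qed

lemma aug_obs_tendsto_diff_quot:
  assumes C1: "C1_map n p f f'" and z: "vec_tendsto n z z0 F" and u: "vec_tendsto n u u0 F"
    and \<tau>: "(\<tau> \<longlongrightarrow> 0) F" "\<forall>\<^sub>F t in F. \<tau> t > 0"
  shows "vec_tendsto (p + n) (\<lambda>t. diff_quot (\<tau> t) (aug_obs f) (z t) (u t))
    ((f' z0 @\<^sub>r 1\<^sub>m n) *\<^sub>v u0) F"
proof (rule vec_tendsto_cong)
  have "(f' z0 @\<^sub>r 1\<^sub>m n) *\<^sub>v u0 = (f' z0 *\<^sub>v u0) @\<^sub>v u0"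
    using mat_mult_append[OF C1_map_closed(2)[OF C1 vec_tendstoD(1)[OF z]] one_carrier_mat
        vec_tendstoD(1)[OF u]] vec_tendstoD(1)[OF u] by simp
  then show "vec_tendsto (p + n) (\<lambda>t. diff_quot (\<tau> t) f (z t) (u t) @\<^sub>v u t)
      ((f' z0 @\<^sub>r 1\<^sub>m n) *\<^sub>v u0) F"
    using vec_tendsto_append[OF C1_map_tendsto_diff_quot[OF C1 z u \<tau>] u] by simp
  show "\<forall>\<^sub>F t in F. diff_quot (\<tau> t) f (z t) (u t) @\<^sub>v u t
      = diff_quot (\<tau> t) (aug_obs f) (z t) (u t)"
    using vec_tendstoD(2)[OF z] vec_tendstoD(2)[OF u] \<tau>(2)
    by eventually_elim (simp add: diff_quot_aug_obs[OF C1])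
qed

lemma aug_obs_tendsto_diff_quot_const:
  assumes C1: "C1_map n p f f'" and z: "vec_tendsto n z z0 F" and u: "vec_tendsto n u u0 F"
  shows "vec_tendsto (p + n) (\<lambda>t. diff_quot \<tau> (aug_obs f) (z t) (u t))
    (diff_quot \<tau> (aug_obs f) z0 u0) F"
  unfolding diff_quot_def
  by (intro vec_tendsto_smult vec_tendsto_diff vec_tendsto_add aug_obs_tendsto[OF C1] z u
      tendsto_const)

lemma C1_map_tendsto_aug_jacobian:
  assumes C1: "C1_map n p f f'" and X: "vec_tendsto n X x F"
  shows "mat_tendsto (p + n) n (\<lambda>t. f' (X t) @\<^sub>r 1\<^sub>m n) (f' x @\<^sub>r 1\<^sub>m n) F"
proof (rule mat_tendstoI)
  note J = C1_map_tendsto_jacobian[OF C1 X]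
  show "f' x @\<^sub>r 1\<^sub>m n \<in> carrier_mat (p + n) n"
    using mat_tendstoD(1)[OF J] by simp
  show "\<forall>\<^sub>F t in F. f' (X t) @\<^sub>r 1\<^sub>m n \<in> carrier_mat (p + n) n \<and>
      (\<forall>a<p+n. \<forall>b<n. (f' (X t) @\<^sub>r 1\<^sub>m n) $$ (a, b) =
        (if a < p then f' (X t) $$ (a, b) else 1\<^sub>m n $$ (a - p, b)))"
    using mat_tendstoD(2)[OF J] by eventually_elim (auto simp: append_rows_def)
  fix a b assume "a < p + n" "b < n"
  then show "((\<lambda>t. if a < p then f' (X t) $$ (a, b) else 1\<^sub>m n $$ (a - p, b)) \<longlongrightarrow>
      (f' x @\<^sub>r 1\<^sub>m n) $$ (a, b)) F"
    using mat_tendstoD(1)[OF J] mat_tendstoD(3)[OF J, of a b]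
    by (cases "a < p") (auto simp: append_rows_def)
qed


section \<open>The smoother with general finite difference operators\<close>

lemma sample_mean_carrier [simp]: "sample_mean m N X \<in> carrier_vec m"
  by (simp add: sample_mean_def)

lemma sample_outer_carrier [simp]: "sample_outer r c N X Y \<in> carrier_mat r c"
  by (simp add: sample_outer_def)

text \<open>Exchanging the sums exhibits the form as a sum over members of squares of linear
  functionals, divided by \<open>N - 1\<close>.\<close>

lemma sample_outer_psd:
  assumes v: "v \<in> carrier_vec q"
  shows "0 \<le> v \<bullet> (sample_outer q q N h h *\<^sub>v v)"
proof -
  have "v \<bullet> (sample_outer q q N h h *\<^sub>v v) =
      (\<Sum>a<q. \<Sum>b<q. \<Sum>n=1..N. (v $ a * h n $ a) * (v $ b * h n $ b) / (real N - 1))"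
    using v by (auto simp: sample_outer_def scalar_prod_def atLeast0LessThan sum_distrib_left
        sum_distrib_right sum_divide_distrib algebra_simps intro!: sum.cong)
  also have "\<dots> = (\<Sum>a<q. \<Sum>n=1..N. \<Sum>b<q. (v $ a * h n $ a) * (v $ b * h n $ b) / (real N - 1))"
    by (intro sum.cong refl sum.swap)
  also have "\<dots> = (\<Sum>n=1..N. \<Sum>a<q. \<Sum>b<q. (v $ a * h n $ a) * (v $ b * h n $ b) / (real N - 1))"
    by (rule sum.swap)
  also have "\<dots> = (\<Sum>n=1..N. (\<Sum>a<q. v $ a * h n $ a)\<^sup>2 / (real N - 1))"
    by (simp add: power2_eq_square sum_product sum_divide_distrib)
  \<comment> \<open>An index in \<open>{1..N}\<close> forces \<open>N \<ge> 1\<close>, so no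
    denominator is negative; for \<open>N = 1\<close> it is 0 and division by it gives 0.\<close>
  also have "\<dots> \<ge> 0"
    by (intro sum_nonneg divide_nonneg_nonneg) auto
  finally show ?thesis .
qed

lemma scalar_prod_self_nonneg: "0 \<le> (v :: real vec) \<bullet> v"
  by (simp add: scalar_prod_def sum_nonneg)

lemma scalar_prod_self_pos:
  assumes "(v :: real vec) \<in> carrier_vec n" "v \<noteq> 0\<^sub>v n"
  shows "0 < v \<bullet> v"
proof -
  obtain a where "a < n" "v $ a \<noteq> 0"
    using assms by (metis carrier_vecD eq_vecI index_zero_vec)
  then have "0 < (\<Sum>a\<in>{0..<n}. v $ a * v $ a)"
    by (intro sum_pos2[of _ a]) (auto simp: zero_less_mult_iff)
  then show ?thesis
    using assms(1) by (simp add: scalar_prod_def)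
qed

text \<open>The form splits along the blocks into the form of \<open>S\<close> and
  \<open>1 / \<gamma>\<close> times a squared length, and one of the two blocks of a nonzero vector
  is nonzero.\<close>

lemma sym_pos_def_aug_cov:
  assumes S: "sym_pos_def p S" and "\<gamma> > 0"
  shows "sym_pos_def (p + m) (aug_cov p m \<gamma> S)"
  unfolding sym_pos_def_def
proof (intro conjI ballI impI)
  have Sc: "S \<in> carrier_mat p p" and St: "transpose_mat S = S"
    using S unfolding sym_pos_def_def by auto
  show "aug_cov p m \<gamma> S \<in> carrier_mat (p + m) (p + m)"
    using Sc unfolding aug_cov_def by auto
  show "transpose_mat (aug_cov p m \<gamma> S) = aug_cov p m \<gamma> S"
    unfolding aug_cov_def
    by (subst transpose_four_block_mat[OF Sc]) (use St in \<open>auto intro!: cong_four_block_mat eq_matI\<close>)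
  fix v :: "real vec" assume v: "v \<in> carrier_vec (p + m)" "v \<noteq> 0\<^sub>v (p + m)"
  define a b where "a = vec_first v p" and "b = vec_last v m"
  have ab: "v = a @\<^sub>v b" "a \<in> carrier_vec p" "b \<in> carrier_vec m"
    using v unfolding a_def b_def by auto
  have "aug_cov p m \<gamma> S *\<^sub>v v = (S *\<^sub>v a) @\<^sub>v ((1 / \<gamma>) \<cdot>\<^sub>v b)"
    unfolding aug_cov_def ab(1)
    by (subst four_block_mat_mult_vec[OF Sc _ _ _ ab(2,3)]) (use Sc ab in auto)
  then have eq: "v \<bullet> (aug_cov p m \<gamma> S *\<^sub>v v) = a \<bullet> (S *\<^sub>v a) + (1 / \<gamma>) * (b \<bullet> b)"
    using scalar_prod_append[of a p b m "S *\<^sub>v a" "(1 / \<gamma>) \<cdot>\<^sub>v b"] ab Sc by simp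
  have bb: "b \<bullet> b \<ge> 0" "b \<noteq> 0\<^sub>v m \<Longrightarrow> b \<bullet> b > 0"
    using ab(3) scalar_prod_self_pos scalar_prod_self_nonneg by auto
  show "v \<bullet> (aug_cov p m \<gamma> S *\<^sub>v v) > 0"
  proof (cases "a = 0\<^sub>v p")
    case True
    then have "b \<noteq> 0\<^sub>v m"
      using v(2) ab(1) by auto
    then show ?thesis
      unfolding eq using bb(2) True Sc \<open>\<gamma> > 0\<close> by simp
  next
    case False
    then have "a \<bullet> (S *\<^sub>v a) > 0"
      using S ab(2) unfolding sym_pos_def_def by blast
    then show ?thesis
      unfolding eq using bb(1) \<open>\<gamma> > 0\<close> by (simp add: add_pos_nonneg)
  qed
qed

text \<open>The deterministic data. Probability enters only in \<open>random_inputs\<close>, so that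
  the limit theorems about the algorithm can be stated along arbitrary filters.\<close>

locale assimilation =
  fixes k m :: nat and d :: "nat \<Rightarrow> nat"
    and M H :: "nat \<Rightarrow> real vec \<Rightarrow> real vec"
    and M' H' :: "nat \<Rightarrow> real vec \<Rightarrow> real mat"
    and xb :: "real vec" and \<mu> y :: "nat \<Rightarrow> real vec"
    and B :: "real mat" and Q R :: "nat \<Rightarrow> real mat"
    and \<gamma> :: real and x0 :: "nat \<Rightarrow> real vec"
  assumes C1_M: "\<And>i. i \<in> {1..k} \<Longrightarrow> C1_map m m (M i) (M' i)"
    and C1_H: "\<And>i. i \<in> {1..k} \<Longrightarrow> C1_map m (d i) (H i) (H' i)"
    and xb_carrier: "xb \<in> carrier_vec m"
    and \<mu>_carrier: "\<And>i. i \<in> {1..k} \<Longrightarrow> \<mu> i \<in> carrier_vec m"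
    and y_carrier: "\<And>i. i \<in> {1..k} \<Longrightarrow> y i \<in> carrier_vec (d i)"
    and B_spd: "sym_pos_def m B"
    and Q_spd: "\<And>i. i \<in> {1..k} \<Longrightarrow> sym_pos_def m (Q i)"
    and R_spd: "\<And>i. i \<in> {1..k} \<Longrightarrow> sym_pos_def (d i) (R i)"
    and \<gamma>_pos: "\<gamma> > 0"
    and x0_carrier: "\<And>l. l \<in> {0..k} \<Longrightarrow> x0 l \<in> carrier_vec m"
begin

text \<open>The operators \<open>DM i z u\<close> and \<open>DH i z u\<close> stand for a derivative
  at \<open>z\<close> in direction \<open>u\<close>. With difference quotients the recursion is the
  given algorithm, with tangent maps it is its limit for \<tau> tending to 0, and one set of lemmas
  serves both.\<close>

definition forecast where
  "forecast DM i z V E =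
     (\<lambda>n::nat. (E n)(i := DM i (z (i - 1)) (E n (i - 1) - z (i - 1)) + M i (z (i - 1)) + \<mu> i + V n))"

definition gain where
  "gain DH N i z E l =
     (let Ebar = (\<lambda>l. sample_mean m N (\<lambda>n. E n l));
          h = (\<lambda>n. DH i (z i) (E n i - Ebar i))
      in sample_outer m (d i + m) N (\<lambda>n. E n l - Ebar l) h
         * minv (sample_outer (d i + m) (d i + m) N h h + aug_cov (d i) m \<gamma> (R i)))"

definition innovation where
  "innovation DH i z W E n =
     (y i @\<^sub>v z i) - W n - aug_obs (H i) (z i) - DH i (z i) (E n i - z i)"

definition analysis where
  "analysis DH N i z W E =
     (\<lambda>(n::nat) l::nat. E n l + gain DH N i z E l *\<^sub>v innovation DH i z W E n)"

primrec ensemble where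
  "ensemble DM DH N z X0 V W 0 = (\<lambda>n l. X0 n)"
| "ensemble DM DH N z X0 V W (Suc i) = analysis DH N (Suc i) z (W (Suc i))
     (forecast DM (Suc i) z (V (Suc i)) (ensemble DM DH N z X0 V W i))"

primrec iterate where
  "iterate DM DH X0 V W N 0 = x0"
| "iterate DM DH X0 V W N (Suc j) = (\<lambda>l. sample_mean m (N (Suc j)) (\<lambda>n.
     ensemble DM DH (N (Suc j)) (iterate DM DH X0 V W N j)
       (X0 (Suc j)) (V (Suc j)) (W (Suc j)) k n l))"

lemma enks_ensemble_eq:
  "enks_ensemble m d M H \<mu> y R \<gamma> \<tau> N z X0 V W i =
   ensemble (\<lambda>i. diff_quot \<tau> (M i)) (\<lambda>i. diff_quot \<tau> (aug_obs (H i))) N z X0 V W i"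
  by (induction i) (simp_all add: enks_forecast_def enks_analysis_def forecast_def analysis_def
      gain_def innovation_def Let_def)

lemma enks_iterate_eq:
  "enks_iterate k m d M H \<mu> y R \<gamma> x0 X0 V W \<tau> N j =
   iterate (\<lambda>i. diff_quot \<tau> (M i)) (\<lambda>i. diff_quot \<tau> (aug_obs (H i))) X0 V W N j"
  by (induction j) (simp_all add: enks_ensemble_eq)

lemma aug_cov_spd: "i \<in> {1..k} \<Longrightarrow> sym_pos_def (d i + m) (aug_cov (d i) m \<gamma> (R i))"
  by (rule sym_pos_def_aug_cov[OF R_spd \<gamma>_pos])

lemma aug_cov_carrier:
  "i \<in> {1..k} \<Longrightarrow> aug_cov (d i) m \<gamma> (R i) \<in> carrier_mat (d i + m) (d i + m)"
  using aug_cov_spd unfolding sym_pos_def_def by blast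

lemma det_psd_plus_aug_cov:
  assumes "i \<in> {1..k}" and D: "D \<in> carrier_mat (d i + m) (d i + m)"
    and psd: "\<And>v. v \<in> carrier_vec (d i + m) \<Longrightarrow> 0 \<le> v \<bullet> (D *\<^sub>v v)"
  shows "det (D + aug_cov (d i) m \<gamma> (R i)) \<noteq> 0"
proof (rule det_nonzeroI)
  let ?R = "aug_cov (d i) m \<gamma> (R i)"
  have R: "?R \<in> carrier_mat (d i + m) (d i + m)"
    by (rule aug_cov_carrier[OF assms(1)])
  show "D + ?R \<in> carrier_mat (d i + m) (d i + m)"
    using D R by simp
  fix v :: "real vec" assume v: "v \<in> carrier_vec (d i + m)" "v \<noteq> 0\<^sub>v (d i + m)"
  have "v \<bullet> (?R *\<^sub>v v) > 0"
    using aug_cov_spd[OF assms(1)] v unfolding sym_pos_def_def by blast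
  moreover have "v \<bullet> ((D + ?R) *\<^sub>v v) = v \<bullet> (D *\<^sub>v v) + v \<bullet> (?R *\<^sub>v v)"
    using D R v(1) by (simp add: add_mult_distrib_mat_vec scalar_prod_add_distrib[of _ "d i + m"])
  ultimately show "v \<bullet> ((D + ?R) *\<^sub>v v) > 0"
    using psd[OF v(1)] by simp
qed

text \<open>Stated for varying operators and varying inputs at once. It is used with fixed inputs
  and operators depending on \<tau>, and with a fixed \<tau> and varying inputs. The operators must
  converge jointly in base point and direction because both depend on \<open>t\<close>.\<close>

lemma ensemble_tendsto:
  assumes DM: "\<And>i z z0 u u0. i \<in> {1..k} \<Longrightarrow> vec_tendsto m z z0 F \<Longrightarrow> vec_tendsto m u u0 F \<Longrightarrow>
      vec_tendsto m (\<lambda>t. DMt t i (z t) (u t)) (DM i z0 u0) F"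
    and DH: "\<And>i z z0 u u0. i \<in> {1..k} \<Longrightarrow> vec_tendsto m z z0 F \<Longrightarrow> vec_tendsto m u u0 F \<Longrightarrow>
      vec_tendsto (d i + m) (\<lambda>t. DHt t i (z t) (u t)) (DH i z0 u0) F"
    and z: "\<And>l. l \<le> k \<Longrightarrow> vec_tendsto m (\<lambda>t. zt t l) (z l) F"
    and X0: "\<And>n. n \<in> {1..N} \<Longrightarrow> vec_tendsto m (\<lambda>t. X0t t n) (X0 n) F"
    and V: "\<And>i n. i \<in> {1..k} \<Longrightarrow> n \<in> {1..N} \<Longrightarrow> vec_tendsto m (\<lambda>t. Vt t i n) (V i n) F"
    and W: "\<And>i n. i \<in> {1..k} \<Longrightarrow> n \<in> {1..N} \<Longrightarrow>
      vec_tendsto (d i + m) (\<lambda>t. Wt t i n) (W i n) F"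
    and "i \<le> k" "l \<le> i" "n \<in> {1..N}"
  shows "vec_tendsto m (\<lambda>t. ensemble (DMt t) (DHt t) N (zt t) (X0t t) (Vt t) (Wt t) i n l)
    (ensemble DM DH N z X0 V W i n l) F"
  using assms(7-)
proof (induction i arbitrary: l n)
  case 0
  then show ?case
    using X0 by simp
next
  case (Suc i)
  let ?i = "Suc i"
  have i: "?i \<in> {1..k}"
    using Suc.prems by simp
  define E where "E = forecast DM ?i z (V ?i) (ensemble DM DH N z X0 V W i)"
  define Et where "Et t = forecast (DMt t) ?i (zt t) (Vt t ?i)
    (ensemble (DMt t) (DHt t) N (zt t) (X0t t) (Vt t) (Wt t) i)" for t
  have IH: "vec_tendsto m (\<lambda>t. ensemble (DMt t) (DHt t) N (zt t) (X0t t) (Vt t) (Wt t) i n l)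
    (ensemble DM DH N z X0 V W i n l) F" if "l \<le> i" "n \<in> {1..N}" for l n
    using Suc.IH that Suc.prems by simp
  have E: "vec_tendsto m (\<lambda>t. Et t n l) (E n l) F" if "l \<le> ?i" "n \<in> {1..N}" for l n
  proof (cases "l = ?i")
    case True
    then show ?thesis
      unfolding E_def Et_def forecast_def
      using i that Suc.prems
      by (auto intro!: vec_tendsto_add vec_tendsto_diff vec_tendsto_const DM z IH V \<mu>_carrier
          C1_map_tendsto[OF C1_M])
  next
    case False
    then show ?thesis
      unfolding E_def Et_def forecast_def using IH[of l n] that by simp
  qed
  define h where "h n = DH ?i (z ?i) (E n ?i - sample_mean m N (\<lambda>n. E n ?i))" for n
  define ht where "ht t n = DHt t ?i (zt t ?i) (Et t n ?i - sample_mean m N (\<lambda>n. Et t n ?i))"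
    for t n
  have h: "vec_tendsto (d ?i + m) (\<lambda>t. ht t n) (h n) F" if "n \<in> {1..N}" for n
    unfolding h_def ht_def using i that Suc.prems
    by (intro DH z vec_tendsto_diff vec_tendsto_sample_mean E) auto
  \<comment> \<open>Invertibility is checked at the limit; \<open>mat_tendsto_minv\<close> supplies
    it nearby.\<close>
  have det: "det (sample_outer (d ?i + m) (d ?i + m) N h h + aug_cov (d ?i) m \<gamma> (R ?i)) \<noteq> 0"
    by (rule det_psd_plus_aug_cov[OF i]) (auto intro: sample_outer_psd)
  have A: "mat_tendsto m (d ?i + m)
      (\<lambda>t. sample_outer m (d ?i + m) N (\<lambda>n. Et t n l - sample_mean m N (\<lambda>n. Et t n l)) (ht t))
      (sample_outer m (d ?i + m) N (\<lambda>n. E n l - sample_mean m N (\<lambda>n. E n l)) h) F"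
    using Suc.prems
    by (intro mat_tendsto_sample_outer vec_tendsto_diff vec_tendsto_sample_mean E h) auto
  have D: "mat_tendsto (d ?i + m) (d ?i + m)
      (\<lambda>t. sample_outer (d ?i + m) (d ?i + m) N (ht t) (ht t))
      (sample_outer (d ?i + m) (d ?i + m) N h h) F"
    by (intro mat_tendsto_sample_outer h)
  have "mat_tendsto m (d ?i + m)
      (\<lambda>t. gain (DHt t) N ?i (zt t) (Et t) l) (gain DH N ?i z E l) F"
    unfolding gain_def Let_def h_def[symmetric] ht_def[symmetric]
    by (rule mat_tendsto_mult[OF A mat_tendsto_minv[OF mat_tendsto_add[OF D
        mat_tendsto_const[OF aug_cov_carrier[OF i]]] det]])
  moreover have "vec_tendsto (d ?i + m)
      (\<lambda>t. innovation (DHt t) ?i (zt t) (Wt t ?i) (Et t) n) (innovation DH ?i z (W ?i) E n) F"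
    unfolding innovation_def
    using Suc.prems i
    by (intro vec_tendsto_diff vec_tendsto_append vec_tendsto_const y_carrier z W
        aug_obs_tendsto[OF C1_H] DH E) auto
  ultimately show ?case
    unfolding ensemble.simps analysis_def E_def[symmetric] Et_def[symmetric]
    using Suc.prems
    by (intro vec_tendsto_add vec_tendsto_mult_mat_vec E) auto
qed

lemma iterate_tendsto:
  assumes DM: "\<And>i z z0 u u0. i \<in> {1..k} \<Longrightarrow> vec_tendsto m z z0 F \<Longrightarrow> vec_tendsto m u u0 F \<Longrightarrow>
      vec_tendsto m (\<lambda>t. DMt t i (z t) (u t)) (DM i z0 u0) F"
    and DH: "\<And>i z z0 u u0. i \<in> {1..k} \<Longrightarrow> vec_tendsto m z z0 F \<Longrightarrow> vec_tendsto m u u0 F \<Longrightarrow>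
      vec_tendsto (d i + m) (\<lambda>t. DHt t i (z t) (u t)) (DH i z0 u0) F"
    and X0: "\<And>j n. j \<ge> 1 \<Longrightarrow> n \<ge> 1 \<Longrightarrow> vec_tendsto m (\<lambda>t. X0t t j n) (X0 j n) F"
    and V: "\<And>j i n. j \<ge> 1 \<Longrightarrow> i \<in> {1..k} \<Longrightarrow> n \<ge> 1 \<Longrightarrow>
      vec_tendsto m (\<lambda>t. Vt t j i n) (V j i n) F"
    and W: "\<And>j i n. j \<ge> 1 \<Longrightarrow> i \<in> {1..k} \<Longrightarrow> n \<ge> 1 \<Longrightarrow>
      vec_tendsto (d i + m) (\<lambda>t. Wt t j i n) (W j i n) F"
    and "l \<le> k"
  shows "vec_tendsto m (\<lambda>t. iterate (DMt t) (DHt t) (X0t t) (Vt t) (Wt t) N j l)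
    (iterate DM DH X0 V W N j l) F"
  using assms(6)
proof (induction j arbitrary: l)
  case 0
  then show ?case
    using x0_carrier by (simp add: vec_tendsto_const)
next
  case (Suc j)
  show ?case
    unfolding iterate.simps
    by (intro vec_tendsto_sample_mean ensemble_tendsto DM DH Suc.IH X0 V W)
      (use Suc.prems in auto)
qed

end


section \<open>Sample covariances\<close>

text \<open>Both arguments are centered. The gain instead pairs centered states with
  \<open>DH\<close> applied to centered states; for a linear \<open>DH\<close> this becomes a
  product of \<open>sample_cov\<close> with the matrix of \<open>DH\<close>.\<close>

definition sample_cov ::
    "nat \<Rightarrow> nat \<Rightarrow> nat \<Rightarrow> (nat \<Rightarrow> real vec) \<Rightarrow> (nat \<Rightarrow> real vec) \<Rightarrow> real mat" where
  "sample_cov r c N X Y =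
     sample_outer r c N (\<lambda>n. X n - sample_mean r N X) (\<lambda>n. Y n - sample_mean c N Y)"

lemma sample_cov_carrier [simp]: "sample_cov r c N X Y \<in> carrier_mat r c"
  by (simp add: sample_cov_def)

lemma sample_outer_transpose:
  "transpose_mat (sample_outer r c N X Y) = sample_outer c r N Y X"
  by (rule eq_matI) (auto simp: sample_outer_def mult.commute)

lemma sample_cov_transpose:
  "transpose_mat (sample_cov r c N X Y) = sample_cov c r N Y X"
  by (simp add: sample_cov_def sample_outer_transpose)

lemma sample_outer_cong:
  assumes "\<And>n. n \<in> {1..N} \<Longrightarrow> X n = X' n" "\<And>n. n \<in> {1..N} \<Longrightarrow> Y n = Y' n"
  shows "sample_outer r c N X Y = sample_outer r c N X' Y'"
  using assms by (simp add: sample_outer_def)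

lemma sample_mean_cong:
  assumes "\<And>n. n \<in> {1..N} \<Longrightarrow> X n = X' n"
  shows "sample_mean m N X = sample_mean m N X'"
  using assms by (simp add: sample_mean_def)

lemma sample_cov_cong:
  assumes "\<And>n. n \<in> {1..N} \<Longrightarrow> X n = X' n" "\<And>n. n \<in> {1..N} \<Longrightarrow> Y n = Y' n"
  shows "sample_cov r c N X Y = sample_cov r c N X' Y'"
  unfolding sample_cov_def
  using sample_mean_cong[of N X X' r] sample_mean_cong[of N Y Y' c] assms
  by (intro sample_outer_cong) auto

lemma sample_outer_mult_left:
  assumes A: "A \<in> carrier_mat r p" and X: "\<And>n. n \<in> {1..N} \<Longrightarrow> X n \<in> carrier_vec p"
  shows "sample_outer r c N (\<lambda>n. A *\<^sub>v X n) Y = A * sample_outer p c N X Y"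
proof (rule eq_matI)
  fix a b assume "a < dim_row (A * sample_outer p c N X Y)"
    and "b < dim_col (A * sample_outer p c N X Y)"
  then have ab: "a < r" "b < c"
    using A by (auto simp: sample_outer_def)
  have eq: "(A *\<^sub>v X n) $ a = (\<Sum>l<p. A $$ (a, l) * X n $ l)" if "n \<in> {1..N}" for n
    using A X[OF that] ab by (auto simp: scalar_prod_def atLeast0LessThan)
  have "(\<Sum>n=1..N. (A *\<^sub>v X n) $ a * Y n $ b) = (\<Sum>n=1..N. \<Sum>l<p. A $$ (a, l) * X n $ l * Y n $ b)"
    by (intro sum.cong) (auto simp: eq sum_distrib_right)
  also have "\<dots> = (\<Sum>l<p. A $$ (a, l) * (\<Sum>n=1..N. X n $ l * Y n $ b))"
    by (subst sum.swap) (simp add: sum_distrib_left mult.assoc)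
  finally show "sample_outer r c N (\<lambda>n. A *\<^sub>v X n) Y $$ (a, b) = (A * sample_outer p c N X Y) $$ (a, b)"
    using A ab
    by (simp add: sample_outer_def scalar_prod_def atLeast0LessThan sum_divide_distrib[symmetric])
qed (use A in \<open>auto simp: sample_outer_def\<close>)

lemma sample_outer_add_left:
  assumes "\<And>n. n \<in> {1..N} \<Longrightarrow> X n \<in> carrier_vec r" "\<And>n. n \<in> {1..N} \<Longrightarrow> Z n \<in> carrier_vec r"
  shows "sample_outer r c N (\<lambda>n. X n + Z n) Y = sample_outer r c N X Y + sample_outer r c N Z Y"
proof (rule eq_matI)
  fix a b assume "a < dim_row (sample_outer r c N X Y + sample_outer r c N Z Y)"
    and "b < dim_col (sample_outer r c N X Y + sample_outer r c N Z Y)"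
  then have ab: "a < r" "b < c"
    by (auto simp: sample_outer_def)
  have "(\<Sum>n=1..N. (X n + Z n) $ a * Y n $ b) =
      (\<Sum>n=1..N. X n $ a * Y n $ b) + (\<Sum>n=1..N. Z n $ a * Y n $ b)"
    unfolding sum.distrib[symmetric]
  proof (rule sum.cong[OF refl])
    fix n assume "n \<in> {1..N}"
    from assms(1)[OF this] assms(2)[OF this]
    show "(X n + Z n) $ a * Y n $ b = X n $ a * Y n $ b + Z n $ a * Y n $ b"
      using ab by (simp add: distrib_right)
  qed
  then show "sample_outer r c N (\<lambda>n. X n + Z n) Y $$ (a, b) =
      (sample_outer r c N X Y + sample_outer r c N Z Y) $$ (a, b)"
    using ab by (simp add: sample_outer_def add_divide_distrib)
qed (auto simp: sample_outer_def)

text \<open>Two linear terms and a shift are the common shape of the forecast (state and model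
  noise), the innovation (state and observation noise) and the update (state and innovation). The
  average of the constant \<open>c\<close> is \<open>c\<close> only for a nonempty ensemble.\<close>

lemma sample_mean_affine:
  assumes A: "A \<in> carrier_mat r p" and A': "A' \<in> carrier_mat r p'" and c: "c \<in> carrier_vec r"
    and X: "\<And>n. n \<in> {1..N} \<Longrightarrow> X n \<in> carrier_vec p"
    and Z: "\<And>n. n \<in> {1..N} \<Longrightarrow> Z n \<in> carrier_vec p'"
    and N: "N \<noteq> 0"
  shows "sample_mean r N (\<lambda>n. A *\<^sub>v X n + A' *\<^sub>v Z n + c) =
    A *\<^sub>v sample_mean p N X + A' *\<^sub>v sample_mean p' N Z + c"
proof (rule eq_vecI)
  fix a assume "a < dim_vec (A *\<^sub>v sample_mean p N X + A' *\<^sub>v sample_mean p' N Z + c)"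
  then have a: "a < r"
    using c by simp
  have eq: "(A *\<^sub>v X n + A' *\<^sub>v Z n + c) $ a =
      (\<Sum>l<p. A $$ (a, l) * X n $ l) + (\<Sum>l<p'. A' $$ (a, l) * Z n $ l) + c $ a"
    if "n \<in> {1..N}" for n
    using A A' c X[OF that] Z[OF that] a by (auto simp: scalar_prod_def atLeast0LessThan)
  have "(\<Sum>n=1..N. (A *\<^sub>v X n + A' *\<^sub>v Z n + c) $ a) =
      (\<Sum>n=1..N. \<Sum>l<p. A $$ (a, l) * X n $ l) + (\<Sum>n=1..N. \<Sum>l<p'. A' $$ (a, l) * Z n $ l)
      + real N * c $ a"
    by (simp add: eq sum.distrib)
  also have "\<dots> = (\<Sum>l<p. A $$ (a, l) * (\<Sum>n=1..N. X n $ l))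
      + (\<Sum>l<p'. A' $$ (a, l) * (\<Sum>n=1..N. Z n $ l)) + real N * c $ a"
    by (simp only: sum.swap[of _ "{1..N}"] sum_distrib_left)
  finally show "sample_mean r N (\<lambda>n. A *\<^sub>v X n + A' *\<^sub>v Z n + c) $ a =
      (A *\<^sub>v sample_mean p N X + A' *\<^sub>v sample_mean p' N Z + c) $ a"
    using A A' c a N
    by (simp add: sample_mean_def scalar_prod_def atLeast0LessThan sum_divide_distrib[symmetric]
        add_divide_distrib)
qed (use c in \<open>auto simp: sample_mean_def\<close>)

text \<open>Centering removes the shift, and what remains is bilinear.\<close>

lemma sample_cov_affine_left:
  assumes A: "A \<in> carrier_mat r p" and A': "A' \<in> carrier_mat r p'" and c: "c \<in> carrier_vec r"
    and X: "\<And>n. n \<in> {1..N} \<Longrightarrow> X n \<in> carrier_vec p"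
    and Z: "\<And>n. n \<in> {1..N} \<Longrightarrow> Z n \<in> carrier_vec p'"
    and N: "N \<noteq> 0"
  shows "sample_cov r q N (\<lambda>n. A *\<^sub>v X n + A' *\<^sub>v Z n + c) Y =
    A * sample_cov p q N X Y + A' * sample_cov p' q N Z Y"
proof -
  let ?U = "\<lambda>n. A *\<^sub>v X n + A' *\<^sub>v Z n + c"
  let ?x = "sample_mean p N X" and ?z = "sample_mean p' N Z"
  have mean: "sample_mean r N ?U = A *\<^sub>v ?x + A' *\<^sub>v ?z + c"
    by (rule sample_mean_affine[OF A A' c X Z N])
  have center: "?U n - sample_mean r N ?U = A *\<^sub>v (X n - ?x) + A' *\<^sub>v (Z n - ?z)"
    if n: "n \<in> {1..N}" for n
  proof -
    have "A *\<^sub>v (X n - ?x) = A *\<^sub>v X n - A *\<^sub>v ?x"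
      by (rule mult_minus_distrib_mat_vec[OF A X[OF n]]) simp
    moreover have "A' *\<^sub>v (Z n - ?z) = A' *\<^sub>v Z n - A' *\<^sub>v ?z"
      by (rule mult_minus_distrib_mat_vec[OF A' Z[OF n]]) simp
    moreover have "A *\<^sub>v X n \<in> carrier_vec r" "A *\<^sub>v ?x \<in> carrier_vec r"
      "A' *\<^sub>v Z n \<in> carrier_vec r" "A' *\<^sub>v ?z \<in> carrier_vec r"
      using A A' X[OF n] Z[OF n] by auto
    moreover have "a + b + c - (a' + b' + c) = (a - a') + (b - b')"
      if "a \<in> carrier_vec r" "a' \<in> carrier_vec r" "b \<in> carrier_vec r" "b' \<in> carrier_vec r"
      for a a' b b' :: "real vec"
      using that c by (intro eq_vecI) auto
    ultimately show ?thesis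
      unfolding mean by simp
  qed
  have "sample_cov r q N ?U Y = sample_outer r q N (\<lambda>n. A *\<^sub>v (X n - ?x) + A' *\<^sub>v (Z n - ?z))
      (\<lambda>n. Y n - sample_mean q N Y)"
    unfolding sample_cov_def by (rule sample_outer_cong) (auto simp: center)
  also have "\<dots> = sample_outer r q N (\<lambda>n. A *\<^sub>v (X n - ?x)) (\<lambda>n. Y n - sample_mean q N Y)
      + sample_outer r q N (\<lambda>n. A' *\<^sub>v (Z n - ?z)) (\<lambda>n. Y n - sample_mean q N Y)"
    using X Z by (intro sample_outer_add_left mult_mat_vec_carrier[OF A] mult_mat_vec_carrier[OF A'])
      (auto intro: minus_carrier_vec)
  also have "\<dots> = A * sample_cov p q N X Y + A' * sample_cov p' q N Z Y"
    unfolding sample_cov_def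
    by (intro arg_cong2[of _ _ _ _ "(+)"] sample_outer_mult_left[OF A] sample_outer_mult_left[OF A']
        minus_carrier_vec X Z) simp_all
  finally show ?thesis .
qed

lemma eventually_carriers_affine:
  assumes A: "mat_tendsto r p A A0 F" and A': "mat_tendsto r p' A' A0' F"
    and c: "vec_tendsto r c c0 F"
    and X: "\<forall>\<^sub>F t in F. \<forall>n\<in>{1..N t}. X t n \<in> carrier_vec p"
    and Z: "\<forall>\<^sub>F t in F. \<forall>n\<in>{1..N t}. Z t n \<in> carrier_vec p'"
    and U: "\<forall>\<^sub>F t in F. \<forall>n\<in>{1..N t}. U t n = A t *\<^sub>v X t n + A' t *\<^sub>v Z t n + c t"
  shows "\<forall>\<^sub>F t in F. \<forall>n\<in>{1..N t}. U t n \<in> carrier_vec r"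
  using mat_tendstoD(2)[OF A] mat_tendstoD(2)[OF A'] vec_tendstoD(2)[OF c] X Z U
  by eventually_elim (simp add: mult_mat_vec_carrier[of _ r])

text \<open>The coefficients may depend on the whole ensemble, as the gain does, but not on the
  member \<open>n\<close>. Hence they can be taken out of the average before passing to the
  limit.\<close>

lemma tendsto_sample_mean_affine:
  assumes A: "mat_tendsto r p A A0 F" and A': "mat_tendsto r p' A' A0' F"
    and c: "vec_tendsto r c c0 F"
    and X: "\<forall>\<^sub>F t in F. \<forall>n\<in>{1..N t}. X t n \<in> carrier_vec p"
    and Z: "\<forall>\<^sub>F t in F. \<forall>n\<in>{1..N t}. Z t n \<in> carrier_vec p'"
    and U: "\<forall>\<^sub>F t in F. \<forall>n\<in>{1..N t}. U t n = A t *\<^sub>v X t n + A' t *\<^sub>v Z t n + c t"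
    and N: "\<forall>\<^sub>F t in F. N t \<ge> 2"
    and "vec_tendsto p (\<lambda>t. sample_mean p (N t) (X t)) x F"
    and "vec_tendsto p' (\<lambda>t. sample_mean p' (N t) (Z t)) z F"
  shows "vec_tendsto r (\<lambda>t. sample_mean r (N t) (U t)) (A0 *\<^sub>v x + A0' *\<^sub>v z + c0) F"
proof (rule vec_tendsto_cong)
  show "vec_tendsto r (\<lambda>t. A t *\<^sub>v sample_mean p (N t) (X t) + A' t *\<^sub>v sample_mean p' (N t) (Z t)
      + c t) (A0 *\<^sub>v x + A0' *\<^sub>v z + c0) F"
    by (rule vec_tendsto_add[OF vec_tendsto_add[OF vec_tendsto_mult_mat_vec[OF A assms(8)]
        vec_tendsto_mult_mat_vec[OF A' assms(9)]] c])
  show "\<forall>\<^sub>F t in F. A t *\<^sub>v sample_mean p (N t) (X t) + A' t *\<^sub>v sample_mean p' (N t) (Z t) + c t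
      = sample_mean r (N t) (U t)"
    using mat_tendstoD(2)[OF A] mat_tendstoD(2)[OF A'] vec_tendstoD(2)[OF c] X Z U N
  proof eventually_elim
    case (elim t)
    have "sample_mean r (N t) (U t) = sample_mean r (N t) (\<lambda>n. A t *\<^sub>v X t n + A' t *\<^sub>v Z t n + c t)"
      using elim(6) by (intro sample_mean_cong) auto
    then show ?case
      using sample_mean_affine[OF elim(1-3), of "N t" "X t" "Z t"] elim by simp
  qed
qed

lemma tendsto_sample_cov_affine_left:
  assumes A: "mat_tendsto r p A A0 F" and A': "mat_tendsto r p' A' A0' F"
    and c: "vec_tendsto r c c0 F"
    and X: "\<forall>\<^sub>F t in F. \<forall>n\<in>{1..N t}. X t n \<in> carrier_vec p"
    and Z: "\<forall>\<^sub>F t in F. \<forall>n\<in>{1..N t}. Z t n \<in> carrier_vec p'"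
    and U: "\<forall>\<^sub>F t in F. \<forall>n\<in>{1..N t}. U t n = A t *\<^sub>v X t n + A' t *\<^sub>v Z t n + c t"
    and N: "\<forall>\<^sub>F t in F. N t \<ge> 2"
    and "mat_tendsto p q (\<lambda>t. sample_cov p q (N t) (X t) (Y t)) C F"
    and "mat_tendsto p' q (\<lambda>t. sample_cov p' q (N t) (Z t) (Y t)) C' F"
  shows "mat_tendsto r q (\<lambda>t. sample_cov r q (N t) (U t) (Y t)) (A0 * C + A0' * C') F"
proof (rule mat_tendsto_cong)
  show "mat_tendsto r q (\<lambda>t. A t * sample_cov p q (N t) (X t) (Y t)
      + A' t * sample_cov p' q (N t) (Z t) (Y t)) (A0 * C + A0' * C') F"
    by (rule mat_tendsto_add[OF mat_tendsto_mult[OF A assms(8)] mat_tendsto_mult[OF A' assms(9)]])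
  show "\<forall>\<^sub>F t in F. A t * sample_cov p q (N t) (X t) (Y t)
      + A' t * sample_cov p' q (N t) (Z t) (Y t) = sample_cov r q (N t) (U t) (Y t)"
    using mat_tendstoD(2)[OF A] mat_tendstoD(2)[OF A'] vec_tendstoD(2)[OF c] X Z U N
  proof eventually_elim
    case (elim t)
    have "sample_cov r q (N t) (U t) (Y t) =
        sample_cov r q (N t) (\<lambda>n. A t *\<^sub>v X t n + A' t *\<^sub>v Z t n + c t) (Y t)"
      using elim(6) by (intro sample_cov_cong) auto
    then show ?case
      using sample_cov_affine_left[OF elim(1-3), of "N t" "X t" "Z t" q "Y t"] elim by simp
  qed
qed

lemma tendsto_sample_cov_swap:
  assumes "mat_tendsto r c (\<lambda>t. sample_cov r c (N t) (X t) (Y t)) C F"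
  shows "mat_tendsto c r (\<lambda>t. sample_cov c r (N t) (Y t) (X t)) (transpose_mat C) F"
  using mat_tendsto_transpose[OF assms] by (simp add: sample_cov_transpose)

text \<open>The left version, applied between two transpositions.\<close>

lemma tendsto_sample_cov_affine_right:
  assumes A: "mat_tendsto r p A A0 F" and A': "mat_tendsto r p' A' A0' F"
    and c: "vec_tendsto r c c0 F"
    and X: "\<forall>\<^sub>F t in F. \<forall>n\<in>{1..N t}. X t n \<in> carrier_vec p"
    and Z: "\<forall>\<^sub>F t in F. \<forall>n\<in>{1..N t}. Z t n \<in> carrier_vec p'"
    and U: "\<forall>\<^sub>F t in F. \<forall>n\<in>{1..N t}. U t n = A t *\<^sub>v X t n + A' t *\<^sub>v Z t n + c t"
    and N: "\<forall>\<^sub>F t in F. N t \<ge> 2"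
    and C: "mat_tendsto q p (\<lambda>t. sample_cov q p (N t) (Y t) (X t)) C F"
    and C': "mat_tendsto q p' (\<lambda>t. sample_cov q p' (N t) (Y t) (Z t)) C' F"
  shows "mat_tendsto q r (\<lambda>t. sample_cov q r (N t) (Y t) (U t))
    (C * transpose_mat A0 + C' * transpose_mat A0') F"
proof -
  have "transpose_mat (A0 * transpose_mat C + A0' * transpose_mat C') =
      C * transpose_mat A0 + C' * transpose_mat A0'"
    using mat_tendstoD(1)[OF A] mat_tendstoD(1)[OF A'] mat_tendstoD(1)[OF C] mat_tendstoD(1)[OF C']
    by (simp add: transpose_add[of _ r q] transpose_mult[of _ r p] transpose_mult[of _ r p'])
  then show ?thesis
    using tendsto_sample_cov_swap[OF tendsto_sample_cov_affine_left[OF A A' c X Z U N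
        tendsto_sample_cov_swap[OF C] tendsto_sample_cov_swap[OF C']]]
    by simp
qed


section \<open>The Kalman smoother solves the linear least squares problem\<close>

lemma mult_mat_zero_vec: "A \<in> carrier_mat r c \<Longrightarrow> A *\<^sub>v 0\<^sub>v c = (0\<^sub>v r :: real vec)"
  by (rule eq_vecI) auto

lemma scalar_prod_mult_mat_vec:
  assumes "(A :: real mat) \<in> carrier_mat r c" "x \<in> carrier_vec r" "y \<in> carrier_vec c"
  shows "x \<bullet> (A *\<^sub>v y) = (transpose_mat A *\<^sub>v x) \<bullet> y"
  using transpose_vec_mult_scalar[OF assms(1,3,2)] by simp

lemma sym_pos_defD:
  assumes "sym_pos_def n A"
  shows "A \<in> carrier_mat n n" "transpose_mat A = A"
    "v \<in> carrier_vec n \<Longrightarrow> v \<noteq> 0\<^sub>v n \<Longrightarrow> v \<bullet> (A *\<^sub>v v) > 0"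
  using assms unfolding sym_pos_def_def by auto

lemma sym_pos_def_minv_props:
  assumes "sym_pos_def n A"
  shows "minv A \<in> carrier_mat n n" "A * minv A = 1\<^sub>m n" "minv A * A = 1\<^sub>m n"
  using minv_props[OF sym_pos_defD(1)[OF assms]]
    det_nonzeroI[OF sym_pos_defD(1)[OF assms] sym_pos_defD(3)[OF assms]] by auto

lemma sym_pos_def_mult_minv_vec:
  assumes "sym_pos_def n A" "v \<in> carrier_vec n"
  shows "A *\<^sub>v (minv A *\<^sub>v v) = v" "minv A *\<^sub>v (A *\<^sub>v v) = v"
proof -
  note inv = sym_pos_def_minv_props[OF assms(1)] and A = sym_pos_defD(1)[OF assms(1)]
  show "A *\<^sub>v (minv A *\<^sub>v v) = v" "minv A *\<^sub>v (A *\<^sub>v v) = v"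
    using assoc_mult_mat_vec[OF A inv(1) assms(2)] assoc_mult_mat_vec[OF inv(1) A assms(2)]
      inv(2,3) assms(2) by simp_all
qed

lemma sym_pos_def_minv:
  assumes A: "sym_pos_def n A"
  shows "sym_pos_def n (minv A)"
  unfolding sym_pos_def_def
proof (intro conjI ballI impI)
  note Ac = sym_pos_defD(1)[OF A] and inv = sym_pos_def_minv_props[OF A]
  show "minv A \<in> carrier_mat n n"
    by (rule inv(1))
  have "transpose_mat (minv A * A) = A * transpose_mat (minv A)"
    using transpose_mult[OF inv(1) Ac] sym_pos_defD(2)[OF A] by simp
  then have "A * transpose_mat (minv A) = 1\<^sub>m n"
    using inv(3) by simp
  then show "transpose_mat (minv A) = minv A"
    using minv_unique[OF Ac _ \<open>A * transpose_mat (minv A) = 1\<^sub>m n\<close>] inv(1) by simp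
  fix v :: "real vec" assume v: "v \<in> carrier_vec n" "v \<noteq> 0\<^sub>v n"
  let ?u = "minv A *\<^sub>v v"
  have u: "?u \<in> carrier_vec n" and Au: "A *\<^sub>v ?u = v"
    using inv(1) v(1) sym_pos_def_mult_minv_vec(1)[OF A v(1)] by auto
  then have "?u \<noteq> 0\<^sub>v n"
    using v(2) mult_mat_zero_vec[OF Ac] by auto
  then have "?u \<bullet> (A *\<^sub>v ?u) > 0"
    using sym_pos_defD(3)[OF A u] by simp
  then show "v \<bullet> (minv A *\<^sub>v v) > 0"
    unfolding Au using comm_scalar_prod[OF u v(1)] by simp
qed

lemma sym_pos_def_nonneg:
  assumes "sym_pos_def n A" "v \<in> carrier_vec n"
  shows "v \<bullet> (A *\<^sub>v v) \<ge> 0"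
proof (cases "v = 0\<^sub>v n")
  case True
  then show ?thesis
    using sym_pos_defD(1)[OF assms(1)] by simp
qed (use sym_pos_defD(3)[OF assms] in simp)

lemma sym_pos_def_scalar_prod_minv:
  assumes A: "sym_pos_def n A" and a: "a \<in> carrier_vec n" and b: "b \<in> carrier_vec n"
  shows "(A *\<^sub>v a) \<bullet> (minv A *\<^sub>v b) = a \<bullet> b"
proof -
  have "(A *\<^sub>v a) \<bullet> (minv A *\<^sub>v b) = a \<bullet> (A *\<^sub>v (minv A *\<^sub>v b))"
    using scalar_prod_mult_mat_vec[OF sym_pos_defD(1)[OF A] a, of "minv A *\<^sub>v b"]
      sym_pos_defD(2)[OF A] sym_pos_def_minv_props(1)[OF A] b by simp
  then show ?thesis
    using sym_pos_def_mult_minv_vec(1)[OF A b] by simp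
qed

lemma sym_pos_def_commute:
  assumes A: "sym_pos_def n A" and a: "a \<in> carrier_vec n" and b: "b \<in> carrier_vec n"
  shows "a \<bullet> (A *\<^sub>v b) = b \<bullet> (A *\<^sub>v a)"
  using scalar_prod_mult_mat_vec[OF sym_pos_defD(1)[OF A] a b] sym_pos_defD[OF A]
    comm_scalar_prod[of "A *\<^sub>v a" n b] a b by simp

text \<open>The linear smoothing problem with model \<open>x i = F i x (i - 1) + c i\<close> of
  error covariance \<open>Q i\<close> and observations \<open>r i = G i x i\<close> of error
  covariance \<open>R i\<close>. It is later instantiated with the tangent maps at a limiting
  iterate and with augmented observations of dimension \<open>p i = d i + m\<close>.\<close>

locale smoothing =
  fixes k m :: nat and p :: "nat \<Rightarrow> nat"
    and F G :: "nat \<Rightarrow> real mat" and B :: "real mat" and Q R :: "nat \<Rightarrow> real mat"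
    and xb :: "real vec" and c r :: "nat \<Rightarrow> real vec"
  assumes F: "\<And>i. i \<in> {1..k} \<Longrightarrow> F i \<in> carrier_mat m m"
    and G: "\<And>i. i \<in> {1..k} \<Longrightarrow> G i \<in> carrier_mat (p i) m"
    and B: "sym_pos_def m B"
    and Q: "\<And>i. i \<in> {1..k} \<Longrightarrow> sym_pos_def m (Q i)"
    and R: "\<And>i. i \<in> {1..k} \<Longrightarrow> sym_pos_def (p i) (R i)"
    and xb: "xb \<in> carrier_vec m"
    and c: "\<And>i. i \<in> {1..k} \<Longrightarrow> c i \<in> carrier_vec m"
    and r: "\<And>i. i \<in> {1..k} \<Longrightarrow> r i \<in> carrier_vec (p i)"
begin

definition model_form where
  "model_form i v w = (v i - F i *\<^sub>v v (i - 1)) \<bullet> (minv (Q i) *\<^sub>v (w i - F i *\<^sub>v w (i - 1)))"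

definition obs_form where
  "obs_form i v w = (G i *\<^sub>v v i) \<bullet> (minv (R i) *\<^sub>v (G i *\<^sub>v w i))"

text \<open>Half the second derivative of \<open>objective i\<close> as a bilinear form. Testing on
  block vectors \<open>w\<close> replaces the assembled block tridiagonal matrix; with
  \<open>rhs\<close>, the equation of a critical point reads \<open>hessian i x w = rhs i w\<close>
  for all \<open>w\<close>.\<close>

definition hessian where
  "hessian i v w = v 0 \<bullet> (minv B *\<^sub>v w 0) + (\<Sum>q=1..i. model_form q v w) + (\<Sum>q=1..i. obs_form q v w)"

definition model_rhs where
  "model_rhs i w = c i \<bullet> (minv (Q i) *\<^sub>v (w i - F i *\<^sub>v w (i - 1)))"

definition obs_rhs where
  "obs_rhs i w = r i \<bullet> (minv (R i) *\<^sub>v (G i *\<^sub>v w i))"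

definition rhs where
  "rhs i w = xb \<bullet> (minv B *\<^sub>v w 0) + (\<Sum>q=1..i. model_rhs q w) + (\<Sum>q=1..i. obs_rhs q w)"

definition objective where
  "objective i x = wnorm_sq (minv B) (x 0 - xb)
     + (\<Sum>q=1..i. wnorm_sq (minv (Q q)) (x q - F q *\<^sub>v x (q - 1) - c q))
     + (\<Sum>q=1..i. wnorm_sq (minv (R q)) (r q - G q *\<^sub>v x q))"

definition blocks :: "nat \<Rightarrow> (nat \<Rightarrow> real vec) \<Rightarrow> bool" where
  "blocks i v \<longleftrightarrow> (\<forall>q\<le>i. v q \<in> carrier_vec m)"

text \<open>\<open>C\<close> is the inverse of the Hessian, tested on vectors with the single nonzero block \<open>a\<close>, and
  \<open>x\<close> is the critical point. In a forecast the observation at the last index is missing.\<close>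

definition filtered where
  "filtered i x C \<longleftrightarrow> blocks i x \<and> (\<forall>l\<le>i. \<forall>l'\<le>i. C l l' \<in> carrier_mat m m) \<and>
     (\<forall>l\<le>i. \<forall>a\<in>carrier_vec m. \<forall>w. blocks i w \<longrightarrow> hessian i (\<lambda>l'. C l' l *\<^sub>v a) w = a \<bullet> w l) \<and>
     (\<forall>w. blocks i w \<longrightarrow> hessian i x w = rhs i w)"

definition predicted where
  "predicted i x C \<longleftrightarrow> blocks i x \<and> (\<forall>l\<le>i. \<forall>l'\<le>i. C l l' \<in> carrier_mat m m) \<and>
     (\<forall>l\<le>i. \<forall>a\<in>carrier_vec m. \<forall>w. blocks i w \<longrightarrow>
        hessian (i - 1) (\<lambda>l'. C l' l *\<^sub>v a) w + model_form i (\<lambda>l'. C l' l *\<^sub>v a) w = a \<bullet> w l) \<and>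
     (\<forall>w. blocks i w \<longrightarrow>
        hessian (i - 1) x w + model_form i x w = rhs (i - 1) w + model_rhs i w)"

section \<open>Bilinearity and definiteness of the tested forms\<close>

lemma hessian_Suc:
  "hessian (Suc i) v w = hessian i v w + model_form (Suc i) v w + obs_form (Suc i) v w"
  by (simp add: hessian_def)

lemma rhs_Suc: "rhs (Suc i) w = rhs i w + model_rhs (Suc i) w + obs_rhs (Suc i) w"
  by (simp add: rhs_def)

lemma hessian_cong:
  assumes "\<And>q. q \<le> i \<Longrightarrow> v q = v' q"
  shows "hessian i v w = hessian i v' w"
proof -
  have "model_form q v w = model_form q v' w" "obs_form q v w = obs_form q v' w"
    if "q \<in> {1..i}" for q
    using assms[of q] assms[of "q - 1"] that unfolding model_form_def obs_form_def by auto
  then show ?thesis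
    unfolding hessian_def using assms[of 0] by simp
qed

lemmas minv_Q = sym_pos_def_minv[OF Q] and minv_R = sym_pos_def_minv[OF R]
  and minv_B = sym_pos_def_minv[OF B]

lemmas mat_carriers = F G sym_pos_defD(1)[OF Q] sym_pos_defD(1)[OF R] sym_pos_defD(1)[OF B]
  sym_pos_defD(1)[OF minv_Q] sym_pos_defD(1)[OF minv_R] sym_pos_defD(1)[OF minv_B]

lemma model_diff_carrier:
  assumes "blocks i v" "i \<in> {1..k}"
  shows "v i - F i *\<^sub>v v (i - 1) \<in> carrier_vec m"
  using assms F[OF assms(2)] unfolding blocks_def by auto

lemma obs_carrier:
  assumes "blocks i v" "i \<in> {1..k}"
  shows "G i *\<^sub>v v i \<in> carrier_vec (p i)"
  using assms G[OF assms(2)] unfolding blocks_def by auto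

lemma blocks_mono: "blocks i v \<Longrightarrow> q \<le> i \<Longrightarrow> blocks q v"
  unfolding blocks_def by (meson order_trans)

lemma model_form_add_left:
  assumes "blocks i v" "blocks i v'" "blocks i w" "i \<in> {1..k}"
  shows "model_form i (\<lambda>q. v q + v' q) w = model_form i v w + model_form i v' w"
proof -
  have c: "v i \<in> carrier_vec m" "v' i \<in> carrier_vec m" "v (i - 1) \<in> carrier_vec m"
    "v' (i - 1) \<in> carrier_vec m"
    using assms unfolding blocks_def by auto
  note Fi = F[OF assms(4)]
  have "v i + v' i - F i *\<^sub>v (v (i - 1) + v' (i - 1)) =
      (v i - F i *\<^sub>v v (i - 1)) + (v' i - F i *\<^sub>v v' (i - 1))"
    unfolding mult_add_distrib_mat_vec[OF Fi c(3,4)]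
    using c Fi by (intro eq_vecI) auto
  then show ?thesis
    unfolding model_form_def
    using add_scalar_prod_distrib[OF model_diff_carrier[OF assms(1,4)]
        model_diff_carrier[OF assms(2,4)], of "minv (Q i) *\<^sub>v (w i - F i *\<^sub>v w (i - 1))"]
      model_diff_carrier[OF assms(3,4)] mat_carriers(6)[OF assms(4)]
    by simp
qed

lemma obs_form_add_left:
  assumes "blocks i v" "blocks i v'" "blocks i w" "i \<in> {1..k}"
  shows "obs_form i (\<lambda>q. v q + v' q) w = obs_form i v w + obs_form i v' w"
proof -
  have c: "v i \<in> carrier_vec m" "v' i \<in> carrier_vec m"
    using assms unfolding blocks_def by auto
  show ?thesis
    unfolding obs_form_def mult_add_distrib_mat_vec[OF G[OF assms(4)] c]
    using add_scalar_prod_distrib[OF obs_carrier[OF assms(1,4)]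
        obs_carrier[OF assms(2,4)], of "minv (R i) *\<^sub>v (G i *\<^sub>v w i)"]
      obs_carrier[OF assms(3,4)] mat_carriers(7)[OF assms(4)]
    by simp
qed

lemma hessian_add_left:
  assumes "blocks i v" "blocks i v'" "blocks i w" "i \<le> k"
  shows "hessian i (\<lambda>q. v q + v' q) w = hessian i v w + hessian i v' w"
proof -
  have q: "blocks q v" "blocks q v'" "blocks q w" if "q \<in> {1..i}" for q
    using that assms blocks_mono by auto
  have "(\<Sum>q=1..i. model_form q (\<lambda>q. v q + v' q) w) =
      (\<Sum>q=1..i. model_form q v w) + (\<Sum>q=1..i. model_form q v' w)"
    unfolding sum.distrib[symmetric]
    by (rule sum.cong) (use q assms(4) in \<open>auto intro!: model_form_add_left\<close>)
  moreover have "(\<Sum>q=1..i. obs_form q (\<lambda>q. v q + v' q) w) =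
      (\<Sum>q=1..i. obs_form q v w) + (\<Sum>q=1..i. obs_form q v' w)"
    unfolding sum.distrib[symmetric]
    by (rule sum.cong) (use q assms(4) in \<open>auto intro!: obs_form_add_left\<close>)
  moreover have "(v 0 + v' 0) \<bullet> (minv B *\<^sub>v w 0) = v 0 \<bullet> (minv B *\<^sub>v w 0) + v' 0 \<bullet> (minv B *\<^sub>v w 0)"
    using assms mat_carriers(8) unfolding blocks_def
    by (auto intro!: add_scalar_prod_distrib)
  ultimately show ?thesis
    unfolding hessian_def by simp
qed

lemma model_form_nonneg: "blocks i v \<Longrightarrow> i \<in> {1..k} \<Longrightarrow> 0 \<le> model_form i v v"
  unfolding model_form_def by (rule sym_pos_def_nonneg[OF minv_Q model_diff_carrier])

lemma obs_form_nonneg: "blocks i v \<Longrightarrow> i \<in> {1..k} \<Longrightarrow> 0 \<le> obs_form i v v"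
  unfolding obs_form_def by (rule sym_pos_def_nonneg[OF minv_R obs_carrier])

lemma hessian_nonneg:
  assumes "blocks i v" "i \<le> k"
  shows "0 \<le> hessian i v v"
  unfolding hessian_def
  using assms blocks_mono[OF assms(1)]
  by (intro add_nonneg_nonneg sum_nonneg model_form_nonneg obs_form_nonneg
      sym_pos_def_nonneg[OF minv_B]) (auto simp: blocks_def)

text \<open>All summands are nonnegative, so each vanishes. The background term gives
  \<open>v 0 = 0\<close>, and each model term gives
  \<open>v (Suc l) = F (Suc l) *\<^sub>v v l\<close>, so zero propagates along the time
  axis.\<close>

lemma hessian_eq_0D:
  assumes v: "blocks i v" "i \<le> k" and 0: "hessian i v v = 0" and l: "l \<le> i"
  shows "v l = 0\<^sub>v m"
proof -
  have pos: "0 \<le> v 0 \<bullet> (minv B *\<^sub>v v 0)" "0 \<le> (\<Sum>q=1..i. model_form q v v)"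
    "0 \<le> (\<Sum>q=1..i. obs_form q v v)"
    using v blocks_mono[OF v(1)]
    by (auto intro!: sum_nonneg model_form_nonneg obs_form_nonneg sym_pos_def_nonneg[OF minv_B]
        simp: blocks_def)
  then have "v 0 \<bullet> (minv B *\<^sub>v v 0) = 0" and "(\<Sum>q=1..i. model_form q v v) = 0"
    using 0 unfolding hessian_def by linarith+
  have *: "model_form q v v = 0" if "q \<in> {1..i}" for q
  proof -
    have "0 \<le> model_form q v v" if "q \<in> {1..i}" for q
      using that v blocks_mono[OF v(1), of q] by (intro model_form_nonneg) auto
    then show ?thesis
      using sum_nonneg_eq_0_iff[of "{1..i}" "\<lambda>q. model_form q v v"] that
        \<open>(\<Sum>q=1..i. model_form q v v) = 0\<close> by auto
  qed
  have v0: "v 0 = 0\<^sub>v m"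
  proof (rule ccontr)
    assume "v 0 \<noteq> 0\<^sub>v m"
    then have "v 0 \<bullet> (minv B *\<^sub>v v 0) > 0"
      using v by (intro sym_pos_defD(3)[OF minv_B]) (auto simp: blocks_def)
    then show False
      using \<open>v 0 \<bullet> (minv B *\<^sub>v v 0) = 0\<close> by simp
  qed
  show ?thesis
    using l
  proof (induction l)
    case (Suc l)
    then have l: "Suc l \<in> {1..k}" "blocks (Suc l) v" and vl: "v l = 0\<^sub>v m"
      using v blocks_mono by auto
    have "v (Suc l) - F (Suc l) *\<^sub>v v l = 0\<^sub>v m"
    proof (rule ccontr)
      assume "v (Suc l) - F (Suc l) *\<^sub>v v l \<noteq> 0\<^sub>v m"
      then have "model_form (Suc l) v v > 0"
        using sym_pos_defD(3)[OF minv_Q[OF l(1)] model_diff_carrier[OF l(2,1)]]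
        unfolding model_form_def by simp
      then show False
        using *[of "Suc l"] Suc.prems by simp
    qed
    moreover have "F (Suc l) *\<^sub>v v l = 0\<^sub>v m"
      unfolding vl by (rule mult_mat_zero_vec[OF F[OF l(1)]])
    ultimately show ?case
      using l(2) unfolding blocks_def by auto
  qed (rule v0)
qed

section \<open>The Kalman recursion solves the tested equations\<close>

lemma predictedD:
  assumes "predicted i x C"
  shows "blocks i x" "\<And>l l'. l \<le> i \<Longrightarrow> l' \<le> i \<Longrightarrow> C l l' \<in> carrier_mat m m"
    "\<And>l a w. l \<le> i \<Longrightarrow> a \<in> carrier_vec m \<Longrightarrow> blocks i w \<Longrightarrow>
      hessian (i - 1) (\<lambda>l'. C l' l *\<^sub>v a) w + model_form i (\<lambda>l'. C l' l *\<^sub>v a) w = a \<bullet> w l"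
    "\<And>w. blocks i w \<Longrightarrow>
      hessian (i - 1) x w + model_form i x w = rhs (i - 1) w + model_rhs i w"
  using assms unfolding predicted_def by auto

lemma filteredD:
  assumes "filtered i x C"
  shows "blocks i x" "\<And>l l'. l \<le> i \<Longrightarrow> l' \<le> i \<Longrightarrow> C l l' \<in> carrier_mat m m"
    "\<And>l a w. l \<le> i \<Longrightarrow> a \<in> carrier_vec m \<Longrightarrow> blocks i w \<Longrightarrow>
      hessian i (\<lambda>l'. C l' l *\<^sub>v a) w = a \<bullet> w l"
    "\<And>w. blocks i w \<Longrightarrow> hessian i x w = rhs i w"
  using assms unfolding filtered_def by auto

lemma filtered_0: "filtered 0 (\<lambda>_. xb) (\<lambda>_ _. B)"
  unfolding filtered_def
proof (intro conjI allI ballI impI)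
  fix l l' :: nat and a :: "real vec" and w :: "nat \<Rightarrow> real vec"
  assume l: "l \<le> 0" "a \<in> carrier_vec m" "blocks 0 w"
  then show "hessian 0 (\<lambda>l'. B *\<^sub>v a) w = a \<bullet> w l"
    using sym_pos_def_scalar_prod_minv[OF B, of a "w 0"] by (simp add: hessian_def blocks_def)
qed (auto simp: blocks_def hessian_def rhs_def xb sym_pos_defD(1)[OF B])

text \<open>An old column is continued by \<open>F\<close> times its last block, so its model
  residual is zero and the new term contributes nothing. The new column is the old column
  \<open>i\<close> at \<open>transpose_mat F *\<^sub>v a\<close>, with the residual
  \<open>Q *\<^sub>v a\<close> in its last block. Testing the residual gives \<open>a\<close> paired
  with \<open>w (Suc i) - F *\<^sub>v w i\<close>, and the second half cancels what the old column
  contributes.\<close>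

lemma predicted_Suc:
  fixes x C
  assumes filt: "filtered i x C" and i: "Suc i \<in> {1..k}"
  defines "x' \<equiv> x(Suc i := F (Suc i) *\<^sub>v x i + c (Suc i))"
  assumes C': "\<And>l l'. l \<le> i \<Longrightarrow> l' \<le> i \<Longrightarrow> C' l l' = C l l'"
    "\<And>l'. l' \<le> i \<Longrightarrow> C' (Suc i) l' = F (Suc i) * C i l'"
    "\<And>l. l \<le> i \<Longrightarrow> C' l (Suc i) = C l i * transpose_mat (F (Suc i))"
    "C' (Suc i) (Suc i) = F (Suc i) * C i i * transpose_mat (F (Suc i)) + Q (Suc i)"
  shows "predicted (Suc i) x' C'"
proof -
  let ?i = "Suc i" and ?F = "F (Suc i)"
  note Fi = F[OF i] and Qi = sym_pos_defD(1)[OF Q[OF i]] and D = filteredD[OF filt]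
  have Ft: "transpose_mat ?F \<in> carrier_mat m m"
    using Fi by simp
  show ?thesis
    unfolding predicted_def
  proof (intro conjI allI ballI impI)
    show "blocks ?i x'"
      using D(1) Fi c[OF i] unfolding x'_def blocks_def by auto
    fix l l' assume l: "l \<le> ?i" "l' \<le> ?i"
    have "C' l l' \<in> carrier_mat m m" if "l \<le> i" "l' \<le> i"
      using C'(1) that D(2) by simp
    moreover have "C' ?i l' \<in> carrier_mat m m" if "l' \<le> i"
      using C'(2) that D(2)[of i l'] Fi by simp
    moreover have "C' l ?i \<in> carrier_mat m m" if "l \<le> i"
      using C'(3) that D(2)[of l i] Fi by simp
    moreover have "C' ?i ?i \<in> carrier_mat m m"
      using C'(4) D(2)[of i i] Fi Qi by simp
    ultimately show "C' l l' \<in> carrier_mat m m"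
      using l by (cases "l = ?i"; cases "l' = ?i") auto
  next
    fix l w and a :: "real vec" assume l: "l \<le> ?i" and a: "a \<in> carrier_vec m" and w: "blocks ?i w"
    have wi: "blocks i w"
      using w by (rule blocks_mono) simp
    let ?wd = "minv (Q ?i) *\<^sub>v (w ?i - ?F *\<^sub>v w i)"
    have wd: "w ?i - ?F *\<^sub>v w i \<in> carrier_vec m" "?wd \<in> carrier_vec m"
      using model_diff_carrier[OF w i] mat_carriers(6)[OF i] by auto
    show "hessian (?i - 1) (\<lambda>l'. C' l' l *\<^sub>v a) w + model_form ?i (\<lambda>l'. C' l' l *\<^sub>v a) w = a \<bullet> w l"
    proof (cases "l = ?i")
      case False
      then have l: "l \<le> i"
        using l by simp
      have Cil: "C i l \<in> carrier_mat m m"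
        using D(2) l by simp
      have "C' ?i l *\<^sub>v a = ?F *\<^sub>v (C i l *\<^sub>v a)"
        using C'(2)[OF l] assoc_mult_mat_vec[OF Fi Cil a] by simp
      then have "C' ?i l *\<^sub>v a - ?F *\<^sub>v (C' i l *\<^sub>v a) = 0\<^sub>v m"
        using C'(1)[of i l] l Fi Cil a by simp
      then have "model_form ?i (\<lambda>l'. C' l' l *\<^sub>v a) w = 0"
        unfolding model_form_def using wd by simp
      moreover have "hessian i (\<lambda>l'. C' l' l *\<^sub>v a) w = hessian i (\<lambda>l'. C l' l *\<^sub>v a) w"
        using C'(1) l by (intro hessian_cong) simp
      ultimately show ?thesis
        using D(3)[OF l a wi] by simp
    next
      case True
      let ?Fa = "transpose_mat ?F *\<^sub>v a"
      have Fa: "?Fa \<in> carrier_vec m"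
        using Ft a by simp
      have Cii: "C i i \<in> carrier_mat m m"
        using D(2) by simp
      have col: "C' l' ?i *\<^sub>v a = C l' i *\<^sub>v ?Fa" if "l' \<le> i" for l'
        using C'(3)[OF that] assoc_mult_mat_vec[OF D(2)[OF that order_refl] Ft a] by simp
      have "C' ?i ?i *\<^sub>v a = ?F *\<^sub>v (C i i *\<^sub>v ?Fa) + Q ?i *\<^sub>v a"
        unfolding C'(4)
        using add_mult_distrib_mat_vec[OF _ Qi a, of "?F * C i i * transpose_mat ?F"]
          assoc_mult_mat_vec[OF mult_carrier_mat[OF Fi Cii] Ft a]
          assoc_mult_mat_vec[OF Fi Cii Fa] Fi Cii Ft by simp
      then have "C' ?i ?i *\<^sub>v a - ?F *\<^sub>v (C' i ?i *\<^sub>v a) = Q ?i *\<^sub>v a"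
        unfolding col[OF order_refl] using Fi Cii Fa Qi a by (intro eq_vecI) auto
      then have "model_form ?i (\<lambda>l'. C' l' ?i *\<^sub>v a) w = a \<bullet> (w ?i - ?F *\<^sub>v w i)"
        unfolding model_form_def using sym_pos_def_scalar_prod_minv[OF Q[OF i] a wd(1)] by simp
      also have "\<dots> = a \<bullet> w ?i - a \<bullet> (?F *\<^sub>v w i)"
        using w a Fi by (intro scalar_prod_minus_distrib[of _ m]) (auto simp: blocks_def)
      also have "a \<bullet> (?F *\<^sub>v w i) = ?Fa \<bullet> w i"
        using w by (intro scalar_prod_mult_mat_vec[OF Fi a]) (auto simp: blocks_def)
      finally have "model_form ?i (\<lambda>l'. C' l' ?i *\<^sub>v a) w = a \<bullet> w ?i - ?Fa \<bullet> w i" .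
      moreover have "hessian i (\<lambda>l'. C' l' ?i *\<^sub>v a) w = hessian i (\<lambda>l'. C l' i *\<^sub>v ?Fa) w"
        using col by (intro hessian_cong) simp
      ultimately show ?thesis
        using D(3)[OF order_refl Fa wi] True by simp
    qed
  next
    fix w assume w: "blocks ?i w"
    have wi: "blocks i w"
      using w by (rule blocks_mono) simp
    have xi: "x i \<in> carrier_vec m"
      using D(1) unfolding blocks_def by simp
    \<comment> \<open>The predicted mean leaves exactly the shift as residual, so the new terms on
      both sides of the equation coincide.\<close>
    have "x' ?i - ?F *\<^sub>v x' i = c ?i"
      unfolding x'_def using Fi xi c[OF i] by (intro eq_vecI) auto
    then have "model_form ?i x' w = model_rhs ?i w"
      unfolding model_form_def model_rhs_def by simp
    moreover have "hessian i x' w = hessian i x w"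
      unfolding x'_def by (intro hessian_cong) simp
    ultimately show "hessian (?i - 1) x' w + model_form ?i x' w = rhs (?i - 1) w + model_rhs ?i w"
      using D(4)[OF wi] by simp
  qed
qed

text \<open>Testing the column of \<open>C\<close> at \<open>a\<close> against itself turns the
  right-hand side into this quadratic form, and the left-hand side is nonnegative.\<close>

lemma predicted_psd:
  assumes "predicted i x C" and i: "i \<in> {1..k}" and a: "a \<in> carrier_vec m"
  shows "0 \<le> a \<bullet> (C i i *\<^sub>v a)"
proof -
  have bl: "blocks i (\<lambda>l'. C l' i *\<^sub>v a)"
    unfolding blocks_def
    by (intro allI impI mult_mat_vec_carrier[OF predictedD(2)[OF assms(1)] a]) auto
  show ?thesis
    using predictedD(3)[OF assms(1) order_refl a bl] model_form_nonneg[OF bl i]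
      hessian_nonneg[OF blocks_mono[OF bl diff_le_self], of 1] i by fastforce
qed

text \<open>The form of \<open>S\<close> at \<open>v\<close> is the form of \<open>C i i\<close> at
  \<open>transpose_mat (G i) *\<^sub>v v\<close>, hence nonnegative, and \<open>R i\<close> adds
  strict positivity.\<close>

lemma innovation_cov_props:
  assumes pred: "predicted i x C" and i: "i \<in> {1..k}"
  defines "S \<equiv> G i * C i i * transpose_mat (G i)"
  shows "S \<in> carrier_mat (p i) (p i)" "det (S + R i) \<noteq> 0"
proof -
  note Gi = G[OF i] and Ri = sym_pos_defD(1)[OF R[OF i]]
  have Cii: "C i i \<in> carrier_mat m m"
    by (rule predictedD(2)[OF pred]) auto
  have Gt: "transpose_mat (G i) \<in> carrier_mat m (p i)"
    using Gi by simp
  show S: "S \<in> carrier_mat (p i) (p i)"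
    unfolding S_def using Gi Cii by simp
  show "det (S + R i) \<noteq> 0"
  proof (rule det_nonzeroI)
    show "S + R i \<in> carrier_mat (p i) (p i)"
      using S Ri by simp
    fix v :: "real vec" assume v: "v \<in> carrier_vec (p i)" "v \<noteq> 0\<^sub>v (p i)"
    let ?a = "transpose_mat (G i) *\<^sub>v v"
    have a: "?a \<in> carrier_vec m"
      using Gt v by simp
    have "S *\<^sub>v v = G i *\<^sub>v (C i i *\<^sub>v ?a)"
      unfolding S_def using assoc_mult_mat_vec[OF mult_carrier_mat[OF Gi Cii] Gt v(1)]
        assoc_mult_mat_vec[OF Gi Cii a] by simp
    then have "v \<bullet> (S *\<^sub>v v) = ?a \<bullet> (C i i *\<^sub>v ?a)"
      using scalar_prod_mult_mat_vec[OF Gi v(1), of "C i i *\<^sub>v ?a"] Cii a by simp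
    then have "0 \<le> v \<bullet> (S *\<^sub>v v)"
      using predicted_psd[OF pred i a] by simp
    moreover have "v \<bullet> ((S + R i) *\<^sub>v v) = v \<bullet> (S *\<^sub>v v) + v \<bullet> (R i *\<^sub>v v)"
      using S Ri v(1) by (simp add: add_mult_distrib_mat_vec scalar_prod_add_distrib[of _ "p i"])
    ultimately show "0 < v \<bullet> ((S + R i) *\<^sub>v v)"
      using sym_pos_defD(3)[OF R[OF i] v] by simp
  qed
qed

text \<open>Both the mean and the covariance update move along column \<open>i\<close> in a
  direction \<open>transpose_mat (G i) *\<^sub>v q\<close>. The form without the new observation
  sees only \<open>q\<close> paired with \<open>G i *\<^sub>v w i\<close>, and the observed value
  shifts by \<open>S *\<^sub>v q\<close>.\<close>

lemma hessian_add_column: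
  assumes pred: "predicted i x C" and i: "i \<in> {1..k}"
    and u: "blocks i u" and w: "blocks i w" and q: "q \<in> carrier_vec (p i)"
  defines "S \<equiv> G i * C i i * transpose_mat (G i)"
  shows "hessian i (\<lambda>l. u l + C l i *\<^sub>v (transpose_mat (G i) *\<^sub>v q)) w =
    hessian (i - 1) u w + model_form i u w + q \<bullet> (G i *\<^sub>v w i)
    + (G i *\<^sub>v u i + S *\<^sub>v q) \<bullet> (minv (R i) *\<^sub>v (G i *\<^sub>v w i))"
proof -
  let ?a = "transpose_mat (G i) *\<^sub>v q"
  let ?v = "\<lambda>l. C l i *\<^sub>v ?a"
  note Gi = G[OF i]
  have Cii: "C i i \<in> carrier_mat m m"
    by (rule predictedD(2)[OF pred]) auto
  have Gt: "transpose_mat (G i) \<in> carrier_mat m (p i)"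
    using Gi by simp
  have a: "?a \<in> carrier_vec m"
    using Gt q by simp
  have v: "blocks i ?v"
    unfolding blocks_def
    by (intro allI impI mult_mat_vec_carrier[OF predictedD(2)[OF pred] a]) auto
  have i1: "blocks (i - 1) u" "blocks (i - 1) ?v" "blocks (i - 1) w"
    using blocks_mono[OF u] blocks_mono[OF v] blocks_mono[OF w] by auto
  have "S *\<^sub>v q = G i *\<^sub>v (C i i *\<^sub>v ?a)"
    unfolding S_def using assoc_mult_mat_vec[OF mult_carrier_mat[OF Gi Cii] Gt q]
      assoc_mult_mat_vec[OF Gi Cii a] by simp
  then have obs: "obs_form i (\<lambda>l. u l + ?v l) w =
      (G i *\<^sub>v u i + S *\<^sub>v q) \<bullet> (minv (R i) *\<^sub>v (G i *\<^sub>v w i))"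
    unfolding obs_form_def
    using mult_add_distrib_mat_vec[OF Gi, of "u i" "C i i *\<^sub>v ?a"] u Cii a
    by (simp add: blocks_def)
  have "hessian i (\<lambda>l. u l + ?v l) w =
      hessian (i - 1) (\<lambda>l. u l + ?v l) w + model_form i (\<lambda>l. u l + ?v l) w
      + obs_form i (\<lambda>l. u l + ?v l) w"
    using hessian_Suc[of "i - 1"] i by simp
  also have "hessian (i - 1) (\<lambda>l. u l + ?v l) w = hessian (i - 1) u w + hessian (i - 1) ?v w"
    using i by (intro hessian_add_left i1) auto
  also have "model_form i (\<lambda>l. u l + ?v l) w = model_form i u w + model_form i ?v w"
    by (rule model_form_add_left[OF u v w i])
  finally show ?thesis
    using predictedD(3)[OF pred order_refl a w] obs
      scalar_prod_mult_mat_vec[OF Gi q, of "w i"] w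
    by (simp add: blocks_def)
qed

text \<open>A tested form of the Woodbury identity. If \<open>q\<close> solves
  \<open>(S + R) q = g\<close>, then \<open>S q = g - R q\<close>; inside the observation term
  \<open>R q\<close> cancels \<open>minv R\<close>, and what is left cancels the term produced by
  the column correction. The mean uses \<open>g = r - G x\<close>; the covariance uses the observed
  column of \<open>C\<close> with the opposite sign.\<close>

lemma filtered_update:
  assumes pred: "predicted i x C" and i: "i \<in> {1..k}"
  defines "S \<equiv> G i * C i i * transpose_mat (G i)"
  defines "K \<equiv> (\<lambda>l. C l i * transpose_mat (G i) * minv (S + R i))"
  assumes x': "\<And>l. l \<le> i \<Longrightarrow> x' l = x l + K l *\<^sub>v (r i - G i *\<^sub>v x i)"
    and C': "\<And>l l'. l \<le> i \<Longrightarrow> l' \<le> i \<Longrightarrow> C' l l' = C l l' - K l * (G i * C i l')"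
  shows "filtered i x' C'"
proof -
  note Gi = G[OF i] and Ri = sym_pos_defD(1)[OF R[OF i]] and D = predictedD[OF pred]
  note S = innovation_cov_props[OF pred i, folded S_def]
  let ?D = "S + R i"
  have Dc: "?D \<in> carrier_mat (p i) (p i)"
    using S Ri by simp
  note inv = minv_props[OF Dc S(2)]
  have Gt: "transpose_mat (G i) \<in> carrier_mat m (p i)"
    using Gi by simp
  have K: "K l \<in> carrier_mat m (p i)" if "l \<le> i" for l
    unfolding K_def using D(2)[OF that order_refl] Gt inv(1) by simp
  have K_vec: "K l *\<^sub>v g = C l i *\<^sub>v (transpose_mat (G i) *\<^sub>v (minv ?D *\<^sub>v g))"
    if "l \<le> i" "g \<in> carrier_vec (p i)" for l g
    unfolding K_def
    using assoc_mult_mat_vec[OF mult_carrier_mat[OF D(2)[OF that(1) order_refl] Gt] inv(1) that(2)]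
      assoc_mult_mat_vec[OF D(2)[OF that(1) order_refl] Gt, of "minv ?D *\<^sub>v g"] inv(1) that(2)
    by simp
  have D_inv: "S *\<^sub>v (minv ?D *\<^sub>v g) = g - R i *\<^sub>v (minv ?D *\<^sub>v g)"
    if g: "g \<in> carrier_vec (p i)" for g
  proof -
    let ?q = "minv ?D *\<^sub>v g"
    have q: "?q \<in> carrier_vec (p i)"
      using inv(1) g by simp
    have "S *\<^sub>v ?q + R i *\<^sub>v ?q = g"
      using assoc_mult_mat_vec[OF Dc inv(1) g] inv(2) g add_mult_distrib_mat_vec[OF S(1) Ri q]
      by simp
    moreover have "S *\<^sub>v ?q = S *\<^sub>v ?q + R i *\<^sub>v ?q - R i *\<^sub>v ?q"
      using S(1) Ri q by (intro eq_vecI) auto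
    ultimately show ?thesis
      by simp
  qed
  show ?thesis
    unfolding filtered_def
  proof (intro conjI allI ballI impI)
    have rG: "r i - G i *\<^sub>v x i \<in> carrier_vec (p i)"
      using r[OF i] Gi D(1) unfolding blocks_def by auto
    show "blocks i x'"
      unfolding blocks_def
    proof (intro allI impI)
      fix l assume "l \<le> i"
      then show "x' l \<in> carrier_vec m"
        using x' mult_mat_vec_carrier[OF K rG] D(1) unfolding blocks_def by auto
    qed
    show "C' l l' \<in> carrier_mat m m" if "l \<le> i" "l' \<le> i" for l l'
      unfolding C'[OF that] using K[OF that(1)] D(2)[OF that] D(2)[of i l'] that Gi
      by (intro minus_carrier_mat mult_carrier_mat) auto
    fix w assume w: "blocks i w"
    let ?g = "G i *\<^sub>v w i"
    have g: "?g \<in> carrier_vec (p i)" "minv (R i) *\<^sub>v ?g \<in> carrier_vec (p i)"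
      using w Gi mat_carriers(7)[OF i] unfolding blocks_def by auto
    {
      fix l and a :: "real vec" assume l: "l \<le> i" and a: "a \<in> carrier_vec m"
      let ?b = "G i *\<^sub>v (C i l *\<^sub>v a)"
      let ?q = "minv ?D *\<^sub>v ?b"
      have Cil: "C i l \<in> carrier_mat m m"
        using D(2) l by simp
      have b: "?b \<in> carrier_vec (p i)" and q: "?q \<in> carrier_vec (p i)"
        using Gi Cil a inv(1) by auto
      have col: "blocks i (\<lambda>l'. C l' l *\<^sub>v a)"
        unfolding blocks_def by (intro allI impI mult_mat_vec_carrier[OF D(2) a]) (use l in auto)
      have mq: "- ?q \<in> carrier_vec (p i)"
        using q by simp
      have neg: "A *\<^sub>v (- v) = - (A *\<^sub>v v)" if "A \<in> carrier_mat n n'" "v \<in> carrier_vec n'"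
        for A :: "real mat" and v n n'
        using that by (intro eq_vecI) auto
      \<comment> \<open>The covariance update is rewritten as a correction along column
        \<open>i\<close> with coefficient \<open>- ?q\<close>, the shape handled by
        \<open>hessian_add_column\<close>.\<close>
      have "C' l' l *\<^sub>v a = C l' l *\<^sub>v a + C l' i *\<^sub>v (transpose_mat (G i) *\<^sub>v (- ?q))"
        if l': "l' \<le> i" for l'
      proof -
        have "C' l' l *\<^sub>v a = C l' l *\<^sub>v a - (K l' * (G i * C i l)) *\<^sub>v a"
          unfolding C'[OF l' l]
          using K[OF l'] D(2)[OF l' l] Cil Gi a
          by (intro minus_mult_distrib_mat_vec[of _ m m]) auto
        also have "(K l' * (G i * C i l)) *\<^sub>v a = K l' *\<^sub>v ?b"
          using assoc_mult_mat_vec[OF K[OF l'] mult_carrier_mat[OF Gi Cil] a]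
            assoc_mult_mat_vec[OF Gi Cil a] by simp
        also have "\<dots> = C l' i *\<^sub>v (transpose_mat (G i) *\<^sub>v ?q)"
          by (rule K_vec[OF l' b])
        finally show ?thesis
          using neg[OF Gt q] neg[OF D(2)[OF l' order_refl], of "transpose_mat (G i) *\<^sub>v ?q"] Gt q
            D(2)[OF l' l] D(2)[OF l' order_refl] a
          by (auto intro!: eq_vecI)
      qed
      then have "hessian i (\<lambda>l'. C' l' l *\<^sub>v a) w =
          hessian i (\<lambda>l'. C l' l *\<^sub>v a + C l' i *\<^sub>v (transpose_mat (G i) *\<^sub>v (- ?q))) w"
        by (intro hessian_cong) simp
      also have "\<dots> = a \<bullet> w l + (- ?q) \<bullet> ?g + (?b + S *\<^sub>v (- ?q)) \<bullet> (minv (R i) *\<^sub>v ?g)"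
        using hessian_add_column[OF pred i col w mq, folded S_def] D(3)[OF l a w] by simp
      also have "?b + S *\<^sub>v (- ?q) = R i *\<^sub>v ?q"
        unfolding neg[OF S(1) q] D_inv[OF b] using b Ri q by (intro eq_vecI) auto
      also have "(R i *\<^sub>v ?q) \<bullet> (minv (R i) *\<^sub>v ?g) = ?q \<bullet> ?g"
        by (rule sym_pos_def_scalar_prod_minv[OF R[OF i] q g(1)])
      finally show "hessian i (\<lambda>l'. C' l' l *\<^sub>v a) w = a \<bullet> w l"
        using uminus_scalar_prod[OF q g(1)] by simp
    }
    let ?b = "r i - G i *\<^sub>v x i"
    let ?q = "minv ?D *\<^sub>v ?b"
    have q: "?q \<in> carrier_vec (p i)"
      using rG inv(1) by auto
    have "hessian i x' w = hessian i (\<lambda>l. x l + C l i *\<^sub>v (transpose_mat (G i) *\<^sub>v ?q)) w"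
      using x' K_vec[OF _ rG] by (intro hessian_cong) simp
    also have "\<dots> = rhs (i - 1) w + model_rhs i w + ?q \<bullet> ?g
        + (G i *\<^sub>v x i + S *\<^sub>v ?q) \<bullet> (minv (R i) *\<^sub>v ?g)"
      using hessian_add_column[OF pred i D(1) w q, folded S_def] D(4)[OF w] by simp
    \<comment> \<open>The observed value of the updated mean misses the data by
      \<open>R i *\<^sub>v ?q\<close>.\<close>
    also have "G i *\<^sub>v x i + S *\<^sub>v ?q = r i - R i *\<^sub>v ?q"
      unfolding D_inv[OF rG] using Ri q r[OF i] Gi D(1)
      by (intro eq_vecI) (auto simp: blocks_def)
    also have "(r i - R i *\<^sub>v ?q) \<bullet> (minv (R i) *\<^sub>v ?g) = obs_rhs i w - ?q \<bullet> ?g"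
      using minus_scalar_prod_distrib[OF r[OF i], of "R i *\<^sub>v ?q" "minv (R i) *\<^sub>v ?g"] Ri q g
        sym_pos_def_scalar_prod_minv[OF R[OF i] q g(1)] by (simp add: obs_rhs_def)
    finally show "hessian i x' w = rhs i w"
      using rhs_Suc[of "i - 1" w] i by simp
  qed
qed

section \<open>From critical points to minimizers\<close>

lemma wnorm_sq_add:
  assumes A: "sym_pos_def n A" and a: "a \<in> carrier_vec n" and b: "b \<in> carrier_vec n"
  shows "wnorm_sq A (a + b) = wnorm_sq A a + 2 * (a \<bullet> (A *\<^sub>v b)) + wnorm_sq A b"
proof -
  note Ac = sym_pos_defD(1)[OF A]
  have "wnorm_sq A (a + b) = (a + b) \<bullet> (A *\<^sub>v a) + (a + b) \<bullet> (A *\<^sub>v b)"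
    unfolding wnorm_sq_def mult_add_distrib_mat_vec[OF Ac a b]
    using a b Ac by (intro scalar_prod_add_distrib[of _ n]) auto
  also have "(a + b) \<bullet> (A *\<^sub>v a) = a \<bullet> (A *\<^sub>v a) + b \<bullet> (A *\<^sub>v a)"
    using a b Ac by (intro add_scalar_prod_distrib[of _ n]) auto
  also have "(a + b) \<bullet> (A *\<^sub>v b) = a \<bullet> (A *\<^sub>v b) + b \<bullet> (A *\<^sub>v b)"
    using a b Ac by (intro add_scalar_prod_distrib[of _ n]) auto
  finally show ?thesis
    using sym_pos_def_commute[OF A a b] unfolding wnorm_sq_def by simp
qed

lemma wnorm_sq_uminus:
  assumes A: "A \<in> carrier_mat n n" and a: "a \<in> carrier_vec n"
  shows "wnorm_sq A (- a) = wnorm_sq A a"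
proof -
  have "A *\<^sub>v (- a) = - (A *\<^sub>v a)"
    using A a by (intro eq_vecI) auto
  then show ?thesis
    using A a unfolding wnorm_sq_def
    by simp
qed

text \<open>The second-order Taylor expansion of a quadratic function is exact, and its first-order
  part \<open>2 * (hessian i x e - rhs i e)\<close> is zero at a critical point.\<close>

lemma objective_critical_point:
  assumes x: "blocks i x" "i \<le> k" and crit: "\<And>w. blocks i w \<Longrightarrow> hessian i x w = rhs i w"
    and x': "blocks i x'"
  shows "objective i x' = objective i x + hessian i (\<lambda>l. x' l - x l) (\<lambda>l. x' l - x l)"
proof -
  let ?e = "\<lambda>l. x' l - x l"
  have e: "blocks i ?e"
    using x(1) x' unfolding blocks_def by auto
  have c0: "x 0 \<in> carrier_vec m" "x' 0 \<in> carrier_vec m"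
    using x(1) x' unfolding blocks_def by auto
  have "x' 0 - xb = (x 0 - xb) + ?e 0"
    using c0 xb by (intro eq_vecI) auto
  then have 0: "wnorm_sq (minv B) (x' 0 - xb) = wnorm_sq (minv B) (x 0 - xb)
      + 2 * (x 0 \<bullet> (minv B *\<^sub>v ?e 0) - xb \<bullet> (minv B *\<^sub>v ?e 0)) + ?e 0 \<bullet> (minv B *\<^sub>v ?e 0)"
    using wnorm_sq_add[OF minv_B, of "x 0 - xb" "?e 0"] c0 xb mat_carriers(8)
      minus_scalar_prod_distrib[OF c0(1) xb, of "minv B *\<^sub>v ?e 0"]
    unfolding wnorm_sq_def[of _ "?e 0"] by simp
  have 1: "wnorm_sq (minv (Q q)) (x' q - F q *\<^sub>v x' (q - 1) - c q) =
      wnorm_sq (minv (Q q)) (x q - F q *\<^sub>v x (q - 1) - c q)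
      + 2 * (model_form q x ?e - model_rhs q ?e) + model_form q ?e ?e" if "q \<in> {1..i}" for q
  proof -
    have q: "q \<in> {1..k}" "blocks q x" "blocks q ?e"
      using that x e blocks_mono by auto
    have qc: "x q \<in> carrier_vec m" "x' q \<in> carrier_vec m" "x (q - 1) \<in> carrier_vec m"
      "x' (q - 1) \<in> carrier_vec m"
      using that x x' unfolding blocks_def by auto
    let ?a = "x q - F q *\<^sub>v x (q - 1)" and ?b = "?e q - F q *\<^sub>v ?e (q - 1)"
    have ab: "?a \<in> carrier_vec m" "?b \<in> carrier_vec m"
      using model_diff_carrier[OF q(2,1)] model_diff_carrier[OF q(3,1)] by auto
    have "F q *\<^sub>v ?e (q - 1) = F q *\<^sub>v x' (q - 1) - F q *\<^sub>v x (q - 1)"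
      by (rule mult_minus_distrib_mat_vec[OF F[OF q(1)] qc(4,3)])
    then have "x' q - F q *\<^sub>v x' (q - 1) - c q = (?a - c q) + ?b"
      using F[OF q(1)] qc c[OF q(1)] by (intro eq_vecI) auto
    then show ?thesis
      using wnorm_sq_add[OF minv_Q[OF q(1)], of "?a - c q" ?b] ab c[OF q(1)] mat_carriers(6)[OF q(1)]
        minus_scalar_prod_distrib[OF ab(1) c[OF q(1)], of "minv (Q q) *\<^sub>v ?b"]
      unfolding wnorm_sq_def[of _ ?b] model_form_def model_rhs_def by simp
  qed
  have 2: "wnorm_sq (minv (R q)) (r q - G q *\<^sub>v x' q) = wnorm_sq (minv (R q)) (r q - G q *\<^sub>v x q)
      + 2 * (obs_form q x ?e - obs_rhs q ?e) + obs_form q ?e ?e" if "q \<in> {1..i}" for q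
  proof -
    have q: "q \<in> {1..k}" "blocks q x" "blocks q ?e"
      using that x e blocks_mono by auto
    have qc: "x q \<in> carrier_vec m" "x' q \<in> carrier_vec m"
      using that x x' unfolding blocks_def by auto
    let ?a = "G q *\<^sub>v x q" and ?b = "G q *\<^sub>v ?e q"
    have ab: "?a \<in> carrier_vec (p q)" "?b \<in> carrier_vec (p q)"
      using obs_carrier[OF q(2,1)] obs_carrier[OF q(3,1)] by auto
    have "?b = G q *\<^sub>v x' q - ?a"
      by (rule mult_minus_distrib_mat_vec[OF G[OF q(1)] qc(2,1)])
    \<comment> \<open>The observation residual is written with the opposite sign, so that the
      increment is added to it; the weighted norm is even.\<close>
    then have "- (r q - G q *\<^sub>v x' q) = (?a - r q) + ?b" "?a - r q = - (r q - ?a)"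
      using G[OF q(1)] qc r[OF q(1)] by (auto intro!: eq_vecI)
    then show ?thesis
      using wnorm_sq_add[OF minv_R[OF q(1)], of "?a - r q" ?b] ab r[OF q(1)] mat_carriers(7)[OF q(1)]
        minus_scalar_prod_distrib[OF ab(1) r[OF q(1)], of "minv (R q) *\<^sub>v ?b"]
        wnorm_sq_uminus[OF mat_carriers(7)[OF q(1)], of "r q - G q *\<^sub>v x' q"]
        wnorm_sq_uminus[OF mat_carriers(7)[OF q(1)], of "r q - ?a"] G[OF q(1)] qc
      unfolding wnorm_sq_def[of _ ?b] obs_form_def obs_rhs_def by simp
  qed
  have sum1: "(\<Sum>q=1..i. wnorm_sq (minv (Q q)) (x' q - F q *\<^sub>v x' (q - 1) - c q)) =
      (\<Sum>q=1..i. wnorm_sq (minv (Q q)) (x q - F q *\<^sub>v x (q - 1) - c q)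
        + 2 * (model_form q x ?e - model_rhs q ?e) + model_form q ?e ?e)"
    by (rule sum.cong[OF refl 1])
  have sum2: "(\<Sum>q=1..i. wnorm_sq (minv (R q)) (r q - G q *\<^sub>v x' q)) =
      (\<Sum>q=1..i. wnorm_sq (minv (R q)) (r q - G q *\<^sub>v x q)
        + 2 * (obs_form q x ?e - obs_rhs q ?e) + obs_form q ?e ?e)"
    by (rule sum.cong[OF refl 2])
  have "objective i x' = objective i x + 2 * (hessian i x ?e - rhs i ?e) + hessian i ?e ?e"
    unfolding objective_def hessian_def rhs_def 0 sum1 sum2
      sum.distrib sum_subtractf sum_distrib_left[symmetric]
    by (simp add: algebra_simps)
  then show ?thesis
    using crit[OF e] by simp
qed

end


section \<open>Large ensembles\<close>

lemma minv_aug_cov: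
  assumes S: "sym_pos_def p S" and "\<gamma> > 0"
  shows "minv (aug_cov p m \<gamma> S) = four_block_mat (minv S) (0\<^sub>m p m) (0\<^sub>m m p) (\<gamma> \<cdot>\<^sub>m 1\<^sub>m m)"
proof (rule minv_unique)
  note Sc = sym_pos_defD(1)[OF S] and inv = sym_pos_def_minv_props[OF S]
  show "aug_cov p m \<gamma> S \<in> carrier_mat (p + m) (p + m)"
    using sym_pos_defD(1)[OF sym_pos_def_aug_cov[OF S \<open>\<gamma> > 0\<close>]] .
  show "four_block_mat (minv S) (0\<^sub>m p m) (0\<^sub>m m p) (\<gamma> \<cdot>\<^sub>m 1\<^sub>m m) \<in> carrier_mat (p + m) (p + m)"
    using inv(1) by simp
  have "aug_cov p m \<gamma> S * four_block_mat (minv S) (0\<^sub>m p m) (0\<^sub>m m p) (\<gamma> \<cdot>\<^sub>m 1\<^sub>m m) =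
      four_block_mat (S * minv S + 0\<^sub>m p m * 0\<^sub>m m p) (S * 0\<^sub>m p m + 0\<^sub>m p m * (\<gamma> \<cdot>\<^sub>m 1\<^sub>m m))
        (0\<^sub>m m p * minv S + (1 / \<gamma>) \<cdot>\<^sub>m 1\<^sub>m m * 0\<^sub>m m p)
        (0\<^sub>m m p * 0\<^sub>m p m + (1 / \<gamma>) \<cdot>\<^sub>m 1\<^sub>m m * (\<gamma> \<cdot>\<^sub>m 1\<^sub>m m))"
    unfolding aug_cov_def using Sc inv(1) by (intro mult_four_block_mat) auto
  also have "(1 / \<gamma>) \<cdot>\<^sub>m 1\<^sub>m m * (\<gamma> \<cdot>\<^sub>m 1\<^sub>m m) = 1\<^sub>m m"
    using \<open>\<gamma> > 0\<close> by (intro eq_matI) auto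
  finally show "aug_cov p m \<gamma> S * four_block_mat (minv S) (0\<^sub>m p m) (0\<^sub>m m p) (\<gamma> \<cdot>\<^sub>m 1\<^sub>m m) =
      1\<^sub>m (p + m)"
    using Sc inv by simp
qed

text \<open>The purpose of the augmented observation: the weight of the state block is the inverse
  of \<open>1 / \<gamma>\<close>, which reproduces the penalty of the Levenberg-Marquardt
  objective.\<close>

lemma wnorm_sq_minv_aug_cov:
  assumes S: "sym_pos_def p S" and "\<gamma> > 0" and a: "a \<in> carrier_vec p" and b: "b \<in> carrier_vec m"
  shows "wnorm_sq (minv (aug_cov p m \<gamma> S)) (a @\<^sub>v b) = wnorm_sq (minv S) a + \<gamma> * (vnorm b)\<^sup>2"
proof -
  have inv: "minv S \<in> carrier_mat p p"
    by (rule sym_pos_def_minv_props(1)[OF S])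
  have "minv (aug_cov p m \<gamma> S) *\<^sub>v (a @\<^sub>v b) = (minv S *\<^sub>v a) @\<^sub>v (\<gamma> \<cdot>\<^sub>v b)"
    unfolding minv_aug_cov[OF S \<open>\<gamma> > 0\<close>]
    by (subst four_block_mat_mult_vec[OF inv _ _ _ a b]) (use inv a b in auto)
  then have "wnorm_sq (minv (aug_cov p m \<gamma> S)) (a @\<^sub>v b) = a \<bullet> (minv S *\<^sub>v a) + \<gamma> * (b \<bullet> b)"
    unfolding wnorm_sq_def
    using scalar_prod_append[of a p b m "minv S *\<^sub>v a" "\<gamma> \<cdot>\<^sub>v b"] a b inv by simp
  then show ?thesis
    using scalar_prod_self_nonneg[of b] unfolding wnorm_sq_def vnorm_def by simp
qed

lemma mat_tendsto_uminus:
  assumes "mat_tendsto r c X x F"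
  shows "mat_tendsto r c (\<lambda>t. - X t) (- x) F"
proof (rule mat_tendstoI)
  show "- x \<in> carrier_mat r c"
    using mat_tendstoD(1)[OF assms] by simp
  show "\<forall>\<^sub>F t in F. - X t \<in> carrier_mat r c \<and> (\<forall>a<r. \<forall>b<c. (- X t) $$ (a, b) = - (X t $$ (a, b)))"
    using mat_tendstoD(2)[OF assms] by eventually_elim auto
  fix a b assume "a < r" "b < c"
  then show "((\<lambda>t. - (X t $$ (a, b))) \<longlongrightarrow> (- x) $$ (a, b)) F"
    using mat_tendstoD(1)[OF assms] mat_tendstoD(3)[OF assms, of a b]
    by (simp add: tendsto_minus)
qed

lemma mult_uminus_mat:
  assumes "(A :: real mat) \<in> carrier_mat r c" "D \<in> carrier_mat c q"
  shows "(- A) * D = - (A * D)" "A * (- D) = - (A * D)"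
  using carrier_matD[OF assms(1)] carrier_matD[OF assms(2)] by simp_all

lemma sample_outer_mult_right:
  assumes A: "A \<in> carrier_mat c p" and Y: "\<And>n. n \<in> {1..N} \<Longrightarrow> Y n \<in> carrier_vec p"
  shows "sample_outer r c N X (\<lambda>n. A *\<^sub>v Y n) = sample_outer r p N X Y * transpose_mat A"
proof -
  have "sample_outer r c N X (\<lambda>n. A *\<^sub>v Y n) = transpose_mat (sample_outer c r N (\<lambda>n. A *\<^sub>v Y n) X)"
    by (simp add: sample_outer_transpose)
  also have "\<dots> = transpose_mat (A * sample_outer p r N Y X)"
    using sample_outer_mult_left[OF A, of N Y r X] Y by simp
  also have "\<dots> = transpose_mat (sample_outer p r N Y X) * transpose_mat A"
    by (rule transpose_mult[OF A sample_outer_carrier])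
  finally show ?thesis
    by (simp add: sample_outer_transpose)
qed

text \<open>The limits of the difference quotients for \<tau> tending to 0, to be substituted for
  \<open>DM\<close> and, in stacked form, for \<open>DH\<close>.\<close>

definition (in assimilation) tangent_model where
  "tangent_model i z u = M' i z *\<^sub>v u"

definition (in assimilation) tangent_obs where
  "tangent_obs i z u = (H' i z @\<^sub>r 1\<^sub>m m) *\<^sub>v u"

text \<open>One outer iteration along an arbitrary filter, with ensemble size \<open>N t\<close> and
  linearization point \<open>zt t\<close> both varying. Growth of the ensemble is expressed by its
  consequences: sample means and covariances of the inputs tend to the population values, and
  cross-covariances of different sources to zero. No probability occurs here.\<close>

locale large_sample = assimilation k m d M H M' H' xb \<mu> y B Q R \<gamma> x0
  for k m d M H M' H' xb \<mu> y B Q R \<gamma> x0 +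
  fixes F :: "'t filter" and N :: "'t \<Rightarrow> nat"
    and zt :: "'t \<Rightarrow> nat \<Rightarrow> real vec" and z :: "nat \<Rightarrow> real vec"
    and X0 :: "'t \<Rightarrow> nat \<Rightarrow> real vec" and V W :: "'t \<Rightarrow> nat \<Rightarrow> nat \<Rightarrow> real vec"
  assumes N_ge_2: "\<forall>\<^sub>F t in F. N t \<ge> 2"
    and z_lim: "\<And>l. l \<le> k \<Longrightarrow> vec_tendsto m (\<lambda>t. zt t l) (z l) F"
    and X0_carrier: "\<forall>\<^sub>F t in F. \<forall>n\<in>{1..N t}. X0 t n \<in> carrier_vec m"
    and V_carrier: "\<And>i. i \<in> {1..k} \<Longrightarrow> \<forall>\<^sub>F t in F. \<forall>n\<in>{1..N t}. V t i n \<in> carrier_vec m"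
    and W_carrier: "\<And>i. i \<in> {1..k} \<Longrightarrow> \<forall>\<^sub>F t in F. \<forall>n\<in>{1..N t}. W t i n \<in> carrier_vec (d i + m)"
    and X0_mean: "vec_tendsto m (\<lambda>t. sample_mean m (N t) (X0 t)) xb F"
    and V_mean: "\<And>i. i \<in> {1..k} \<Longrightarrow> vec_tendsto m (\<lambda>t. sample_mean m (N t) (V t i)) (0\<^sub>v m) F"
    and W_mean: "\<And>i. i \<in> {1..k} \<Longrightarrow>
      vec_tendsto (d i + m) (\<lambda>t. sample_mean (d i + m) (N t) (W t i)) (0\<^sub>v (d i + m)) F"
    and X0_cov: "mat_tendsto m m (\<lambda>t. sample_cov m m (N t) (X0 t) (X0 t)) B F"
    and V_cov: "\<And>i. i \<in> {1..k} \<Longrightarrow>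
      mat_tendsto m m (\<lambda>t. sample_cov m m (N t) (V t i) (V t i)) (Q i) F"
    and W_cov: "\<And>i. i \<in> {1..k} \<Longrightarrow> mat_tendsto (d i + m) (d i + m)
      (\<lambda>t. sample_cov (d i + m) (d i + m) (N t) (W t i) (W t i)) (aug_cov (d i) m \<gamma> (R i)) F"
    and X0_V_cov: "\<And>i. i \<in> {1..k} \<Longrightarrow>
      mat_tendsto m m (\<lambda>t. sample_cov m m (N t) (X0 t) (V t i)) (0\<^sub>m m m) F"
    and X0_W_cov: "\<And>i. i \<in> {1..k} \<Longrightarrow> mat_tendsto m (d i + m)
      (\<lambda>t. sample_cov m (d i + m) (N t) (X0 t) (W t i)) (0\<^sub>m m (d i + m)) F"
    and V_V_cov: "\<And>i i'. i \<in> {1..k} \<Longrightarrow> i' \<in> {1..k} \<Longrightarrow> i \<noteq> i' \<Longrightarrow>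
      mat_tendsto m m (\<lambda>t. sample_cov m m (N t) (V t i) (V t i')) (0\<^sub>m m m) F"
    and V_W_cov: "\<And>i i'. i \<in> {1..k} \<Longrightarrow> i' \<in> {1..k} \<Longrightarrow> mat_tendsto m (d i' + m)
      (\<lambda>t. sample_cov m (d i' + m) (N t) (V t i) (W t i')) (0\<^sub>m m (d i' + m)) F"
    and W_W_cov: "\<And>i i'. i \<in> {1..k} \<Longrightarrow> i' \<in> {1..k} \<Longrightarrow> i \<noteq> i' \<Longrightarrow>
      mat_tendsto (d i + m) (d i' + m)
      (\<lambda>t. sample_cov (d i + m) (d i' + m) (N t) (W t i) (W t i')) (0\<^sub>m (d i + m) (d i' + m)) F"
begin

abbreviation "tan_M \<equiv> (\<lambda>i. M' i (z (i - 1)))"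
abbreviation "tan_H \<equiv> (\<lambda>i. H' i (z i) @\<^sub>r 1\<^sub>m m)"
abbreviation "noise_cov \<equiv> (\<lambda>i. aug_cov (d i) m \<gamma> (R i))"
text \<open>The constant terms left when the tangent maps are expanded at the limit point
  \<open>z\<close>: the forecast becomes \<open>tan_M i *\<^sub>v x + model_shift i\<close> plus
  noise, and the innovation \<open>obs_shift i - tan_H i *\<^sub>v x\<close> minus noise.\<close>

abbreviation "model_shift \<equiv> (\<lambda>i. M i (z (i - 1)) - M' i (z (i - 1)) *\<^sub>v z (i - 1) + \<mu> i)"
abbreviation "obs_shift \<equiv>
  (\<lambda>i. (y i @\<^sub>v z i) - aug_obs (H i) (z i) + (H' i (z i) @\<^sub>r 1\<^sub>m m) *\<^sub>v z i)"

lemma z_carrier: "l \<le> k \<Longrightarrow> z l \<in> carrier_vec m"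
  by (rule vec_tendstoD(1)[OF z_lim])

lemma tan_M_carrier: "i \<in> {1..k} \<Longrightarrow> tan_M i \<in> carrier_mat m m"
  using C1_map_closed(2)[OF C1_M] z_carrier by auto

lemma tan_H_carrier: "i \<in> {1..k} \<Longrightarrow> tan_H i \<in> carrier_mat (d i + m) m"
  using C1_map_closed(2)[OF C1_H] z_carrier by auto

lemma aug_obs_carrier: "i \<in> {1..k} \<Longrightarrow> x \<in> carrier_vec m \<Longrightarrow> aug_obs (H i) x \<in> carrier_vec (d i + m)"
  using C1_map_closed(1)[OF C1_H] unfolding aug_obs_def by auto

lemma model_shift_carrier: "i \<in> {1..k} \<Longrightarrow> model_shift i \<in> carrier_vec m"
  using tan_M_carrier[of i] z_carrier[of "i - 1"] \<mu>_carrier[of i]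
    C1_map_closed(1)[OF C1_M, of i "z (i - 1)"] by auto

lemma obs_shift_carrier: "i \<in> {1..k} \<Longrightarrow> obs_shift i \<in> carrier_vec (d i + m)"
  using tan_H_carrier[of i] z_carrier[of i] y_carrier[of i] aug_obs_carrier[of i "z i"]
  by (auto intro!: add_carrier_vec minus_carrier_vec mult_mat_vec_carrier)

sublocale smoothing k m "\<lambda>i. d i + m" tan_M tan_H B Q noise_cov xb model_shift obs_shift
  by unfold_locales
    (use tan_M_carrier tan_H_carrier model_shift_carrier obs_shift_carrier B_spd Q_spd aug_cov_spd
      xb_carrier in auto)

definition tracks where
  "tracks E i x C \<longleftrightarrow>
     (\<forall>l\<le>i. \<forall>\<^sub>F t in F. \<forall>n\<in>{1..N t}. E t n l \<in> carrier_vec m) \<and>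
     (\<forall>l\<le>i. vec_tendsto m (\<lambda>t. sample_mean m (N t) (\<lambda>n. E t n l)) (x l) F) \<and>
     (\<forall>l\<le>i. \<forall>l'\<le>i. mat_tendsto m m
        (\<lambda>t. sample_cov m m (N t) (\<lambda>n. E t n l) (\<lambda>n. E t n l')) (C l l') F)"

text \<open>\<open>Z\<close> is a noise family that has not entered the ensemble yet. For a finite
  ensemble its sample covariance with the states is a nonzero random matrix, so its vanishing in the
  limit has to be propagated through every step.\<close>

definition uncorrelated where
  "uncorrelated E i q Z \<longleftrightarrow>
     (\<forall>l\<le>i. mat_tendsto m q (\<lambda>t. sample_cov m q (N t) (\<lambda>n. E t n l) (Z t)) (0\<^sub>m m q) F)"

lemma tracksD:
  assumes "tracks E i x C" "l \<le> i"
  shows "\<forall>\<^sub>F t in F. \<forall>n\<in>{1..N t}. E t n l \<in> carrier_vec m"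
    "vec_tendsto m (\<lambda>t. sample_mean m (N t) (\<lambda>n. E t n l)) (x l) F"
    "l' \<le> i \<Longrightarrow> mat_tendsto m m
      (\<lambda>t. sample_cov m m (N t) (\<lambda>n. E t n l) (\<lambda>n. E t n l')) (C l l') F"
  using assms unfolding tracks_def by auto

lemma uncorrelatedD:
  assumes "uncorrelated E i q Z" "l \<le> i"
  shows "mat_tendsto m q (\<lambda>t. sample_cov m q (N t) (\<lambda>n. E t n l) (Z t)) (0\<^sub>m m q) F"
    "mat_tendsto q m (\<lambda>t. sample_cov q m (N t) (Z t) (\<lambda>n. E t n l)) (0\<^sub>m q m) F"
  using assms tendsto_sample_cov_swap[of m q N "\<lambda>t n. E t n l" Z "0\<^sub>m m q" F]
  unfolding uncorrelated_def by auto

section \<open>Forecast step for large ensembles\<close>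

context
  fixes i :: nat and E :: "'t \<Rightarrow> nat \<Rightarrow> nat \<Rightarrow> real vec"
    and x :: "nat \<Rightarrow> real vec" and C :: "nat \<Rightarrow> nat \<Rightarrow> real mat"
  assumes i: "Suc i \<in> {1..k}" and E: "tracks E i x C"
    and E_V: "\<And>q. q \<in> {1..k} \<Longrightarrow> i < q \<Longrightarrow> uncorrelated E i m (\<lambda>t. V t q)"
    and E_W: "\<And>q. q \<in> {1..k} \<Longrightarrow> i < q \<Longrightarrow> uncorrelated E i (d q + m) (\<lambda>t. W t q)"
begin

definition forecasted where
  "forecasted t = forecast tangent_model (Suc i) (zt t) (V t (Suc i)) (E t)"

definition forecasted_mean where
  "forecasted_mean = x(Suc i := tan_M (Suc i) *\<^sub>v x i + model_shift (Suc i))"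

definition forecasted_cov where
  "forecasted_cov l l' =
     (if l = Suc i
      then if l' = Suc i
        then tan_M (Suc i) * C i i * transpose_mat (tan_M (Suc i)) + Q (Suc i)
        else tan_M (Suc i) * C i l'
      else if l' = Suc i then C l i * transpose_mat (tan_M (Suc i)) else C l l')"

lemma forecasted_old: "l \<le> i \<Longrightarrow> forecasted t n l = E t n l"
  unfolding forecasted_def forecast_def by simp

lemma tan_M_lim: "mat_tendsto m m (\<lambda>t. M' (Suc i) (zt t i)) (tan_M (Suc i)) F"
  using C1_map_tendsto_jacobian[OF C1_M[OF i] z_lim[of i]] i by simp

lemma model_shift_lim:
  "vec_tendsto m (\<lambda>t. M (Suc i) (zt t i) - M' (Suc i) (zt t i) *\<^sub>v zt t i + \<mu> (Suc i))
    (model_shift (Suc i)) F"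
  using tan_M_lim z_lim[of i] i
  by (auto intro!: vec_tendsto_add vec_tendsto_diff vec_tendsto_const \<mu>_carrier
      C1_map_tendsto[OF C1_M] intro: vec_tendsto_mult_mat_vec)

text \<open>The coefficients are those at the current point \<open>zt t\<close> and not at its
  limit. The factor \<open>1\<^sub>m m\<close> makes the noise fit the general affine shape.\<close>

lemma forecasted_new: "\<forall>\<^sub>F t in F. \<forall>n\<in>{1..N t}. forecasted t n (Suc i) =
    M' (Suc i) (zt t i) *\<^sub>v E t n i + 1\<^sub>m m *\<^sub>v V t (Suc i) n
    + (M (Suc i) (zt t i) - M' (Suc i) (zt t i) *\<^sub>v zt t i + \<mu> (Suc i))"
proof -
  have z: "\<forall>\<^sub>F t in F. zt t i \<in> carrier_vec m"
    using vec_tendstoD(2)[OF z_lim[of i]] i by simp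
  show ?thesis
    using mat_tendstoD(2)[OF tan_M_lim] z tracksD(1)[OF E order_refl] V_carrier[OF i]
  proof eventually_elim
    case (elim t)
    have Mz: "M (Suc i) (zt t i) \<in> carrier_vec m"
      by (rule C1_map_closed(1)[OF C1_M[OF i] elim(2)])
    show ?case
    proof
      fix n assume n: "n \<in> {1..N t}"
      let ?A = "M' (Suc i) (zt t i)"
      have "?A *\<^sub>v (E t n i - zt t i) = ?A *\<^sub>v E t n i - ?A *\<^sub>v zt t i"
        using elim n by (intro mult_minus_distrib_mat_vec[of _ m m]) auto
      moreover have "?A *\<^sub>v E t n i \<in> carrier_vec m" "?A *\<^sub>v zt t i \<in> carrier_vec m"
        "V t (Suc i) n \<in> carrier_vec m"
        using elim n by (auto intro: mult_mat_vec_carrier)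
      moreover have "a - b + Mx + c + v = a + v + (Mx - b + c)"
        if "a \<in> carrier_vec m" "b \<in> carrier_vec m" "Mx \<in> carrier_vec m" "c \<in> carrier_vec m"
          "v \<in> carrier_vec m" for a b c v Mx :: "real vec"
        using that by (intro eq_vecI) auto
      ultimately show "forecasted t n (Suc i) = ?A *\<^sub>v E t n i + 1\<^sub>m m *\<^sub>v V t (Suc i) n
          + (M (Suc i) (zt t i) - ?A *\<^sub>v zt t i + \<mu> (Suc i))"
        using Mz \<mu>_carrier[OF i] unfolding forecasted_def forecast_def tangent_model_def by simp
    qed
  qed
qed

lemmas forecasted_affine = tan_M_lim mat_tendsto_const[OF one_carrier_mat, of m F] model_shift_lim
  tracksD(1)[OF E order_refl] V_carrier[OF i] forecasted_new

lemma C_carrier: "l \<le> i \<Longrightarrow> l' \<le> i \<Longrightarrow> C l l' \<in> carrier_mat m m"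
  using mat_tendstoD(1)[OF tracksD(3)[OF E]] by simp

lemma forecasted_uncorrelated:
  assumes "uncorrelated E i q Z"
    and "mat_tendsto m q (\<lambda>t. sample_cov m q (N t) (V t (Suc i)) (Z t)) (0\<^sub>m m q) F"
  shows "uncorrelated forecasted (Suc i) q Z"
  unfolding uncorrelated_def
proof (intro allI impI)
  fix l assume "l \<le> Suc i"
  have "mat_tendsto m q (\<lambda>t. sample_cov m q (N t) (\<lambda>n. forecasted t n (Suc i)) (Z t))
      (tan_M (Suc i) * 0\<^sub>m m q + 1\<^sub>m m * 0\<^sub>m m q) F"
    by (rule tendsto_sample_cov_affine_left[OF forecasted_affine N_ge_2
          uncorrelatedD(1)[OF assms(1) order_refl] assms(2)])
  then show "mat_tendsto m q (\<lambda>t. sample_cov m q (N t) (\<lambda>n. forecasted t n l) (Z t)) (0\<^sub>m m q) F"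
    using \<open>l \<le> Suc i\<close> uncorrelatedD(1)[OF assms(1), of l] tan_M_carrier[OF i]
    by (cases "l = Suc i") (auto simp: forecasted_old)
qed

text \<open>Covariances are expanded one argument at a time. The right argument gives those of old
  blocks and of the model noise with the new block; expanding the left argument then gives the
  variance of the new block, where the noise contributes \<open>Q\<close>.\<close>

lemma forecasted_tracks: "tracks forecasted (Suc i) forecasted_mean forecasted_cov"
proof -
  let ?i = "Suc i"
  have F: "tan_M ?i \<in> carrier_mat m m" "transpose_mat (tan_M ?i) \<in> carrier_mat m m"
    using tan_M_carrier[OF i] by auto
  have Q: "Q ?i \<in> carrier_mat m m"
    by (rule sym_pos_defD(1)[OF Q_spd[OF i]])
  have V: "uncorrelated E i m (\<lambda>t. V t ?i)"
    using E_V[OF i] by simp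
  have old_new: "mat_tendsto m m (\<lambda>t. sample_cov m m (N t) (\<lambda>n. E t n l) (\<lambda>n. forecasted t n ?i))
      (C l i * transpose_mat (tan_M ?i)) F" if "l \<le> i" for l
  proof -
    have "C l i * transpose_mat (tan_M ?i) + 0\<^sub>m m m * transpose_mat (1\<^sub>m m) =
        C l i * transpose_mat (tan_M ?i)"
      using C_carrier[OF that order_refl] F by simp
    then show ?thesis
      using tendsto_sample_cov_affine_right[OF forecasted_affine N_ge_2 tracksD(3)[OF E that order_refl]
          uncorrelatedD(1)[OF V that]] by simp
  qed
  have V_new: "mat_tendsto m m (\<lambda>t. sample_cov m m (N t) (V t ?i) (\<lambda>n. forecasted t n ?i)) (Q ?i) F"
  proof -
    have "0\<^sub>m m m * transpose_mat (tan_M ?i) + Q ?i * transpose_mat (1\<^sub>m m) = Q ?i"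
      using Q F by simp
    then show ?thesis
      using tendsto_sample_cov_affine_right[OF forecasted_affine N_ge_2 uncorrelatedD(2)[OF V order_refl]
          V_cov[OF i]] by simp
  qed
  have new_old: "mat_tendsto m m (\<lambda>t. sample_cov m m (N t) (\<lambda>n. forecasted t n ?i) (\<lambda>n. E t n l))
      (tan_M ?i * C i l) F" if "l \<le> i" for l
  proof -
    have "tan_M ?i * C i l + 1\<^sub>m m * 0\<^sub>m m m = tan_M ?i * C i l"
      using C_carrier[OF order_refl that] F by simp
    then show ?thesis
      using tendsto_sample_cov_affine_left[OF forecasted_affine N_ge_2 tracksD(3)[OF E order_refl that]
          uncorrelatedD(2)[OF V that]] by simp
  qed
  have new_new: "mat_tendsto m m (\<lambda>t. sample_cov m m (N t) (\<lambda>n. forecasted t n ?i) (\<lambda>n. forecasted t n ?i))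
      (tan_M ?i * C i i * transpose_mat (tan_M ?i) + Q ?i) F"
  proof -
    have "tan_M ?i * (C i i * transpose_mat (tan_M ?i)) + 1\<^sub>m m * Q ?i =
        tan_M ?i * C i i * transpose_mat (tan_M ?i) + Q ?i"
      using assoc_mult_mat[OF F(1) C_carrier[OF order_refl order_refl] F(2)] Q by simp
    then show ?thesis
      using tendsto_sample_cov_affine_left[OF forecasted_affine N_ge_2 old_new[OF order_refl] V_new] by simp
  qed
  have x: "x i \<in> carrier_vec m"
    by (rule vec_tendstoD(1)[OF tracksD(2)[OF E order_refl]])
  have "tan_M ?i *\<^sub>v x i + 1\<^sub>m m *\<^sub>v 0\<^sub>v m + model_shift ?i = tan_M ?i *\<^sub>v x i + model_shift ?i"
    using F(1) x by simp
  then have mean: "vec_tendsto m (\<lambda>t. sample_mean m (N t) (\<lambda>n. forecasted t n ?i))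
      (tan_M ?i *\<^sub>v x i + model_shift ?i) F"
    using tendsto_sample_mean_affine[OF forecasted_affine N_ge_2 tracksD(2)[OF E order_refl] V_mean[OF i]]
    by simp
  show ?thesis
    unfolding tracks_def
  proof (intro conjI allI impI)
    fix l assume l: "l \<le> ?i"
    show "\<forall>\<^sub>F t in F. \<forall>n\<in>{1..N t}. forecasted t n l \<in> carrier_vec m"
      using l eventually_carriers_affine[OF forecasted_affine] tracksD(1)[OF E, of l]
      by (cases "l = ?i") (auto simp: forecasted_old)
    show "vec_tendsto m (\<lambda>t. sample_mean m (N t) (\<lambda>n. forecasted t n l)) (forecasted_mean l) F"
      using l mean tracksD(2)[OF E, of l]
      by (cases "l = ?i") (auto simp: forecasted_old forecasted_mean_def)
    fix l' assume l': "l' \<le> ?i"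
    show "mat_tendsto m m (\<lambda>t. sample_cov m m (N t) (\<lambda>n. forecasted t n l) (\<lambda>n. forecasted t n l'))
        (forecasted_cov l l') F"
      using l l' new_new new_old[of l'] old_new[of l] tracksD(3)[OF E, of l l']
      by (cases "l = ?i"; cases "l' = ?i") (auto simp: forecasted_old forecasted_cov_def)
  qed
qed

end

section \<open>Analysis step for large ensembles\<close>

context
  fixes i :: nat and E :: "'t \<Rightarrow> nat \<Rightarrow> nat \<Rightarrow> real vec"
    and x :: "nat \<Rightarrow> real vec" and C :: "nat \<Rightarrow> nat \<Rightarrow> real mat"
  assumes i: "i \<in> {1..k}" and E: "tracks E i x C" and pred: "predicted i x C"
    and E_W: "uncorrelated E i (d i + m) (\<lambda>t. W t i)"
begin

definition innovation_cov where
  "innovation_cov = tan_H i * C i i * transpose_mat (tan_H i)"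

definition limit_gain where
  "limit_gain l = C l i * transpose_mat (tan_H i) * minv (innovation_cov + noise_cov i)"

definition innovations where
  "innovations t n = innovation tangent_obs i (zt t) (W t i) (E t) n"

definition analysed where
  "analysed t = analysis tangent_obs (N t) i (zt t) (W t i) (E t)"

lemma tan_H_lim: "mat_tendsto (d i + m) m (\<lambda>t. H' i (zt t i) @\<^sub>r 1\<^sub>m m) (tan_H i) F"
  using C1_map_tendsto_aug_jacobian[OF C1_H[OF i] z_lim[of i]] i by simp

lemma obs_shift_lim:
  "vec_tendsto (d i + m) (\<lambda>t. (y i @\<^sub>v zt t i) - aug_obs (H i) (zt t i)
      + (H' i (zt t i) @\<^sub>r 1\<^sub>m m) *\<^sub>v zt t i) (obs_shift i) F"
  using i z_lim[of i]
  by (intro vec_tendsto_add vec_tendsto_diff vec_tendsto_append vec_tendsto_const y_carrier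
      aug_obs_tendsto[OF C1_H] vec_tendsto_mult_mat_vec[OF tan_H_lim]) auto

lemma innovations_eq: "\<forall>\<^sub>F t in F. \<forall>n\<in>{1..N t}. innovations t n =
    (- (H' i (zt t i) @\<^sub>r 1\<^sub>m m)) *\<^sub>v E t n i + (- 1\<^sub>m (d i + m)) *\<^sub>v W t i n
    + ((y i @\<^sub>v zt t i) - aug_obs (H i) (zt t i) + (H' i (zt t i) @\<^sub>r 1\<^sub>m m) *\<^sub>v zt t i)"
proof -
  have z: "\<forall>\<^sub>F t in F. zt t i \<in> carrier_vec m"
    using vec_tendstoD(2)[OF z_lim[of i]] i by simp
  show ?thesis
    using mat_tendstoD(2)[OF tan_H_lim] z tracksD(1)[OF E order_refl] W_carrier[OF i]
  proof eventually_elim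
    case (elim t)
    show ?case
    proof
      fix n assume n: "n \<in> {1..N t}"
      let ?A = "H' i (zt t i) @\<^sub>r 1\<^sub>m m" and ?y = "y i @\<^sub>v zt t i" and ?h = "aug_obs (H i) (zt t i)"
      have En: "E t n i \<in> carrier_vec m" and Wn: "W t i n \<in> carrier_vec (d i + m)"
        using elim n by auto
      have "?A *\<^sub>v (E t n i - zt t i) = ?A *\<^sub>v E t n i - ?A *\<^sub>v zt t i"
        by (rule mult_minus_distrib_mat_vec[OF elim(1) En elim(2)])
      moreover have "(- ?A) *\<^sub>v E t n i = - (?A *\<^sub>v E t n i)"
        using elim(1) En by simp
      moreover have "(- 1\<^sub>m (d i + m)) *\<^sub>v W t i n = - W t i n"
        using Wn by simp
      moreover have "?A *\<^sub>v E t n i \<in> carrier_vec (d i + m)" "?A *\<^sub>v zt t i \<in> carrier_vec (d i + m)"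
        using elim En by (auto intro: mult_mat_vec_carrier)
      moreover have "?y \<in> carrier_vec (d i + m)" "?h \<in> carrier_vec (d i + m)"
        using y_carrier[OF i] aug_obs_carrier[OF i elim(2)] elim(2) by auto
      moreover have "a - w - h - (b - c) = - b + - w + (a - h + c)"
        if "a \<in> carrier_vec (d i + m)" "w \<in> carrier_vec (d i + m)" "h \<in> carrier_vec (d i + m)"
          "b \<in> carrier_vec (d i + m)" "c \<in> carrier_vec (d i + m)" for a w h b c :: "real vec"
        using that by (intro eq_vecI) auto
      ultimately show "innovations t n = (- ?A) *\<^sub>v E t n i + (- 1\<^sub>m (d i + m)) *\<^sub>v W t i n
          + (?y - ?h + ?A *\<^sub>v zt t i)"
        using Wn unfolding innovations_def innovation_def tangent_obs_def by simp
    qed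
  qed
qed

lemmas innovations_affine = mat_tendsto_uminus[OF tan_H_lim]
  mat_tendsto_uminus[OF mat_tendsto_const[OF one_carrier_mat, of "d i + m" F]] obs_shift_lim
  tracksD(1)[OF E order_refl] W_carrier[OF i] innovations_eq

lemma analysis_cov_carrier: "l \<le> i \<Longrightarrow> l' \<le> i \<Longrightarrow> C l l' \<in> carrier_mat m m"
  using mat_tendstoD(1)[OF tracksD(3)[OF E]] by simp

lemma analysis_carriers:
  "tan_H i \<in> carrier_mat (d i + m) m" "transpose_mat (tan_H i) \<in> carrier_mat m (d i + m)"
  "noise_cov i \<in> carrier_mat (d i + m) (d i + m)"
  "innovation_cov \<in> carrier_mat (d i + m) (d i + m)" "det (innovation_cov + noise_cov i) \<noteq> 0"
  "minv (innovation_cov + noise_cov i) \<in> carrier_mat (d i + m) (d i + m)"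
  "l \<le> i \<Longrightarrow> limit_gain l \<in> carrier_mat m (d i + m)"
proof -
  show H: "tan_H i \<in> carrier_mat (d i + m) m" "transpose_mat (tan_H i) \<in> carrier_mat m (d i + m)"
    and R: "noise_cov i \<in> carrier_mat (d i + m) (d i + m)"
    using tan_H_carrier[OF i] aug_cov_carrier[OF i] by auto
  show S: "innovation_cov \<in> carrier_mat (d i + m) (d i + m)" "det (innovation_cov + noise_cov i) \<noteq> 0"
    unfolding innovation_cov_def using innovation_cov_props[OF pred i] by auto
  show inv: "minv (innovation_cov + noise_cov i) \<in> carrier_mat (d i + m) (d i + m)"
    using minv_props(1)[of "innovation_cov + noise_cov i" "d i + m"] S R by simp
  show "limit_gain l \<in> carrier_mat m (d i + m)" if "l \<le> i"
    unfolding limit_gain_def using analysis_cov_carrier[OF that order_refl] H inv by simp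
qed

lemma E_innovations_cov:
  assumes "l \<le> i"
  shows "mat_tendsto m (d i + m) (\<lambda>t. sample_cov m (d i + m) (N t) (\<lambda>n. E t n l) (innovations t))
    (- (C l i * transpose_mat (tan_H i))) F"
proof -
  have "C l i * transpose_mat (- tan_H i) + 0\<^sub>m m (d i + m) * transpose_mat (- 1\<^sub>m (d i + m)) =
      - (C l i * transpose_mat (tan_H i))"
    using analysis_cov_carrier[OF assms order_refl] analysis_carriers(1,2)
    by (auto simp: transpose_uminus mult_uminus_mat[of _ m m _ "d i + m"])
  then show ?thesis
    using tendsto_sample_cov_affine_right[OF innovations_affine N_ge_2 tracksD(3)[OF E assms order_refl]
        uncorrelatedD(1)[OF E_W assms]] by simp
qed

lemma innovations_E_cov:
  assumes "l \<le> i"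
  shows "mat_tendsto (d i + m) m (\<lambda>t. sample_cov (d i + m) m (N t) (innovations t) (\<lambda>n. E t n l))
    (- (tan_H i * C i l)) F"
proof -
  have "- tan_H i * C i l + - 1\<^sub>m (d i + m) * 0\<^sub>m (d i + m) m = - (tan_H i * C i l)"
    using analysis_cov_carrier[OF order_refl assms] analysis_carriers(1,2)
    by (auto simp: mult_uminus_mat[of _ "d i + m" m _ m])
  then show ?thesis
    using tendsto_sample_cov_affine_left[OF innovations_affine N_ge_2 tracksD(3)[OF E order_refl assms]
        uncorrelatedD(2)[OF E_W assms]] by simp
qed

text \<open>States and observation noise enter with the same sign and are asymptotically
  uncorrelated, so their covariances add up to the matrix that the gain inverts.\<close>

lemma innovations_innovations_cov:
  "mat_tendsto (d i + m) (d i + m)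
    (\<lambda>t. sample_cov (d i + m) (d i + m) (N t) (innovations t) (innovations t)) (innovation_cov + noise_cov i) F"
proof -
  let ?q = "d i + m" and ?Ht = "transpose_mat (tan_H i)"
  note c = analysis_carriers analysis_cov_carrier[OF order_refl order_refl]
  have "0\<^sub>m ?q m * transpose_mat (- tan_H i) + noise_cov i * transpose_mat (- 1\<^sub>m ?q) = - noise_cov i"
    using c by (auto simp: transpose_uminus mult_uminus_mat[of _ ?q ?q _ ?q])
  then have W_innovations: "mat_tendsto ?q ?q (\<lambda>t. sample_cov ?q ?q (N t) (W t i) (innovations t)) (- noise_cov i) F"
    using tendsto_sample_cov_affine_right[OF innovations_affine N_ge_2 uncorrelatedD(2)[OF E_W order_refl]
        W_cov[OF i]] by simp
  have "- tan_H i * - (C i i * ?Ht) + - 1\<^sub>m ?q * - noise_cov i = innovation_cov + noise_cov i"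
    using c assoc_mult_mat[OF c(1) analysis_cov_carrier[OF order_refl order_refl] c(2)]
    by (auto simp: mult_uminus_mat[of _ ?q m _ ?q] mult_uminus_mat[of _ ?q ?q _ ?q]
        innovation_cov_def)
  then show ?thesis
    using tendsto_sample_cov_affine_left[OF innovations_affine N_ge_2 E_innovations_cov[OF order_refl] W_innovations]
    by simp
qed

lemma innovations_mean: "vec_tendsto (d i + m) (\<lambda>t. sample_mean (d i + m) (N t) (innovations t))
    (obs_shift i - tan_H i *\<^sub>v x i) F"
proof -
  have x: "x i \<in> carrier_vec m"
    by (rule vec_tendstoD(1)[OF tracksD(2)[OF E order_refl]])
  have "- tan_H i *\<^sub>v x i = - (tan_H i *\<^sub>v x i)"
    using carrier_matD(2)[OF analysis_carriers(1)] x by simp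
  moreover have "tan_H i *\<^sub>v x i \<in> carrier_vec (d i + m)"
    using analysis_carriers(1) x by (rule mult_mat_vec_carrier)
  ultimately have "- tan_H i *\<^sub>v x i + - 1\<^sub>m (d i + m) *\<^sub>v 0\<^sub>v (d i + m) + obs_shift i =
      obs_shift i - tan_H i *\<^sub>v x i"
    using obs_shift_carrier[OF i] mult_mat_zero_vec[of "- 1\<^sub>m (d i + m)" "d i + m" "d i + m"]
    by (intro eq_vecI) auto
  then show ?thesis
    using tendsto_sample_mean_affine[OF innovations_affine N_ge_2 tracksD(2)[OF E order_refl] W_mean[OF i]]
    by simp
qed

text \<open>Because the tangent operator is linear, the sample gain at each \<open>t\<close> is
  already the Kalman gain formula evaluated at sample covariances; the limit follows from continuity
  of the inverse.\<close>

lemma gain_lim: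
  assumes l: "l \<le> i"
  shows "mat_tendsto m (d i + m) (\<lambda>t. gain tangent_obs (N t) i (zt t) (E t) l) (limit_gain l) F"
proof (rule mat_tendsto_cong)
  let ?q = "d i + m"
  let ?H = "\<lambda>t. H' i (zt t i) @\<^sub>r 1\<^sub>m m"
  let ?c = "\<lambda>t l l'. sample_cov m m (N t) (\<lambda>n. E t n l) (\<lambda>n. E t n l')"
  show "mat_tendsto m ?q (\<lambda>t. ?c t l i * transpose_mat (?H t)
      * minv (?H t * ?c t i i * transpose_mat (?H t) + noise_cov i)) (limit_gain l) F"
    unfolding limit_gain_def
    by (rule mat_tendsto_mult[OF mat_tendsto_mult[OF tracksD(3)[OF E l order_refl]
          mat_tendsto_transpose[OF tan_H_lim]]
        mat_tendsto_minv[OF mat_tendsto_add[OF mat_tendsto_mult[OF mat_tendsto_mult[OF tan_H_lim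
            tracksD(3)[OF E order_refl order_refl]] mat_tendsto_transpose[OF tan_H_lim],
            folded innovation_cov_def]
          mat_tendsto_const[OF analysis_carriers(3)]] analysis_carriers(5)]])
  show "\<forall>\<^sub>F t in F. ?c t l i * transpose_mat (?H t)
      * minv (?H t * ?c t i i * transpose_mat (?H t) + noise_cov i)
      = gain tangent_obs (N t) i (zt t) (E t) l"
    using mat_tendstoD(2)[OF tan_H_lim] tracksD(1)[OF E l] tracksD(1)[OF E order_refl]
  proof eventually_elim
    case (elim t)
    let ?m = "\<lambda>l. sample_mean m (N t) (\<lambda>n. E t n l)"
    let ?h = "\<lambda>n. ?H t *\<^sub>v (E t n i - ?m i)"
    have c: "E t n i - ?m i \<in> carrier_vec m" if "n \<in> {1..N t}" for n
      using elim that by (intro minus_carrier_vec) auto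
    have "sample_outer m ?q (N t) (\<lambda>n. E t n l - ?m l) ?h = ?c t l i * transpose_mat (?H t)"
      unfolding sample_cov_def by (rule sample_outer_mult_right[OF elim(1) c])
    moreover have "sample_outer ?q ?q (N t) ?h ?h = ?H t * ?c t i i * transpose_mat (?H t)"
    proof -
      have "sample_outer ?q ?q (N t) ?h ?h =
          ?H t * sample_outer m ?q (N t) (\<lambda>n. E t n i - ?m i) ?h"
        by (rule sample_outer_mult_left[OF elim(1) c])
      also have "sample_outer m ?q (N t) (\<lambda>n. E t n i - ?m i) ?h = ?c t i i * transpose_mat (?H t)"
        unfolding sample_cov_def by (rule sample_outer_mult_right[OF elim(1) c])
      also have "?H t * (?c t i i * transpose_mat (?H t)) = ?H t * ?c t i i * transpose_mat (?H t)"
        using elim(1) by (intro assoc_mult_mat[symmetric, of _ ?q m _ m _ ?q]) auto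
      finally show ?thesis .
    qed
    ultimately show ?case
      unfolding gain_def Let_def tangent_obs_def by simp
  qed
qed

text \<open>The gain is random and depends on all members, yet it is the same matrix for each
  \<open>n\<close>. This puts the nonlinear update into the affine shape whose means and covariances
  are known.\<close>

lemma analysed_eq:
  assumes "l \<le> i"
  shows "\<forall>\<^sub>F t in F. \<forall>n\<in>{1..N t}. analysed t n l = 1\<^sub>m m *\<^sub>v E t n l
    + gain tangent_obs (N t) i (zt t) (E t) l *\<^sub>v innovations t n + 0\<^sub>v m"
  using mat_tendstoD(2)[OF gain_lim[OF assms]] tracksD(1)[OF E assms]
    eventually_carriers_affine[OF innovations_affine]
proof eventually_elim
  case (elim t)
  show ?case
  proof
    fix n assume n: "n \<in> {1..N t}"
    have "gain tangent_obs (N t) i (zt t) (E t) l *\<^sub>v innovations t n \<in> carrier_vec m"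
      using elim n by (intro mult_mat_vec_carrier) auto
    then show "analysed t n l = 1\<^sub>m m *\<^sub>v E t n l
        + gain tangent_obs (N t) i (zt t) (E t) l *\<^sub>v innovations t n + 0\<^sub>v m"
      using elim n unfolding analysed_def analysis_def innovations_def by simp
  qed
qed

lemmas analysed_affine = mat_tendsto_const[OF one_carrier_mat, of m F] gain_lim
  vec_tendsto_const[OF zero_carrier_vec, of m F] tracksD(1)[OF E]
  eventually_carriers_affine[OF innovations_affine] analysed_eq

lemma analysed_uncorrelated:
  assumes "uncorrelated E i q Z"
    and "mat_tendsto (d i + m) q (\<lambda>t. sample_cov (d i + m) q (N t) (W t i) (Z t)) (0\<^sub>m (d i + m) q) F"
  shows "uncorrelated analysed i q Z"
  unfolding uncorrelated_def
proof (intro allI impI)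
  fix l assume l: "l \<le> i"
  have "- tan_H i * 0\<^sub>m m q + - 1\<^sub>m (d i + m) * 0\<^sub>m (d i + m) q = 0\<^sub>m (d i + m) q"
    using analysis_carriers by (auto simp: mult_uminus_mat[of _ _ _ _ q])
  then have "mat_tendsto (d i + m) q (\<lambda>t. sample_cov (d i + m) q (N t) (innovations t) (Z t))
      (0\<^sub>m (d i + m) q) F"
    using tendsto_sample_cov_affine_left[OF innovations_affine N_ge_2
        uncorrelatedD(1)[OF assms(1) order_refl] assms(2)] by simp
  from tendsto_sample_cov_affine_left[OF analysed_affine(1) analysed_affine(2)[OF l] analysed_affine(3)
      analysed_affine(4)[OF l] analysed_affine(5) analysed_affine(6)[OF l] N_ge_2 uncorrelatedD(1)[OF assms(1) l] this]
  show "mat_tendsto m q (\<lambda>t. sample_cov m q (N t) (\<lambda>n. analysed t n l) (Z t)) (0\<^sub>m m q) F"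
    using analysis_carriers(7)[OF l] by simp
qed

text \<open>Perturbing the observations by noise of the right covariance is what makes the ensemble
  covariance follow the Kalman update.\<close>

lemma analysed_cov:
  assumes l: "l \<le> i" and l': "l' \<le> i"
  shows "mat_tendsto m m (\<lambda>t. sample_cov m m (N t) (\<lambda>n. analysed t n l) (\<lambda>n. analysed t n l'))
    (C l l' - limit_gain l * (tan_H i * C i l')) F"
proof -
  let ?q = "d i + m" and ?Ht = "transpose_mat (tan_H i)" and ?K = limit_gain
  let ?D = "innovation_cov + noise_cov i"
  note c = analysis_carriers analysis_cov_carrier[OF l l'] analysis_cov_carrier[OF l order_refl] analysis_cov_carrier[OF order_refl l']
  have D: "?D \<in> carrier_mat ?q ?q"
    using c by simp
  have Kt: "transpose_mat (?K l') \<in> carrier_mat ?q m"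
    using c(7)[OF l'] by simp
  note aff = analysed_affine(1) analysed_affine(2)[OF l'] analysed_affine(3) analysed_affine(4)[OF l'] analysed_affine(5)
    analysed_affine(6)[OF l'] N_ge_2
  have "mat_tendsto m m (\<lambda>t. sample_cov m m (N t) (\<lambda>n. E t n l) (\<lambda>n. analysed t n l'))
      (C l l' * transpose_mat (1\<^sub>m m) + - (C l i * ?Ht) * transpose_mat (?K l')) F"
    by (rule tendsto_sample_cov_affine_right[OF aff tracksD(3)[OF E l l'] E_innovations_cov[OF l]])
  moreover have "mat_tendsto ?q m (\<lambda>t. sample_cov ?q m (N t) (innovations t) (\<lambda>n. analysed t n l'))
      (- (tan_H i * C i l') * transpose_mat (1\<^sub>m m) + ?D * transpose_mat (?K l')) F"
    by (rule tendsto_sample_cov_affine_right[OF aff innovations_E_cov[OF l'] innovations_innovations_cov])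
  ultimately have "mat_tendsto m m (\<lambda>t. sample_cov m m (N t) (\<lambda>n. analysed t n l) (\<lambda>n. analysed t n l'))
      (1\<^sub>m m * (C l l' * transpose_mat (1\<^sub>m m) + - (C l i * ?Ht) * transpose_mat (?K l'))
       + ?K l * (- (tan_H i * C i l') * transpose_mat (1\<^sub>m m) + ?D * transpose_mat (?K l'))) F"
    by (rule tendsto_sample_cov_affine_left[OF analysed_affine(1) analysed_affine(2)[OF l] analysed_affine(3)
      analysed_affine(4)[OF l] analysed_affine(5) analysed_affine(6)[OF l] N_ge_2])
  moreover have "1\<^sub>m m * (C l l' * transpose_mat (1\<^sub>m m) + - (C l i * ?Ht) * transpose_mat (?K l'))
       + ?K l * (- (tan_H i * C i l') * transpose_mat (1\<^sub>m m) + ?D * transpose_mat (?K l'))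
      = C l l' - ?K l * (tan_H i * C i l')"
  proof -
    have CH: "C l i * ?Ht \<in> carrier_mat m ?q" and HC: "tan_H i * C i l' \<in> carrier_mat ?q m"
      using c by auto
    \<comment> \<open>Expanding both updated members gives four terms. As gain times innovation
      covariance equals the covariance of state block and observed state, the quadratic term in the
      gains cancels one of the two mixed terms.\<close>
    have "?K l * ?D = C l i * ?Ht * (minv ?D * ?D)"
      unfolding limit_gain_def using c(6) D CH by (intro assoc_mult_mat) auto
    then have KD: "?K l * ?D = C l i * ?Ht"
      using minv_props(3)[OF D c(5)] right_mult_one_mat[OF CH] by simp
    have "?K l * (?D * transpose_mat (?K l')) = C l i * ?Ht * transpose_mat (?K l')"
      using assoc_mult_mat[OF c(7)[OF l] D Kt] KD by simp
    moreover have "?K l * (- (tan_H i * C i l') + ?D * transpose_mat (?K l')) =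
        ?K l * - (tan_H i * C i l') + ?K l * (?D * transpose_mat (?K l'))"
      using c(7)[OF l] HC D Kt by (intro mult_add_distrib_mat) auto
    moreover have "?K l * - (tan_H i * C i l') = - (?K l * (tan_H i * C i l'))"
      by (rule mult_uminus_mat(2)[OF c(7)[OF l] HC])
    moreover have "- (C l i * ?Ht) * transpose_mat (?K l') = - (C l i * ?Ht * transpose_mat (?K l'))"
      by (rule mult_uminus_mat(1)[OF CH Kt])
    moreover have "C l l' + - a + (- b + a) = C l l' - b"
      if "a \<in> carrier_mat m m" "b \<in> carrier_mat m m" for a b
      using that c(8) by (intro eq_matI) auto
    moreover have "C l i * ?Ht * transpose_mat (?K l') \<in> carrier_mat m m"
      "?K l * (tan_H i * C i l') \<in> carrier_mat m m"
      using CH Kt HC c(7)[OF l] by auto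
    moreover have "1\<^sub>m m * (C l l' + - (C l i * ?Ht * transpose_mat (?K l'))) =
        C l l' + - (C l i * ?Ht * transpose_mat (?K l'))"
      using c(8) CH Kt by (intro left_mult_one_mat[of _ m m]) auto
    moreover have "- (tan_H i * C i l') * 1\<^sub>m m = - (tan_H i * C i l')"
      using HC by (intro right_mult_one_mat[of _ ?q m]) auto
    moreover have "C l l' * 1\<^sub>m m = C l l'"
      by (rule right_mult_one_mat[OF c(8)])
    ultimately show ?thesis
      by simp
  qed
  ultimately show ?thesis
    by simp
qed

lemma analysed_mean:
  assumes l: "l \<le> i"
  shows "vec_tendsto m (\<lambda>t. sample_mean m (N t) (\<lambda>n. analysed t n l))
    (x l + limit_gain l *\<^sub>v (obs_shift i - tan_H i *\<^sub>v x i)) F"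
proof -
  have x: "x l \<in> carrier_vec m"
    by (rule vec_tendstoD(1)[OF tracksD(2)[OF E l]])
  have "limit_gain l *\<^sub>v (obs_shift i - tan_H i *\<^sub>v x i) \<in> carrier_vec m"
    by (rule mult_mat_vec_carrier[OF analysis_carriers(7)[OF l] vec_tendstoD(1)[OF innovations_mean]])
  then show ?thesis
    using tendsto_sample_mean_affine[OF analysed_affine(1) analysed_affine(2)[OF l] analysed_affine(3)
      analysed_affine(4)[OF l] analysed_affine(5) analysed_affine(6)[OF l] N_ge_2 tracksD(2)[OF E l] innovations_mean] x
    by simp
qed

lemma analysed_tracks:
  "tracks analysed i (\<lambda>l. x l + limit_gain l *\<^sub>v (obs_shift i - tan_H i *\<^sub>v x i))
    (\<lambda>l l'. C l l' - limit_gain l * (tan_H i * C i l'))"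
  unfolding tracks_def
  using analysed_mean analysed_cov eventually_carriers_affine[OF analysed_affine(1) analysed_affine(2) analysed_affine(3)
      analysed_affine(4) analysed_affine(5) analysed_affine(6)]
  by auto

end

text \<open>The invariant joins three facts: the limits solve the least squares problem up to time
  \<open>i\<close>, the ensemble converges to them, and it is asymptotically uncorrelated with all
  later noise. \<open>filtered\<close> also supplies the positivity that keeps the limiting
  innovation covariance invertible.\<close>

lemma ensemble_tracks:
  assumes "i \<le> k"
  shows "\<exists>x C. filtered i x C \<and>
    tracks (\<lambda>t. ensemble tangent_model tangent_obs (N t) (zt t) (X0 t) (V t) (W t) i) i x C \<and>
    (\<forall>q\<in>{1..k}. i < q \<longrightarrow>
      uncorrelated (\<lambda>t. ensemble tangent_model tangent_obs (N t) (zt t) (X0 t) (V t) (W t) i) i m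
        (\<lambda>t. V t q) \<and>
      uncorrelated (\<lambda>t. ensemble tangent_model tangent_obs (N t) (zt t) (X0 t) (V t) (W t) i) i
        (d q + m) (\<lambda>t. W t q))"
  using assms
proof (induction i)
  case 0
  show ?case
  proof (intro exI conjI ballI impI)
    show "filtered 0 (\<lambda>_. xb) (\<lambda>_ _. B)"
      by (rule filtered_0)
  qed (use X0_carrier X0_mean X0_cov X0_V_cov X0_W_cov in \<open>auto simp: tracks_def uncorrelated_def\<close>)
next
  case (Suc i)
  define E where "E t = ensemble tangent_model tangent_obs (N t) (zt t) (X0 t) (V t) (W t) i" for t
  have i: "Suc i \<in> {1..k}"
    using Suc.prems by simp
  obtain x C where filt: "filtered i x C" and E: "tracks E i x C"
    and E_V: "\<And>q. q \<in> {1..k} \<Longrightarrow> i < q \<Longrightarrow> uncorrelated E i m (\<lambda>t. V t q)"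
    and E_W: "\<And>q. q \<in> {1..k} \<Longrightarrow> i < q \<Longrightarrow> uncorrelated E i (d q + m) (\<lambda>t. W t q)"
    using Suc unfolding E_def by auto
  let ?E = "forecasted i E" and ?x = "forecasted_mean i x" and ?C = "forecasted_cov i C"
  have E': "tracks ?E (Suc i) ?x ?C"
    by (rule forecasted_tracks[OF i E E_V E_W])
  have x_eq: "?x = x(Suc i := tan_M (Suc i) *\<^sub>v x i + model_shift (Suc i))"
    by (rule forecasted_mean_def[OF i E E_V E_W])
  have C_eq: "?C l l' =
     (if l = Suc i
      then if l' = Suc i
        then tan_M (Suc i) * C i i * transpose_mat (tan_M (Suc i)) + Q (Suc i)
        else tan_M (Suc i) * C i l'
      else if l' = Suc i then C l i * transpose_mat (tan_M (Suc i)) else C l l')" for l l'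
    by (rule forecasted_cov_def[OF i E E_V E_W])
  have pred: "predicted (Suc i) ?x ?C"
    unfolding x_eq
    by (rule predicted_Suc[OF filt i]) (simp_all add: C_eq)
  \<comment> \<open>The index \<open>q = Suc i\<close> is included: the observation noise of this
    time enters only in the analysis. For the model noise the bound is strict, as the forecast has
    just used it.\<close>
  have W: "uncorrelated ?E (Suc i) (d q + m) (\<lambda>t. W t q)" if "q \<in> {1..k}" "i < q" for q
    by (rule forecasted_uncorrelated[OF i E E_V E_W E_W[OF that] V_W_cov[OF i that(1)]])
  have V: "uncorrelated ?E (Suc i) m (\<lambda>t. V t q)" if "q \<in> {1..k}" "Suc i < q" for q
    using that i by (intro forecasted_uncorrelated[OF i E E_V E_W] E_V V_V_cov) auto
  note step = i E' pred W[OF i lessI]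
  have analysed: "analysed (Suc i) ?E t =
      ensemble tangent_model tangent_obs (N t) (zt t) (X0 t) (V t) (W t) (Suc i)" for t
  proof -
    have "forecasted i E t = forecast tangent_model (Suc i) (zt t) (V t (Suc i)) (E t)"
      by (rule forecasted_def[OF i E E_V E_W])
    then show ?thesis
      unfolding analysed_def[OF step] by (simp add: E_def)
  qed
  show ?case
    unfolding analysed[symmetric]
  proof (intro exI conjI ballI impI)
    show "tracks (analysed (Suc i) ?E) (Suc i)
        (\<lambda>l. ?x l + limit_gain (Suc i) ?C l *\<^sub>v (obs_shift (Suc i) - tan_H (Suc i) *\<^sub>v ?x (Suc i)))
        (\<lambda>l l'. ?C l l' - limit_gain (Suc i) ?C l * (tan_H (Suc i) * ?C (Suc i) l'))"
      by (rule analysed_tracks[OF step])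
    show "filtered (Suc i)
        (\<lambda>l. ?x l + limit_gain (Suc i) ?C l *\<^sub>v (obs_shift (Suc i) - tan_H (Suc i) *\<^sub>v ?x (Suc i)))
        (\<lambda>l l'. ?C l l' - limit_gain (Suc i) ?C l * (tan_H (Suc i) * ?C (Suc i) l'))"
      by (rule filtered_update[OF pred i])
        (simp_all add: limit_gain_def[OF step] innovation_cov_def[OF step])
    fix q assume q: "q \<in> {1..k}" "Suc i < q"
    show "uncorrelated (analysed (Suc i) ?E) (Suc i) m (\<lambda>t. V t q)"
      by (rule analysed_uncorrelated[OF step V[OF q]])
        (use tendsto_sample_cov_swap[OF V_W_cov[OF q(1) i]] in simp)
    show "uncorrelated (analysed (Suc i) ?E) (Suc i) (d q + m) (\<lambda>t. W t q)"
      using q by (intro analysed_uncorrelated[OF step W] W_W_cov i) auto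
  qed
qed

text \<open>Expanding the linearizations moves the base point into the shifts, and the observation
  and penalty terms of one index merge into a single augmented observation term.\<close>

lemma lm_objective_eq:
  assumes x: "blocks k x"
  shows "lm_objective k M M' H H' xb \<mu> y B Q R \<gamma> z x = objective k x"
proof -
  have xc: "x l \<in> carrier_vec m" if "l \<le> k" for l
    using x that unfolding blocks_def by simp
  have model: "x i - M i (z (i - 1)) - M' i (z (i - 1)) *\<^sub>v (x (i - 1) - z (i - 1)) - \<mu> i =
      x i - tan_M i *\<^sub>v x (i - 1) - model_shift i" if i: "i \<in> {1..k}" for i
  proof -
    have c: "x i \<in> carrier_vec m" "x (i - 1) \<in> carrier_vec m" "z (i - 1) \<in> carrier_vec m"
      using i xc z_carrier by auto
    have "tan_M i *\<^sub>v (x (i - 1) - z (i - 1)) = tan_M i *\<^sub>v x (i - 1) - tan_M i *\<^sub>v z (i - 1)"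
      by (rule mult_minus_distrib_mat_vec[OF tan_M_carrier[OF i] c(2,3)])
    moreover have "tan_M i *\<^sub>v x (i - 1) \<in> carrier_vec m" "tan_M i *\<^sub>v z (i - 1) \<in> carrier_vec m"
      "M i (z (i - 1)) \<in> carrier_vec m"
      using tan_M_carrier[OF i] c C1_map_closed(1)[OF C1_M[OF i]] by auto
    moreover have "x i - a - (b - c) - \<mu> i = x i - b - (a - c + \<mu> i)"
      if "a \<in> carrier_vec m" "b \<in> carrier_vec m" "c \<in> carrier_vec m" for a b c
      using that c \<mu>_carrier[OF i] by (intro eq_vecI) auto
    ultimately show ?thesis
      by simp
  qed
  have obs: "wnorm_sq (minv (R i)) (y i - H i (z i) - H' i (z i) *\<^sub>v (x i - z i))
      + \<gamma> * (vnorm (x i - z i))\<^sup>2 = wnorm_sq (minv (noise_cov i)) (obs_shift i - tan_H i *\<^sub>v x i)"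
    if i: "i \<in> {1..k}" for i
  proof -
    have c: "x i \<in> carrier_vec m" "z i \<in> carrier_vec m"
      using i xc z_carrier by auto
    have H': "H' i (z i) \<in> carrier_mat (d i) m" and Hz: "H i (z i) \<in> carrier_vec (d i)"
      using C1_map_closed[OF C1_H[OF i] c(2)] by auto
    have app: "tan_H i *\<^sub>v v = (H' i (z i) *\<^sub>v v) @\<^sub>v v" if "v \<in> carrier_vec m" for v
      using mat_mult_append[OF H' one_carrier_mat that] that by simp
    have diff: "H' i (z i) *\<^sub>v (x i - z i) = H' i (z i) *\<^sub>v x i - H' i (z i) *\<^sub>v z i"
      by (rule mult_minus_distrib_mat_vec[OF H' c])
    have Hx: "H' i (z i) *\<^sub>v x i \<in> carrier_vec (d i)" "H' i (z i) *\<^sub>v z i \<in> carrier_vec (d i)"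
      using H' c by auto
    have "obs_shift i - tan_H i *\<^sub>v x i =
        (y i - H i (z i) - H' i (z i) *\<^sub>v (x i - z i)) @\<^sub>v (z i - x i)"
      unfolding app[OF c(1)] app[OF c(2)] aug_obs_def diff
      using H' Hz Hx c y_carrier[OF i]
      by (intro eq_vecI) (auto simp: append_vec_def Let_def)
    \<comment> \<open>The lower block of the augmented residual is \<open>z i - x i\<close>, while
      the penalty is written with the opposite difference.\<close>
    moreover have "(vnorm (z i - x i))\<^sup>2 = (vnorm (x i - z i))\<^sup>2"
    proof -
      have "z i - x i = (-1) \<cdot>\<^sub>v (x i - z i)"
        using c by (intro eq_vecI) auto
      then show ?thesis
        by (simp add: vnorm_smult)
    qed
    moreover have "y i - H i (z i) - H' i (z i) *\<^sub>v (x i - z i) \<in> carrier_vec (d i)"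
      using Hz Hx y_carrier[OF i] unfolding diff by (intro minus_carrier_vec) auto
    ultimately show ?thesis
      using wnorm_sq_minv_aug_cov[OF R_spd[OF i] \<gamma>_pos _ minus_carrier_vec[OF c(2,1)]] by simp
  qed
  have "(\<Sum>i=1..k. wnorm_sq (minv (R i)) (y i - H i (z i) - H' i (z i) *\<^sub>v (x i - z i)))
      + (\<Sum>i=1..k. \<gamma> * (vnorm (x i - z i))\<^sup>2) =
      (\<Sum>i=1..k. wnorm_sq (minv (noise_cov i)) (obs_shift i - tan_H i *\<^sub>v x i))"
    unfolding sum.distrib[symmetric] by (rule sum.cong[OF refl obs])
  moreover have "(\<Sum>i=1..k. wnorm_sq (minv (Q i))
        (x i - M i (z (i - 1)) - M' i (z (i - 1)) *\<^sub>v (x (i - 1) - z (i - 1)) - \<mu> i)) =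
      (\<Sum>i=1..k. wnorm_sq (minv (Q i)) (x i - tan_M i *\<^sub>v x (i - 1) - model_shift i))"
    by (rule sum.cong[OF refl]) (simp only: model)
  ultimately show ?thesis
    unfolding lm_objective_def objective_def by simp
qed

text \<open>The definite description requires exactly one minimizer. The excess over the value at
  the critical point is the form at the difference; its nonnegativity gives minimality and its
  definiteness uniqueness.\<close>

lemma filtered_is_lm_minimizer:
  assumes filt: "filtered k x C" and l: "l \<le> k"
  shows "(THE x. is_arg_min (lm_objective k M M' H H' xb \<mu> y B Q R \<gamma> z)
    (\<lambda>x. x \<in> (\<Pi>\<^sub>E l\<in>{0..k}. carrier_vec m)) x) l = x l"
proof -
  let ?f = "lm_objective k M M' H H' xb \<mu> y B Q R \<gamma> z"
  let ?P = "\<lambda>x. x \<in> (\<Pi>\<^sub>E l\<in>{0..k}. carrier_vec m)"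
  \<comment> \<open>Candidates are extensional functions, so the irrelevant blocks beyond
    \<open>k\<close> must be \<open>undefined\<close> for uniqueness to hold.\<close>
  let ?x = "restrict x {0..k}"
  have bl: "blocks k u" if "?P u" for u
    using that unfolding blocks_def by auto
  have x: "blocks k x"
    using filt unfolding filtered_def by simp
  have Px: "?P ?x"
    using x unfolding blocks_def by auto
  have crit: "hessian k ?x w = rhs k w" if "blocks k w" for w
  proof -
    have "hessian k ?x w = hessian k x w"
      by (rule hessian_cong) simp
    then show ?thesis
      using filt that unfolding filtered_def by simp
  qed
  have obj: "?f u = ?f ?x + hessian k (\<lambda>l. u l - ?x l) (\<lambda>l. u l - ?x l)" if "?P u" for u
    using objective_critical_point[OF bl[OF Px] order_refl crit bl[OF that]]
      lm_objective_eq[OF bl[OF that]] lm_objective_eq[OF bl[OF Px]] by simp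
  have e: "blocks k (\<lambda>l. u l - ?x l)" if "?P u" for u
    using bl[OF that] bl[OF Px] unfolding blocks_def by auto
  have "(THE x. is_arg_min ?f ?P x) = ?x"
  proof (rule the_equality)
    show "is_arg_min ?f ?P ?x"
      unfolding is_arg_min_def
    proof (intro conjI notI)
      assume "\<exists>u. ?P u \<and> ?f u < ?f ?x"
      then obtain u where u: "?P u" "?f u < ?f ?x"
        by blast
      then show False
        using obj[OF u(1)] hessian_nonneg[OF e[OF u(1)] order_refl] by simp
    qed (rule Px)
    fix u assume "is_arg_min ?f ?P u"
    then have u: "?P u" "\<not> ?f ?x < ?f u"
      using Px unfolding is_arg_min_def by blast+
    then have "hessian k (\<lambda>l. u l - ?x l) (\<lambda>l. u l - ?x l) = 0"
      using obj[OF u(1)] hessian_nonneg[OF e[OF u(1)] order_refl] by linarith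
    then have zero: "u l - ?x l = 0\<^sub>v m" if "l \<le> k" for l
      by (rule hessian_eq_0D[OF e[OF u(1)] order_refl _ that])
    have "u l = ?x l" if "l \<in> {0..k}" for l
    proof (rule eq_vecI)
      have c: "u l \<in> carrier_vec m" "?x l \<in> carrier_vec m"
        using bl[OF u(1)] bl[OF Px] that unfolding blocks_def by auto
      then show "dim_vec (u l) = dim_vec (?x l)"
        by simp
      fix a assume a: "a < dim_vec (?x l)"
      then have "(u l - ?x l) $ a = 0"
        using zero[of l] that c by simp
      then show "u l $ a = ?x l $ a"
        using a c by simp
    qed
    then show "u = ?x"
      using u(1) Px by (intro PiE_ext) auto
  qed
  then show ?thesis
    using l by simp
qed

lemma large_sample_mean:
  assumes "l \<le> k"
  shows "vec_tendsto m (\<lambda>t. sample_mean m (N t) (\<lambda>n.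
      ensemble tangent_model tangent_obs (N t) (zt t) (X0 t) (V t) (W t) k n l))
    ((THE x. is_arg_min (lm_objective k M M' H H' xb \<mu> y B Q R \<gamma> z)
      (\<lambda>x. x \<in> (\<Pi>\<^sub>E l\<in>{0..k}. carrier_vec m)) x) l) F"
proof -
  obtain x C where "filtered k x C"
    and "tracks (\<lambda>t. ensemble tangent_model tangent_obs (N t) (zt t) (X0 t) (V t) (W t) k) k x C"
    using ensemble_tracks[OF order_refl] by blast
  then show ?thesis
    using tracksD(2)[OF _ assms] filtered_is_lm_minimizer[OF _ assms] by simp
qed

end


section \<open>Random vectors\<close>

lemma space_borel_vec [simp]: "space (borel_vec n) = carrier_vec n"
  by (simp add: borel_vec_def)

lemma measurable_borel_vec_component:
  assumes "a < n"
  shows "(\<lambda>v. v $ a) \<in> borel_measurable (borel_vec n)"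
proof -
  have "(\<lambda>v. \<lambda>a\<in>{..<n}. v $ a) \<in> borel_vec n \<rightarrow>\<^sub>M (\<Pi>\<^sub>M a\<in>{..<n}. (borel :: real measure))"
    unfolding borel_vec_def by (rule measurable_vimage_algebra1) (auto simp: space_PiM)
  from measurable_compose[OF this measurable_component_singleton[of a "{..<n}" "\<lambda>_. borel"]] assms
  show ?thesis
    by simp
qed

lemma measurable_borel_vecI:
  assumes "\<And>\<omega>. \<omega> \<in> space P \<Longrightarrow> X \<omega> \<in> carrier_vec n"
    and "\<And>a. a < n \<Longrightarrow> (\<lambda>\<omega>. X \<omega> $ a) \<in> borel_measurable P"
  shows "X \<in> P \<rightarrow>\<^sub>M borel_vec n"
  unfolding borel_vec_def
proof (rule measurable_vimage_algebra2)
  show "X \<in> space P \<rightarrow> carrier_vec n"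
    using assms(1) by auto
  show "(\<lambda>\<omega>. \<lambda>a\<in>{..<n}. X \<omega> $ a) \<in> P \<rightarrow>\<^sub>M (\<Pi>\<^sub>M a\<in>{..<n}. borel)"
    using assms(2) by (intro measurable_restrict) auto
qed

text \<open>Binomial expansion around the mean reduces raw moments to central ones.\<close>

lemma integrable_normal_density_power:
  assumes "0 < \<sigma>"
  shows "integrable lborel (\<lambda>x. normal_density \<mu> \<sigma> x * x ^ q)"
proof -
  have "x ^ q = (\<Sum>i\<le>q. of_nat (q choose i) * (x - \<mu>) ^ i * \<mu> ^ (q - i))" for x :: real
    using binomial_ring[of "x - \<mu>" \<mu> q] by simp
  then have "(\<lambda>x. normal_density \<mu> \<sigma> x * x ^ q) =
      (\<lambda>x. \<Sum>i\<le>q. of_nat (q choose i) * \<mu> ^ (q - i) * (normal_density \<mu> \<sigma> x * (x - \<mu>) ^ i))"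
    by (simp add: sum_distrib_left mult_ac)
  then show ?thesis
    using integrable_normal_moment[OF assms] by (auto intro!: Bochner_Integration.integrable_sum)
qed

context prob_space
begin

lemma normal_power:
  assumes "0 < \<sigma>" and D: "distributed M lborel X (normal_density \<mu> \<sigma>)"
  shows "integrable M (\<lambda>\<omega>. X \<omega> ^ q)"
    "expectation (\<lambda>\<omega>. X \<omega> ^ q) = (\<integral>x. normal_density \<mu> \<sigma> x * x ^ q \<partial>lborel)"
  using distributed_integrable[OF D, of "\<lambda>x. x ^ q"] distributed_integral[OF D, of "\<lambda>x. x ^ q"]
    integrable_normal_density_power[OF assms(1)] by auto

lemma normal_second_moment:
  assumes "0 < \<sigma>" and D: "distributed M lborel X (normal_density \<mu> \<sigma>)"
  shows "expectation (\<lambda>\<omega>. (X \<omega>)\<^sup>2) = \<sigma>\<^sup>2 + \<mu>\<^sup>2"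
  using variance_eq[of X] normal_power(1)[OF assms, of 1] normal_power(1)[OF assms, of 2]
    normal_distributed_variance[OF assms] normal_distributed_expectation[OF assms] by simp

lemma normal_vec_functional:
  assumes X: "normal_vec M n \<mu> \<Sigma> X" and \<Sigma>: "sym_pos_def n \<Sigma>"
    and u: "u \<in> carrier_vec n" "u \<noteq> 0\<^sub>v n"
  shows "distributed M lborel (\<lambda>\<omega>. u \<bullet> X \<omega>) (normal_density (u \<bullet> \<mu>) (sqrt (u \<bullet> (\<Sigma> *\<^sub>v u))))"
    "0 < sqrt (u \<bullet> (\<Sigma> *\<^sub>v u))"
  using X u sym_pos_defD(3)[OF \<Sigma> u] unfolding normal_vec_def by auto

lemma normal_vec_measurable:
  assumes "normal_vec M n \<mu> \<Sigma> X"
  shows "X \<in> M \<rightarrow>\<^sub>M borel_vec n" "\<omega> \<in> space M \<Longrightarrow> X \<omega> \<in> carrier_vec n"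
    "a < n \<Longrightarrow> (\<lambda>\<omega>. X \<omega> $ a) \<in> borel_measurable M"
proof -
  show X: "X \<in> M \<rightarrow>\<^sub>M borel_vec n"
    using assms unfolding normal_vec_def by simp
  show "\<omega> \<in> space M \<Longrightarrow> X \<omega> \<in> carrier_vec n"
    using measurable_space[OF X] by simp
  show "a < n \<Longrightarrow> (\<lambda>\<omega>. X \<omega> $ a) \<in> borel_measurable M"
    using measurable_compose[OF X measurable_borel_vec_component] .
qed

lemma normal_vec_component:
  assumes X: "normal_vec M n \<mu> \<Sigma> X" and \<Sigma>: "sym_pos_def n \<Sigma>" and \<mu>: "\<mu> \<in> carrier_vec n"
    and a: "a < n"
  shows "distributed M lborel (\<lambda>\<omega>. X \<omega> $ a) (normal_density (\<mu> $ a) (sqrt (\<Sigma> $$ (a, a))))"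
    "0 < \<Sigma> $$ (a, a)"
proof -
  have u: "unit_vec n a \<in> carrier_vec n" "unit_vec n a \<noteq> (0\<^sub>v n :: real vec)"
    using a unit_vec_nonzero[of a n] by auto
  have \<Sigma>c: "\<Sigma> \<in> carrier_mat n n"
    by (rule sym_pos_defD(1)[OF \<Sigma>])
  have q: "unit_vec n a \<bullet> (\<Sigma> *\<^sub>v unit_vec n a) = \<Sigma> $$ (a, a)"
    using \<Sigma>c a by (simp add: scalar_prod_left_unit[of _ n])
  have "distributed M lborel (\<lambda>\<omega>. unit_vec n a \<bullet> X \<omega>)
      (normal_density (\<mu> $ a) (sqrt (\<Sigma> $$ (a, a))))"
    using normal_vec_functional(1)[OF X \<Sigma> u] q \<mu> a by (simp add: scalar_prod_left_unit[of _ n])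
  \<comment> \<open>The two functions agree only on \<open>space M\<close>, where the dimension of
    \<open>X \<omega>\<close> is known, so the distribution is transported by congruence on that
    space.\<close>
  moreover have "unit_vec n a \<bullet> X \<omega> = X \<omega> $ a" if "\<omega> \<in> space M" for \<omega>
    using normal_vec_measurable(2)[OF X that] a by (simp add: scalar_prod_left_unit[of _ n])
  ultimately show "distributed M lborel (\<lambda>\<omega>. X \<omega> $ a) (normal_density (\<mu> $ a) (sqrt (\<Sigma> $$ (a, a))))"
    unfolding distributed_def using distr_cong[of M M lborel lborel "\<lambda>\<omega>. unit_vec n a \<bullet> X \<omega>" "\<lambda>\<omega>. X \<omega> $ a"]
    by (auto cong: measurable_cong)
  show "0 < \<Sigma> $$ (a, a)"
    using sym_pos_defD(3)[OF \<Sigma> u] q by simp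
qed

text \<open>The moments are given by integrals in the mean and one diagonal entry. For inputs with
  common parameters this provides bounds independent of the member number.\<close>

lemma normal_vec_component_moments:
  assumes X: "normal_vec M n \<mu> \<Sigma> X" and \<Sigma>: "sym_pos_def n \<Sigma>" and \<mu>: "\<mu> \<in> carrier_vec n"
    and a: "a < n"
  shows "integrable M (\<lambda>\<omega>. (X \<omega> $ a) ^ q)"
    "expectation (\<lambda>\<omega>. (X \<omega> $ a) ^ q) =
      (\<integral>x. normal_density (\<mu> $ a) (sqrt (\<Sigma> $$ (a, a))) x * x ^ q \<partial>lborel)"
    "expectation (\<lambda>\<omega>. X \<omega> $ a) = \<mu> $ a"
    "expectation (\<lambda>\<omega>. (X \<omega> $ a)\<^sup>2) = \<Sigma> $$ (a, a) + (\<mu> $ a)\<^sup>2"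
proof -
  note D = normal_vec_component(1)[OF assms] and pos = normal_vec_component(2)[OF assms]
  then have pos': "0 < sqrt (\<Sigma> $$ (a, a))"
    by simp
  show "integrable M (\<lambda>\<omega>. (X \<omega> $ a) ^ q)" "expectation (\<lambda>\<omega>. (X \<omega> $ a) ^ q) =
      (\<integral>x. normal_density (\<mu> $ a) (sqrt (\<Sigma> $$ (a, a))) x * x ^ q \<partial>lborel)"
    "expectation (\<lambda>\<omega>. X \<omega> $ a) = \<mu> $ a"
    "expectation (\<lambda>\<omega>. (X \<omega> $ a)\<^sup>2) = \<Sigma> $$ (a, a) + (\<mu> $ a)\<^sup>2"
    using normal_power[OF pos' D] normal_distributed_expectation[OF pos' D]
      normal_second_moment[OF pos' D] pos by simp_all
qed

lemma integrable_mult_if_square: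
  fixes f g :: "'a \<Rightarrow> real"
  assumes [measurable]: "f \<in> borel_measurable M" "g \<in> borel_measurable M"
    and "integrable M (\<lambda>\<omega>. (f \<omega>)\<^sup>2)" "integrable M (\<lambda>\<omega>. (g \<omega>)\<^sup>2)"
  shows "integrable M (\<lambda>\<omega>. f \<omega> * g \<omega>)"
proof (rule Bochner_Integration.integrable_bound)
  show "integrable M (\<lambda>\<omega>. (f \<omega>)\<^sup>2 + (g \<omega>)\<^sup>2)"
    using assms(3,4) by simp
  have "\<bar>x * y\<bar> \<le> x\<^sup>2 + y\<^sup>2" for x y :: real
  proof -
    have "2 * \<bar>x\<bar> * \<bar>y\<bar> \<le> x\<^sup>2 + y\<^sup>2"
      using sum_squares_bound[of "\<bar>x\<bar>" "\<bar>y\<bar>"] by simp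
    moreover have "0 \<le> \<bar>x\<bar> * \<bar>y\<bar>"
      by simp
    ultimately show ?thesis
      unfolding abs_mult by linarith
  qed
  then show "AE \<omega> in M. norm (f \<omega> * g \<omega>) \<le> norm ((f \<omega>)\<^sup>2 + (g \<omega>)\<^sup>2)"
    by simp
qed measurable

text \<open>\<open>normal_vec\<close> describes only laws of single linear functionals, so the mixed
  moment comes by polarization from the functional \<open>unit_vec n a + unit_vec n b\<close>, which
  is nonzero also for \<open>a = b\<close>.\<close>

lemma normal_vec_product_moment:
  assumes X: "normal_vec M n \<mu> \<Sigma> X" and \<Sigma>: "sym_pos_def n \<Sigma>" and \<mu>: "\<mu> \<in> carrier_vec n"
    and a: "a < n" and b: "b < n"
  shows "expectation (\<lambda>\<omega>. X \<omega> $ a * X \<omega> $ b) = \<Sigma> $$ (a, b) + \<mu> $ a * \<mu> $ b"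
proof -
  let ?u = "unit_vec n a + unit_vec n b :: real vec"
  have \<Sigma>c: "\<Sigma> \<in> carrier_mat n n"
    by (rule sym_pos_defD(1)[OF \<Sigma>])
  have u: "?u \<in> carrier_vec n" "?u \<noteq> 0\<^sub>v n"
  proof -
    have "?u $ a \<noteq> 0\<^sub>v n $ a"
      using a b by simp
    then show "?u \<noteq> 0\<^sub>v n"
      by metis
  qed simp
  have dot: "?u \<bullet> v = v $ a + v $ b" if "v \<in> carrier_vec n" for v
    using that a b add_scalar_prod_distrib[of "unit_vec n a" n "unit_vec n b" v]
    by (simp add: scalar_prod_left_unit[of _ n])
  have "\<Sigma> *\<^sub>v ?u = \<Sigma> *\<^sub>v unit_vec n a + \<Sigma> *\<^sub>v unit_vec n b"
    by (rule mult_add_distrib_mat_vec[OF \<Sigma>c]) auto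
  then have "?u \<bullet> (\<Sigma> *\<^sub>v ?u) = \<Sigma> $$ (a, a) + \<Sigma> $$ (a, b) + (\<Sigma> $$ (b, a) + \<Sigma> $$ (b, b))"
    using \<Sigma>c a b dot[of "\<Sigma> *\<^sub>v ?u"] by simp
  moreover have "\<Sigma> $$ (b, a) = \<Sigma> $$ (a, b)"
    using sym_pos_defD(2)[OF \<Sigma>] \<Sigma>c a b by (metis carrier_matD index_transpose_mat(1))
  ultimately have quad: "?u \<bullet> (\<Sigma> *\<^sub>v ?u) = \<Sigma> $$ (a, a) + 2 * \<Sigma> $$ (a, b) + \<Sigma> $$ (b, b)"
    by simp
  have "expectation (\<lambda>\<omega>. (?u \<bullet> X \<omega>)\<^sup>2) = ?u \<bullet> (\<Sigma> *\<^sub>v ?u) + (\<mu> $ a + \<mu> $ b)\<^sup>2"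
    using normal_second_moment[OF normal_vec_functional(2,1)[OF X \<Sigma> u]]
      normal_vec_functional(2)[OF X \<Sigma> u] dot[OF \<mu>] by simp
  also have "expectation (\<lambda>\<omega>. (?u \<bullet> X \<omega>)\<^sup>2) =
      expectation (\<lambda>\<omega>. (X \<omega> $ a)\<^sup>2 + 2 * (X \<omega> $ a * X \<omega> $ b) + (X \<omega> $ b)\<^sup>2)"
    by (rule Bochner_Integration.integral_cong)
      (auto simp: dot normal_vec_measurable(2)[OF X] power2_sum algebra_simps)
  also have "\<dots> = expectation (\<lambda>\<omega>. (X \<omega> $ a)\<^sup>2) + 2 * expectation (\<lambda>\<omega>. X \<omega> $ a * X \<omega> $ b)
      + expectation (\<lambda>\<omega>. (X \<omega> $ b)\<^sup>2)"
    using normal_vec_component_moments(1)[OF X \<Sigma> \<mu> a, of 2]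
      normal_vec_component_moments(1)[OF X \<Sigma> \<mu> b, of 2] normal_vec_measurable(3)[OF X]
      integrable_mult_if_square[of "\<lambda>\<omega>. X \<omega> $ a" "\<lambda>\<omega>. X \<omega> $ b"] a b
    by simp
  finally show ?thesis
    using normal_vec_component_moments(4)[OF X \<Sigma> \<mu> a] normal_vec_component_moments(4)[OF X \<Sigma> \<mu> b]
      quad by (simp add: power2_sum)
qed

text \<open>Chebyshev's inequality. The variables need not have one distribution, only a common
  mean, bounded second moments and no correlation; the explicit bound in \<open>N\<close> composes
  with any filter on sizes.\<close>

lemma weak_law_of_large_numbers:
  fixes Y :: "nat \<Rightarrow> 'a \<Rightarrow> real"
  assumes [measurable]: "\<And>n. n \<ge> 1 \<Longrightarrow> Y n \<in> borel_measurable M"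
    and sq: "\<And>n. n \<ge> 1 \<Longrightarrow> integrable M (\<lambda>\<omega>. (Y n \<omega>)\<^sup>2)"
    and mean: "\<And>n. n \<ge> 1 \<Longrightarrow> expectation (Y n) = L"
    and bound: "\<And>n. n \<ge> 1 \<Longrightarrow> expectation (\<lambda>\<omega>. (Y n \<omega>)\<^sup>2) \<le> c"
    and uncorr: "\<And>n n'. n \<ge> 1 \<Longrightarrow> n' \<ge> 1 \<Longrightarrow> n \<noteq> n' \<Longrightarrow> expectation (\<lambda>\<omega>. Y n \<omega> * Y n' \<omega>) = L\<^sup>2"
    and N: "N \<ge> 1" and "\<epsilon> > 0"
  shows "prob {\<omega> \<in> space M. \<bar>(\<Sum>n=1..N. Y n \<omega>) / real N - L\<bar> \<ge> \<epsilon>} \<le> c / \<epsilon>\<^sup>2 / real N"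
proof -
  let ?S = "\<lambda>\<omega>. (\<Sum>n=1..N. Y n \<omega>)"
  have S_meas [measurable]: "?S \<in> borel_measurable M"
    by (intro borel_measurable_sum) auto
  have int: "integrable M (\<lambda>\<omega>. Y n \<omega> * Y n' \<omega>)" if "n \<ge> 1" "n' \<ge> 1" for n n'
    using that by (intro integrable_mult_if_square sq) auto
  have int1: "integrable M (Y n)" if "n \<ge> 1" for n
    using square_integrable_imp_integrable[OF assms(1) sq] that by blast
  have S2: "(?S \<omega>)\<^sup>2 = (\<Sum>n=1..N. \<Sum>n'=1..N. Y n \<omega> * Y n' \<omega>)" for \<omega>
    by (simp add: power2_eq_square sum_product)
  have int2: "integrable M (\<lambda>\<omega>. (?S \<omega>)\<^sup>2)"
    unfolding S2 by (intro Bochner_Integration.integrable_sum int) auto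
  have "expectation (\<lambda>\<omega>. (?S \<omega>)\<^sup>2) = (\<Sum>n=1..N. \<Sum>n'=1..N. expectation (\<lambda>\<omega>. Y n \<omega> * Y n' \<omega>))"
    unfolding S2 by (subst Bochner_Integration.integral_sum; (intro sum.cong refl
        Bochner_Integration.integral_sum Bochner_Integration.integrable_sum int)?) auto
  \<comment> \<open>Diagonal terms are second moments, off-diagonal ones equal the squared
    mean.\<close>
  also have "\<dots> \<le> (\<Sum>n=1..N. \<Sum>n'=1..N. if n' = n then c else L\<^sup>2)"
    using bound uncorr by (intro sum_mono) (auto simp: power2_eq_square)
  also have "\<dots> = (\<Sum>n=1..N. c + (real N - 1) * L\<^sup>2)"
  proof (rule sum.cong[OF refl])
    fix n assume "n \<in> {1..N}"
    then have "(\<Sum>n'=1..N. if n' = n then c else L\<^sup>2) = c + (\<Sum>n'\<in>{1..N} - {n}. L\<^sup>2)"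
      by (subst sum.remove[of _ n]) auto
    then show "(\<Sum>n'=1..N. if n' = n then c else L\<^sup>2) = c + (real N - 1) * L\<^sup>2"
      using \<open>n \<in> {1..N}\<close> by (simp add: of_nat_diff)
  qed
  finally have ES2: "expectation (\<lambda>\<omega>. (?S \<omega>)\<^sup>2) \<le> real N * (c + (real N - 1) * L\<^sup>2)"
    by simp
  let ?f = "\<lambda>\<omega>. ?S \<omega> / real N"
  have Ef: "expectation ?f = L"
    using int1 mean N by (simp add: Bochner_Integration.integral_sum)
  have intf: "integrable M ?f" "integrable M (\<lambda>\<omega>. (?f \<omega>)\<^sup>2)"
    using int1 int2
    by (auto simp: power_divide intro!: Bochner_Integration.integrable_divide
        Bochner_Integration.integrable_sum)
  have "variance ?f = expectation (\<lambda>\<omega>. (?f \<omega>)\<^sup>2) - L\<^sup>2"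
    using variance_eq[OF intf] Ef by simp
  also have "\<dots> = expectation (\<lambda>\<omega>. (?S \<omega>)\<^sup>2) / (real N)\<^sup>2 - L\<^sup>2"
    by (simp add: power_divide)
  also have "\<dots> \<le> real N * (c + (real N - 1) * L\<^sup>2) / (real N)\<^sup>2 - L\<^sup>2"
    using ES2 by (simp add: divide_right_mono)
  also have "\<dots> = c / real N - L\<^sup>2 / real N"
    using N by (simp add: field_simps power2_eq_square)
  also have "\<dots> \<le> c / real N"
    by simp
  finally have var: "variance ?f \<le> c / real N" .
  have "prob {\<omega> \<in> space M. \<bar>?f \<omega> - L\<bar> \<ge> \<epsilon>} \<le> variance ?f / \<epsilon>\<^sup>2"
    using Chebyshev_inequality[of ?f \<epsilon>] intf(2) Ef \<open>\<epsilon> > 0\<close> by simp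
  also have "\<dots> \<le> c / real N / \<epsilon>\<^sup>2"
    by (rule divide_right_mono[OF var]) simp
  finally show ?thesis
    by (simp add: field_simps)
qed

end

section \<open>The filter of convergence in probability\<close>

text \<open>A property holds eventually if the outer probability of its failure tends to \<open>0\<close>, so convergence
  in probability is convergence along this filter and is inherited by pathwise limit theorems.\<close>

definition prob_filter :: "'w measure \<Rightarrow> 'n filter \<Rightarrow> ('n \<times> 'w) filter" where
  "prob_filter P G = Abs_filter (\<lambda>Q. \<exists>A. (\<forall>N. A N \<in> sets P) \<and>
     (\<forall>\<^sub>F N in G. {\<omega> \<in> space P. \<not> Q (N, \<omega>)} \<subseteq> A N) \<and> ((\<lambda>N. measure P (A N)) \<longlongrightarrow> 0) G)"

text \<open>The filter laws reduce to subadditivity: the conjunction of two properties fails inside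
  the union of their exceptional sets. The measurable majorants \<open>A N\<close> allow arbitrary
  properties, measurable or not.\<close>

lemma eventually_prob_filter:
  "eventually Q (prob_filter P G) \<longleftrightarrow> (\<exists>A. (\<forall>N. A N \<in> sets P) \<and>
     (\<forall>\<^sub>F N in G. {\<omega> \<in> space P. \<not> Q (N, \<omega>)} \<subseteq> A N) \<and> ((\<lambda>N. measure P (A N)) \<longlongrightarrow> 0) G)"
  unfolding prob_filter_def
proof (rule eventually_Abs_filter, unfold_locales, goal_cases)
  case 1
  show ?case
    by (intro exI[of _ "\<lambda>_. {}"]) auto
next
  case (2 Q R)
  then obtain A B where A: "\<And>N. A N \<in> sets P" "\<forall>\<^sub>F N in G. {\<omega> \<in> space P. \<not> Q (N, \<omega>)} \<subseteq> A N"
      "((\<lambda>N. measure P (A N)) \<longlongrightarrow> 0) G"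
    and B: "\<And>N. B N \<in> sets P" "\<forall>\<^sub>F N in G. {\<omega> \<in> space P. \<not> R (N, \<omega>)} \<subseteq> B N"
      "((\<lambda>N. measure P (B N)) \<longlongrightarrow> 0) G"
    by auto
  show ?case
  proof (intro exI[of _ "\<lambda>N. A N \<union> B N"] conjI allI)
    show "\<forall>\<^sub>F N in G. {\<omega> \<in> space P. \<not> (Q (N, \<omega>) \<and> R (N, \<omega>))} \<subseteq> A N \<union> B N"
      using A(2) B(2) by eventually_elim auto
    have "((\<lambda>N. measure P (A N) + measure P (B N)) \<longlongrightarrow> 0) G"
      using tendsto_add[OF A(3) B(3)] by simp
    then show "((\<lambda>N. measure P (A N \<union> B N)) \<longlongrightarrow> 0) G"
      by (rule tendsto_sandwich[OF _ _ tendsto_const, rotated 2])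
        (auto intro!: always_eventually measure_Un_le A(1) B(1))
  qed (use A(1) B(1) in auto)
next
  case (3 Q R)
  then obtain A where A: "\<And>N. A N \<in> sets P" "\<forall>\<^sub>F N in G. {\<omega> \<in> space P. \<not> Q (N, \<omega>)} \<subseteq> A N"
      "((\<lambda>N. measure P (A N)) \<longlongrightarrow> 0) G"
    by auto
  have "\<forall>\<^sub>F N in G. {\<omega> \<in> space P. \<not> R (N, \<omega>)} \<subseteq> A N"
    using A(2) by (rule eventually_mono) (use 3(1) in auto)
  with A show ?case
    by blast
qed

lemma eventually_prob_filter_fst:
  assumes "\<forall>\<^sub>F N in G. Q N"
  shows "\<forall>\<^sub>F t in prob_filter P G. Q (fst t)"
  unfolding eventually_prob_filter
  using assms by (intro exI[of _ "\<lambda>_. {}"]) (auto elim: eventually_mono)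

lemma eventually_prob_filter_space: "\<forall>\<^sub>F t in prob_filter P G. snd t \<in> space P"
  unfolding eventually_prob_filter by (intro exI[of _ "\<lambda>_. {}"]) auto

lemma filterlim_fst_prob_filter: "filterlim fst G (prob_filter P G)"
  unfolding filterlim_iff using eventually_prob_filter_fst by auto

lemma tendsto_prob_filterI:
  fixes f :: "'n \<Rightarrow> 'w \<Rightarrow> real"
  assumes "\<And>N. f N \<in> borel_measurable P"
    and "\<And>\<epsilon>. \<epsilon> > 0 \<Longrightarrow> ((\<lambda>N. measure P {\<omega> \<in> space P. \<bar>f N \<omega> - c\<bar> \<ge> \<epsilon>}) \<longlongrightarrow> 0) G"
  shows "((\<lambda>t. f (fst t) (snd t)) \<longlongrightarrow> c) (prob_filter P G)"
proof (rule tendstoI)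
  fix \<epsilon> :: real assume "\<epsilon> > 0"
  then show "\<forall>\<^sub>F t in prob_filter P G. dist (f (fst t) (snd t)) c < \<epsilon>"
    unfolding eventually_prob_filter
    using assms by (intro exI[of _ "\<lambda>N. {\<omega> \<in> space P. \<bar>f N \<omega> - c\<bar> \<ge> \<epsilon>}"])
      (auto simp: dist_real_def not_less intro!: always_eventually)
qed

lemma tendsto_prob_filterD:
  fixes f :: "'n \<Rightarrow> 'w \<Rightarrow> real"
  assumes "prob_space P" and "((\<lambda>t. f (fst t) (snd t)) \<longlongrightarrow> 0) (prob_filter P G)" and "\<epsilon> > 0"
  shows "((\<lambda>N. measure P {\<omega> \<in> space P. f N \<omega> > \<epsilon>}) \<longlongrightarrow> 0) G"
proof -
  interpret prob_space P by fact
  have "\<forall>\<^sub>F t in prob_filter P G. f (fst t) (snd t) < \<epsilon>"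
    by (rule order_tendstoD(2)[OF assms(2,3)])
  then obtain A where A: "\<And>N. A N \<in> sets P"
      "\<forall>\<^sub>F N in G. {\<omega> \<in> space P. \<not> f N \<omega> < \<epsilon>} \<subseteq> A N" "((\<lambda>N. measure P (A N)) \<longlongrightarrow> 0) G"
    unfolding eventually_prob_filter by auto
  \<comment> \<open>Monotonicity of the measure uses measurability of the larger set
    \<open>A N\<close>, which the filter provides.\<close>
  have "\<forall>\<^sub>F N in G. measure P {\<omega> \<in> space P. f N \<omega> > \<epsilon>} \<le> measure P (A N)"
    using A(2) by eventually_elim (rule finite_measure_mono[OF _ A(1)], auto)
  then show ?thesis
    by (rule tendsto_sandwich[OF _ _ tendsto_const A(3), rotated]) auto
qed


section \<open>Linearized iterates for large ensembles\<close>

text \<open>The mean of products minus the product of means, with the factor from dividing by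
  \<open>N - 1\<close>, which tends to 1. All terms are averages of the kind a law of large numbers
  controls.\<close>

lemma sample_cov_index:
  assumes "N \<ge> 2" "a < r" "b < c"
  shows "sample_cov r c N X Y $$ (a, b) = real N / (real N - 1) *
    ((\<Sum>n=1..N. X n $ a * Y n $ b) / real N
     - (\<Sum>n=1..N. X n $ a) / real N * ((\<Sum>n=1..N. Y n $ b) / real N))"
proof -
  define x where "x = (\<Sum>n=1..N. X n $ a) / real N"
  define w where "w = (\<Sum>n=1..N. Y n $ b) / real N"
  have N: "real N > 0" "real N - 1 > 0"
    using assms(1) by auto
  have "sample_cov r c N X Y $$ (a, b) = (\<Sum>n=1..N. (X n $ a - x) * (Y n $ b - w)) / (real N - 1)"
    using assms by (simp add: sample_cov_def sample_outer_def sample_mean_def x_def w_def)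
  also have "(\<Sum>n=1..N. (X n $ a - x) * (Y n $ b - w)) =
      (\<Sum>n=1..N. X n $ a * Y n $ b) - w * (\<Sum>n=1..N. X n $ a) - x * (\<Sum>n=1..N. Y n $ b)
      + real N * (x * w)"
    by (simp add: algebra_simps sum.distrib sum_subtractf sum_distrib_left)
  also have "(\<Sum>n=1..N. X n $ a) = real N * x"
    using N by (simp add: x_def)
  also have "(\<Sum>n=1..N. Y n $ b) = real N * w"
    using N by (simp add: w_def)
  finally have "sample_cov r c N X Y $$ (a, b) =
      ((\<Sum>n=1..N. X n $ a * Y n $ b) - real N * (x * w)) / (real N - 1)"
    by (simp add: algebra_simps)
  also have "\<dots> = real N / (real N - 1) * ((\<Sum>n=1..N. X n $ a * Y n $ b) / real N - x * w)"
    using N by (simp add: field_simps)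
  finally show ?thesis
    unfolding x_def w_def .
qed

lemma mat_tendsto_sample_covI:
  assumes N: "filterlim N at_top F" and C: "C \<in> carrier_mat r c"
    and X: "\<And>a. a < r \<Longrightarrow> ((\<lambda>t. (\<Sum>n=1..N t. X t n $ a) / real (N t)) \<longlongrightarrow> x a) F"
    and Y: "\<And>b. b < c \<Longrightarrow> ((\<lambda>t. (\<Sum>n=1..N t. Y t n $ b) / real (N t)) \<longlongrightarrow> w b) F"
    and XY: "\<And>a b. a < r \<Longrightarrow> b < c \<Longrightarrow>
      ((\<lambda>t. (\<Sum>n=1..N t. X t n $ a * Y t n $ b) / real (N t)) \<longlongrightarrow> x a * w b + C $$ (a, b)) F"
  shows "mat_tendsto r c (\<lambda>t. sample_cov r c (N t) (X t) (Y t)) C F"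
proof (rule mat_tendstoI[OF C])
  have "\<forall>\<^sub>F t in F. N t \<ge> 2"
    using N by (simp add: filterlim_at_top)
  then show "\<forall>\<^sub>F t in F. sample_cov r c (N t) (X t) (Y t) \<in> carrier_mat r c \<and>
      (\<forall>a<r. \<forall>b<c. sample_cov r c (N t) (X t) (Y t) $$ (a, b) = real (N t) / (real (N t) - 1) *
        ((\<Sum>n=1..N t. X t n $ a * Y t n $ b) / real (N t)
         - (\<Sum>n=1..N t. X t n $ a) / real (N t) * ((\<Sum>n=1..N t. Y t n $ b) / real (N t))))"
    by (rule eventually_mono) (use sample_cov_index in auto)
  fix a b assume ab: "a < r" "b < c"
  have "((\<lambda>q. real q / (real q - 1)) \<longlongrightarrow> 1) at_top"
    by real_asymp
  then have ratio: "((\<lambda>t. real (N t) / (real (N t) - 1)) \<longlongrightarrow> 1) F"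
    by (rule filterlim_compose[OF _ N])
  show "((\<lambda>t. real (N t) / (real (N t) - 1) * ((\<Sum>n=1..N t. X t n $ a * Y t n $ b) / real (N t)
         - (\<Sum>n=1..N t. X t n $ a) / real (N t) * ((\<Sum>n=1..N t. Y t n $ b) / real (N t))))
      \<longlongrightarrow> C $$ (a, b)) F"
    using tendsto_mult[OF ratio tendsto_diff[OF XY[OF ab] tendsto_mult[OF X[OF ab(1)] Y[OF ab(2)]]]]
    by simp
qed

primrec (in assimilation) input_mean :: "input_index \<Rightarrow> real vec" where
  "input_mean (Init j n) = xb"
| "input_mean (Model j i n) = 0\<^sub>v m"
| "input_mean (Obs j i n) = 0\<^sub>v (d i + m)"

primrec (in assimilation) input_cov :: "input_index \<Rightarrow> real mat" where
  "input_cov (Init j n) = B"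
| "input_cov (Model j i n) = Q i"
| "input_cov (Obs j i n) = aug_cov (d i) m \<gamma> (R i)"

text \<open>An ensemble is represented by the function from the member number to the input index.\<close>

definition (in assimilation) input_ensembles :: "nat \<Rightarrow> (nat \<Rightarrow> input_index) set" where
  "input_ensembles j = {Init j} \<union> Model j ` {1..k} \<union> Obs j ` {1..k}"

context assimilation
begin

lemma input_ensembles_dim:
  assumes "\<phi> \<in> input_ensembles j"
  shows "input_dim m d (\<phi> n) = input_dim m d (\<phi> 1)" "input_mean (\<phi> n) = input_mean (\<phi> 1)"
    "input_cov (\<phi> n) = input_cov (\<phi> 1)" "j \<ge> 1 \<Longrightarrow> n \<ge> 1 \<Longrightarrow> \<phi> n \<in> input_indices k"
  using assms unfolding input_ensembles_def input_indices_def by auto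

lemma input_carriers:
  assumes "\<iota> \<in> input_indices k"
  shows "input_mean \<iota> \<in> carrier_vec (input_dim m d \<iota>)" "sym_pos_def (input_dim m d \<iota>) (input_cov \<iota>)"
    "input_cov \<iota> \<in> carrier_mat (input_dim m d \<iota>) (input_dim m d \<iota>)"
  using assms xb_carrier B_spd Q_spd aug_cov_spd sym_pos_defD(1)
  unfolding input_indices_def by auto

text \<open>Induction over outer iterations, with the convergence of the previous iterate supplying
  the linearization points. The three kinds of inputs and all their pairs are handled uniformly by
  ensembles \<phi> and \<psi>; equality of these functions separates a covariance from a
  cross-covariance.\<close>

lemma iterate_large_sample:
  fixes F :: "'t filter" and N :: "'t \<Rightarrow> nat \<Rightarrow> nat" and \<xi> :: "'t \<Rightarrow> input_index \<Rightarrow> real vec"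
  assumes N: "\<And>j'. j' \<in> {1..j} \<Longrightarrow> filterlim (\<lambda>t. N t j') at_top F"
    and carrier: "\<forall>\<^sub>F t in F. \<forall>\<iota>\<in>input_indices k. \<xi> t \<iota> \<in> carrier_vec (input_dim m d \<iota>)"
    and mean: "\<And>j' \<phi> a. j' \<in> {1..j} \<Longrightarrow> \<phi> \<in> input_ensembles j' \<Longrightarrow> a < input_dim m d (\<phi> 1) \<Longrightarrow>
      ((\<lambda>t. (\<Sum>n=1..N t j'. \<xi> t (\<phi> n) $ a) / real (N t j')) \<longlongrightarrow> input_mean (\<phi> 1) $ a) F"
    and prod: "\<And>j' \<phi> \<psi> a b. j' \<in> {1..j} \<Longrightarrow> \<phi> \<in> input_ensembles j' \<Longrightarrow> \<psi> \<in> input_ensembles j' \<Longrightarrow>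
      a < input_dim m d (\<phi> 1) \<Longrightarrow> b < input_dim m d (\<psi> 1) \<Longrightarrow>
      ((\<lambda>t. (\<Sum>n=1..N t j'. \<xi> t (\<phi> n) $ a * \<xi> t (\<psi> n) $ b) / real (N t j')) \<longlongrightarrow>
        input_mean (\<phi> 1) $ a * input_mean (\<psi> 1) $ b
        + (if \<phi> = \<psi> then input_cov (\<phi> 1) $$ (a, b) else 0)) F"
    and "l \<le> k"
  shows "vec_tendsto m (\<lambda>t. iterate tangent_model tangent_obs (\<lambda>j n. \<xi> t (Init j n))
      (\<lambda>j i n. \<xi> t (Model j i n)) (\<lambda>j i n. \<xi> t (Obs j i n)) (N t) j l)
    (lm_iterate k m M M' H H' xb \<mu> y B Q R \<gamma> x0 j l) F"
  using assms
proof (induction j arbitrary: l)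
  case 0
  then show ?case
    using x0_carrier by (simp add: vec_tendsto_const)
next
  case (Suc j)
  let ?j = "Suc j"
  let ?it = "\<lambda>t. iterate tangent_model tangent_obs (\<lambda>j n. \<xi> t (Init j n))
      (\<lambda>j i n. \<xi> t (Model j i n)) (\<lambda>j i n. \<xi> t (Obs j i n)) (N t)"
  have j: "?j \<in> {1..?j}"
    by simp
  note N = Suc.prems(1)[OF j] and carrier = Suc.prems(2) and mean = Suc.prems(3)[OF j]
    and prod = Suc.prems(4)[OF j]
  have IH: "vec_tendsto m (\<lambda>t. ?it t j l) (lm_iterate k m M M' H H' xb \<mu> y B Q R \<gamma> x0 j l) F"
    if "l \<le> k" for l
    using that by (intro Suc.IH Suc.prems) auto
  have mean': "vec_tendsto (input_dim m d (\<phi> 1))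
      (\<lambda>t. sample_mean (input_dim m d (\<phi> 1)) (N t ?j) (\<lambda>n. \<xi> t (\<phi> n))) (input_mean (\<phi> 1)) F"
    if \<phi>: "\<phi> \<in> input_ensembles ?j" for \<phi>
    by (rule vec_tendstoI[where f = "\<lambda>t a. (\<Sum>n=1..N t ?j. \<xi> t (\<phi> n) $ a) / real (N t ?j)"])
      (use mean[OF \<phi>] input_carriers(1)[OF input_ensembles_dim(4)[OF \<phi>]] in
        \<open>auto simp: sample_mean_def\<close>)
  have cov: "mat_tendsto (input_dim m d (\<phi> 1)) (input_dim m d (\<psi> 1))
      (\<lambda>t. sample_cov (input_dim m d (\<phi> 1)) (input_dim m d (\<psi> 1)) (N t ?j)
        (\<lambda>n. \<xi> t (\<phi> n)) (\<lambda>n. \<xi> t (\<psi> n)))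
      (if \<phi> = \<psi> then input_cov (\<phi> 1) else 0\<^sub>m (input_dim m d (\<phi> 1)) (input_dim m d (\<psi> 1))) F"
    if \<phi>: "\<phi> \<in> input_ensembles ?j" and \<psi>: "\<psi> \<in> input_ensembles ?j" for \<phi> \<psi>
  proof (rule mat_tendsto_sample_covI[OF N _ mean[OF \<phi>] mean[OF \<psi>]])
    show "(if \<phi> = \<psi> then input_cov (\<phi> 1) else 0\<^sub>m (input_dim m d (\<phi> 1)) (input_dim m d (\<psi> 1)))
        \<in> carrier_mat (input_dim m d (\<phi> 1)) (input_dim m d (\<psi> 1))"
      using input_carriers(3)[OF input_ensembles_dim(4)[OF \<phi>]] by auto
    fix a b assume "a < input_dim m d (\<phi> 1)" "b < input_dim m d (\<psi> 1)"
    then show "((\<lambda>t. (\<Sum>n=1..N t ?j. \<xi> t (\<phi> n) $ a * \<xi> t (\<psi> n) $ b) / real (N t ?j)) \<longlongrightarrow>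
        input_mean (\<phi> 1) $ a * input_mean (\<psi> 1) $ b + (if \<phi> = \<psi> then input_cov (\<phi> 1)
          else 0\<^sub>m (input_dim m d (\<phi> 1)) (input_dim m d (\<psi> 1))) $$ (a, b)) F"
      using prod[OF \<phi> \<psi>] by (cases "\<phi> = \<psi>") auto
  qed
  have carrier': "\<forall>\<^sub>F t in F. \<forall>n\<in>{1..N t ?j}. \<xi> t (\<phi> n) \<in> carrier_vec (input_dim m d (\<phi> 1))"
    if \<phi>: "\<phi> \<in> input_ensembles ?j" for \<phi>
    using carrier
  proof eventually_elim
    case (elim t)
    show ?case
    proof
      fix n assume "n \<in> {1..N t ?j}"
      then show "\<xi> t (\<phi> n) \<in> carrier_vec (input_dim m d (\<phi> 1))"
        using elim input_ensembles_dim(1)[OF \<phi>, of n] input_ensembles_dim(4)[OF \<phi>, of n] by auto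
    qed
  qed
  have mem: "Init ?j \<in> input_ensembles ?j" "\<And>i. i \<in> {1..k} \<Longrightarrow> Model ?j i \<in> input_ensembles ?j"
    "\<And>i. i \<in> {1..k} \<Longrightarrow> Obs ?j i \<in> input_ensembles ?j"
    unfolding input_ensembles_def by auto
  have ne: "Init ?j \<noteq> Model ?j i" "Init ?j \<noteq> Obs ?j i" "Model ?j i \<noteq> Obs ?j i'"
    "i \<noteq> i' \<Longrightarrow> Model ?j i \<noteq> Model ?j i'" "i \<noteq> i' \<Longrightarrow> Obs ?j i \<noteq> Obs ?j i'" for i i'
    by (auto dest: fun_cong[of _ _ 0])
  have N2: "\<forall>\<^sub>F t in F. N t ?j \<ge> 2"
    using N by (simp add: filterlim_at_top)
  \<comment> \<open>The limiting linearization point is the previous Levenberg-Marquardt iterate, so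
    the minimizer obtained for it is the next one.\<close>
  interpret large_sample k m d M H M' H' xb \<mu> y B Q R \<gamma> x0 F "\<lambda>t. N t ?j" "\<lambda>t. ?it t j"
    "lm_iterate k m M M' H H' xb \<mu> y B Q R \<gamma> x0 j" "\<lambda>t n. \<xi> t (Init ?j n)"
    "\<lambda>t i n. \<xi> t (Model ?j i n)" "\<lambda>t i n. \<xi> t (Obs ?j i n)"
  proof unfold_locales
    show "\<forall>\<^sub>F t in F. 2 \<le> N t ?j"
      by (rule N2)
    show "vec_tendsto m (\<lambda>t. ?it t j l) (lm_iterate k m M M' H H' xb \<mu> y B Q R \<gamma> x0 j l) F"
      if "l \<le> k" for l
      by (rule IH[OF that])
    fix i i' assume i: "i \<in> {1..k}" "i' \<in> {1..k}" "i \<noteq> i'"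
    show "mat_tendsto m m (\<lambda>t. sample_cov m m (N t ?j)
        (\<lambda>n. \<xi> t (Model ?j i n)) (\<lambda>n. \<xi> t (Model ?j i' n))) (0\<^sub>m m m) F"
      using cov[OF mem(2)[OF i(1)] mem(2)[OF i(2)]] ne(4)[OF i(3)] by simp
    show "mat_tendsto (d i + m) (d i' + m) (\<lambda>t. sample_cov (d i + m) (d i' + m) (N t ?j)
        (\<lambda>n. \<xi> t (Obs ?j i n)) (\<lambda>n. \<xi> t (Obs ?j i' n))) (0\<^sub>m (d i + m) (d i' + m)) F"
      using cov[OF mem(3)[OF i(1)] mem(3)[OF i(2)]] ne(5)[OF i(3)] by simp
  next
    fix i i' assume i: "i \<in> {1..k}" "i' \<in> {1..k}"
    show "mat_tendsto m (d i' + m) (\<lambda>t. sample_cov m (d i' + m) (N t ?j)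
        (\<lambda>n. \<xi> t (Model ?j i n)) (\<lambda>n. \<xi> t (Obs ?j i' n))) (0\<^sub>m m (d i' + m)) F"
      using cov[OF mem(2)[OF i(1)] mem(3)[OF i(2)]] ne(3) by simp
  next
    fix i assume i: "i \<in> {1..k}"
    note simps = cov[OF mem(2)[OF i] mem(2)[OF i]] cov[OF mem(3)[OF i] mem(3)[OF i]]
      cov[OF mem(1) mem(2)[OF i]] cov[OF mem(1) mem(3)[OF i]]
    show "mat_tendsto m m (\<lambda>t. sample_cov m m (N t ?j)
        (\<lambda>n. \<xi> t (Model ?j i n)) (\<lambda>n. \<xi> t (Model ?j i n))) (Q i) F"
      "mat_tendsto (d i + m) (d i + m) (\<lambda>t. sample_cov (d i + m) (d i + m) (N t ?j)
        (\<lambda>n. \<xi> t (Obs ?j i n)) (\<lambda>n. \<xi> t (Obs ?j i n))) (aug_cov (d i) m \<gamma> (R i)) F"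
      "mat_tendsto m m (\<lambda>t. sample_cov m m (N t ?j)
        (\<lambda>n. \<xi> t (Init ?j n)) (\<lambda>n. \<xi> t (Model ?j i n))) (0\<^sub>m m m) F"
      "mat_tendsto m (d i + m) (\<lambda>t. sample_cov m (d i + m) (N t ?j)
        (\<lambda>n. \<xi> t (Init ?j n)) (\<lambda>n. \<xi> t (Obs ?j i n))) (0\<^sub>m m (d i + m)) F"
      using simps ne(1,2) by simp_all
  qed (use mean'[OF mem(1)] mean'[OF mem(2)] mean'[OF mem(3)] carrier'[OF mem(1)]
      carrier'[OF mem(2)] carrier'[OF mem(3)] cov[OF mem(1) mem(1)] in \<open>simp_all\<close>)
  show ?case
    using large_sample_mean[OF \<open>l \<le> k\<close>] by simp
qed

end

section \<open>Laws of large numbers for the inputs\<close>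

locale random_inputs = assimilation k m d M H M' H' xb \<mu> y B Q R \<gamma> x0 + prob_space P
  for k m d M H M' H' xb \<mu> y B Q R \<gamma> x0 and P :: "'w measure" +
  fixes \<xi> :: "input_index \<Rightarrow> 'w \<Rightarrow> real vec"
  assumes normal: "\<And>\<iota>. \<iota> \<in> input_indices k \<Longrightarrow>
      normal_vec P (input_dim m d \<iota>) (input_mean \<iota>) (input_cov \<iota>) (\<xi> \<iota>)"
    and indep: "indep_vars (\<lambda>\<iota>. borel_vec (input_dim m d \<iota>)) \<xi> (input_indices k)"
begin

text \<open>A product of two inputs of one member depends on two indices. Functions of disjoint
  groups of independent inputs are independent, hence uncorrelated, whatever the dependence inside a
  group.\<close>

lemma grouped_weak_law:
  fixes Y :: "nat \<Rightarrow> 'w \<Rightarrow> real"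
  assumes K: "\<And>n. n \<ge> 1 \<Longrightarrow> K n \<subseteq> input_indices k" "disjoint_family_on K {1..}"
    and G: "\<And>n. n \<ge> 1 \<Longrightarrow>
      G n \<in> borel_measurable (\<Pi>\<^sub>M \<iota>\<in>K n. borel_vec (input_dim m d \<iota>))"
    and Y: "\<And>n. Y n = (\<lambda>\<omega>. G n (\<lambda>\<iota>\<in>K n. \<xi> \<iota> \<omega>))"
    and sq: "\<And>n. n \<ge> 1 \<Longrightarrow> integrable P (\<lambda>\<omega>. (Y n \<omega>)\<^sup>2)"
    and mean: "\<And>n. n \<ge> 1 \<Longrightarrow> expectation (Y n) = L"
    and bound: "\<And>n. n \<ge> 1 \<Longrightarrow> expectation (\<lambda>\<omega>. (Y n \<omega>)\<^sup>2) \<le> c"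
    and N: "filterlim N at_top S"
  shows "((\<lambda>t. (\<Sum>n=1..N (fst t). Y n (snd t)) / real (N (fst t))) \<longlongrightarrow> L) (prob_filter P S)"
proof -
  have indep_Y: "indep_vars (\<lambda>_. borel) Y {1..}"
    unfolding Y
    by (rule indep_vars_compose2[OF indep_vars_restrict[OF indep K(1) K(2)]]) (auto intro: G)
  have meas: "Y n \<in> borel_measurable P" if "n \<ge> 1" for n
    using indep_Y that unfolding indep_vars_def by auto
  have int: "integrable P (Y n)" if "n \<ge> 1" for n
    using square_integrable_imp_integrable[OF meas sq] that by blast
  have uncorr: "expectation (\<lambda>\<omega>. Y n \<omega> * Y n' \<omega>) = L\<^sup>2" if "n \<ge> 1" "n' \<ge> 1" "n \<noteq> n'" for n n'
  proof -
    have "integrable P (Y i)" if "i \<in> {n, n'}" for i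
      using that \<open>n \<ge> 1\<close> \<open>n' \<ge> 1\<close> int by auto
    moreover have "indep_vars (\<lambda>_. borel) Y {n, n'}"
      using that by (intro indep_vars_subset[OF indep_Y]) auto
    ultimately have "expectation (\<lambda>\<omega>. \<Prod>i\<in>{n, n'}. Y i \<omega>) = (\<Prod>i\<in>{n, n'}. expectation (Y i))"
      by (intro indep_vars_lebesgue_integral) auto
    then show ?thesis
      using that mean by (simp add: power2_eq_square)
  qed
  show ?thesis
  proof (rule tendsto_prob_filterI)
    show "(\<lambda>\<omega>. (\<Sum>n=1..N t. Y n \<omega>) / real (N t)) \<in> borel_measurable P" for t
      using meas by (intro borel_measurable_divide borel_measurable_sum) auto
    fix \<epsilon> :: real assume "\<epsilon> > 0"
    have lim: "((\<lambda>t. c / \<epsilon>\<^sup>2 / real (N t)) \<longlongrightarrow> 0) S"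
      by (rule real_tendsto_divide_at_top[OF tendsto_const
          filterlim_compose[OF filterlim_real_sequentially N]])
    have "\<forall>\<^sub>F t in S. N t \<ge> 1"
      using N by (simp add: filterlim_at_top)
    then have "\<forall>\<^sub>F t in S. prob {\<omega> \<in> space P. \<bar>(\<Sum>n=1..N t. Y n \<omega>) / real (N t) - L\<bar> \<ge> \<epsilon>}
        \<le> c / \<epsilon>\<^sup>2 / real (N t)"
      by eventually_elim
        (rule weak_law_of_large_numbers[OF meas sq mean bound uncorr _ \<open>\<epsilon> > 0\<close>])
    then show "((\<lambda>t. prob {\<omega> \<in> space P. \<bar>(\<Sum>n=1..N t. Y n \<omega>) / real (N t) - L\<bar> \<ge> \<epsilon>}) \<longlongrightarrow> 0) S"
      by (rule tendsto_sandwich[OF _ _ tendsto_const lim, rotated]) simp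
  qed
qed

lemma component_moments:
  assumes "\<phi> \<in> input_ensembles j" "j \<ge> 1" "n \<ge> 1" "a < input_dim m d (\<phi> 1)"
  shows "(\<lambda>\<omega>. \<xi> (\<phi> n) \<omega> $ a) \<in> borel_measurable P"
    "integrable P (\<lambda>\<omega>. (\<xi> (\<phi> n) \<omega> $ a) ^ q)"
    "expectation (\<lambda>\<omega>. (\<xi> (\<phi> n) \<omega> $ a) ^ q) =
      (\<integral>x. normal_density (input_mean (\<phi> 1) $ a) (sqrt (input_cov (\<phi> 1) $$ (a, a))) x * x ^ q \<partial>lborel)"
    "expectation (\<lambda>\<omega>. \<xi> (\<phi> n) \<omega> $ a) = input_mean (\<phi> 1) $ a"
proof -
  note idx = input_ensembles_dim[OF assms(1), of n]
  note i = idx(4)[OF assms(2,3)]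
  note mom = normal_vec_component_moments[OF normal[OF i] input_carriers(2,1)[OF i], of a, unfolded idx(1-3)]
  show "(\<lambda>\<omega>. \<xi> (\<phi> n) \<omega> $ a) \<in> borel_measurable P"
    using normal_vec_measurable(3)[OF normal[OF i], of a] idx(1) assms(4) by simp
  show "integrable P (\<lambda>\<omega>. (\<xi> (\<phi> n) \<omega> $ a) ^ q)"
    "expectation (\<lambda>\<omega>. (\<xi> (\<phi> n) \<omega> $ a) ^ q) =
      (\<integral>x. normal_density (input_mean (\<phi> 1) $ a) (sqrt (input_cov (\<phi> 1) $$ (a, a))) x * x ^ q \<partial>lborel)"
    "expectation (\<lambda>\<omega>. \<xi> (\<phi> n) \<omega> $ a) = input_mean (\<phi> 1) $ a"
    using mom[OF assms(4)] by auto
qed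

lemma input_ensembles_eq_iff:
  assumes "\<phi> \<in> input_ensembles j" "\<psi> \<in> input_ensembles j"
  shows "\<phi> n = \<psi> n' \<longleftrightarrow> \<phi> = \<psi> \<and> n = n'"
  using assms unfolding input_ensembles_def by (auto dest: fun_cong[of _ _ 0])

lemma measurable_input_component:
  assumes "\<iota> \<in> K" "a < input_dim m d \<iota>"
  shows "(\<lambda>x. x \<iota> $ a) \<in> borel_measurable (\<Pi>\<^sub>M \<iota>\<in>K. borel_vec (input_dim m d \<iota>))"
proof -
  have "(\<lambda>x. x \<iota>) \<in> (\<Pi>\<^sub>M \<iota>\<in>K. borel_vec (input_dim m d \<iota>)) \<rightarrow>\<^sub>M borel_vec (input_dim m d \<iota>)"
    using measurable_component_singleton[OF assms(1), of "\<lambda>\<iota>. borel_vec (input_dim m d \<iota>)"] .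
  from measurable_compose[OF this measurable_borel_vec_component[OF assms(2)]] show ?thesis .
qed

lemma mean_law:
  assumes \<phi>: "\<phi> \<in> input_ensembles j" and j: "j \<ge> 1" and a: "a < input_dim m d (\<phi> 1)"
    and N: "filterlim N at_top S"
  shows "((\<lambda>t. (\<Sum>n=1..N (fst t). \<xi> (\<phi> n) (snd t) $ a) / real (N (fst t)))
    \<longlongrightarrow> input_mean (\<phi> 1) $ a) (prob_filter P S)"
proof (rule grouped_weak_law[where K = "\<lambda>n. {\<phi> n}" and G = "\<lambda>n x. x (\<phi> n) $ a"])
  show "{\<phi> n} \<subseteq> input_indices k" if "n \<ge> 1" for n
    using input_ensembles_dim(4)[OF \<phi> j that] by simp
  show "disjoint_family_on (\<lambda>n. {\<phi> n}) {1..}"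
    using input_ensembles_eq_iff[OF \<phi> \<phi>] by (auto simp: disjoint_family_on_def)
  show "(\<lambda>x. x (\<phi> n) $ a) \<in> borel_measurable (\<Pi>\<^sub>M \<iota>\<in>{\<phi> n}. borel_vec (input_dim m d \<iota>))" for n
    using a input_ensembles_dim(1)[OF \<phi>, of n] by (intro measurable_input_component) auto
  show "expectation (\<lambda>\<omega>. (\<xi> (\<phi> n) \<omega> $ a)\<^sup>2) \<le> (\<integral>x. normal_density (input_mean (\<phi> 1) $ a)
      (sqrt (input_cov (\<phi> 1) $$ (a, a))) x * x ^ 2 \<partial>lborel)" if "n \<ge> 1" for n
    using component_moments(3)[OF \<phi> j that a] by simp
qed (use component_moments[OF \<phi> j _ a] N in auto)

lemma product_moments:
  assumes \<phi>: "\<phi> \<in> input_ensembles j" and \<psi>: "\<psi> \<in> input_ensembles j" and j: "j \<ge> 1"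
    and n: "n \<ge> 1" and a: "a < input_dim m d (\<phi> 1)" and b: "b < input_dim m d (\<psi> 1)"
  shows "expectation (\<lambda>\<omega>. \<xi> (\<phi> n) \<omega> $ a * \<xi> (\<psi> n) \<omega> $ b) =
    input_mean (\<phi> 1) $ a * input_mean (\<psi> 1) $ b
    + (if \<phi> = \<psi> then input_cov (\<phi> 1) $$ (a, b) else 0)"
proof (cases "\<phi> = \<psi>")
  case True
  note idx = input_ensembles_dim[OF \<phi>, of n]
  note i = idx(4)[OF j n]
  show ?thesis
    using normal_vec_product_moment[OF normal[OF i] input_carriers(2,1)[OF i], of a b] idx(1-3) a b True
    by simp
next
  case False
  have ne: "\<phi> n \<noteq> \<psi> n"
    using input_ensembles_eq_iff[OF \<phi> \<psi>] False by simp
  \<comment> \<open>One coordinate function per input, so that the product rule for independent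
    variables applies to the two-element index set.\<close>
  define A where "A = (\<lambda>\<iota> (v :: real vec). if \<iota> = \<phi> n then v $ a else v $ b)"
  have sub: "{\<phi> n, \<psi> n} \<subseteq> input_indices k"
    using input_ensembles_dim(4)[OF \<phi> j n] input_ensembles_dim(4)[OF \<psi> j n] by simp
  have "indep_vars (\<lambda>_. borel) (\<lambda>\<iota> \<omega>. A \<iota> (\<xi> \<iota> \<omega>)) {\<phi> n, \<psi> n}"
  proof (rule indep_vars_compose2[OF indep_vars_subset[OF indep sub]])
    fix \<iota> assume "\<iota> \<in> {\<phi> n, \<psi> n}"
    then show "A \<iota> \<in> borel_vec (input_dim m d \<iota>) \<rightarrow>\<^sub>M borel"
      using measurable_borel_vec_component[of a "input_dim m d (\<phi> n)"]
        measurable_borel_vec_component[of b "input_dim m d (\<psi> n)"] a b ne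
        input_ensembles_dim(1)[OF \<phi>, of n] input_ensembles_dim(1)[OF \<psi>, of n]
      unfolding A_def by auto
  qed
  moreover have "integrable P (\<lambda>\<omega>. A \<iota> (\<xi> \<iota> \<omega>))" if "\<iota> \<in> {\<phi> n, \<psi> n}" for \<iota>
    using that component_moments(2)[OF \<phi> j n a, of 1] component_moments(2)[OF \<psi> j n b, of 1]
      ne ne[symmetric] unfolding A_def by auto
  ultimately have "expectation (\<lambda>\<omega>. \<Prod>\<iota>\<in>{\<phi> n, \<psi> n}. A \<iota> (\<xi> \<iota> \<omega>)) =
      (\<Prod>\<iota>\<in>{\<phi> n, \<psi> n}. expectation (\<lambda>\<omega>. A \<iota> (\<xi> \<iota> \<omega>)))"
    by (intro indep_vars_lebesgue_integral) auto
  then show ?thesis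
    using ne False component_moments(4)[OF \<phi> j n a] component_moments(4)[OF \<psi> j n b]
    by (simp add: A_def)
qed

text \<open>The weak law for products needs their second moments, which are bounded by fourth
  moments through \<open>(x * w)\<^sup>2 \<le> x ^ 4 + w ^ 4\<close>. For \<phi> = \<psi> the group
  of a member collapses to one index.\<close>

lemma product_law:
  assumes \<phi>: "\<phi> \<in> input_ensembles j" and \<psi>: "\<psi> \<in> input_ensembles j" and j: "j \<ge> 1"
    and a: "a < input_dim m d (\<phi> 1)" and b: "b < input_dim m d (\<psi> 1)"
    and N: "filterlim N at_top S"
  shows "((\<lambda>t. (\<Sum>n=1..N (fst t). \<xi> (\<phi> n) (snd t) $ a * \<xi> (\<psi> n) (snd t) $ b) / real (N (fst t)))
    \<longlongrightarrow> input_mean (\<phi> 1) $ a * input_mean (\<psi> 1) $ b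
      + (if \<phi> = \<psi> then input_cov (\<phi> 1) $$ (a, b) else 0)) (prob_filter P S)"
proof (rule grouped_weak_law[where K = "\<lambda>n. {\<phi> n, \<psi> n}" and G = "\<lambda>n x. x (\<phi> n) $ a * x (\<psi> n) $ b"])
  show "{\<phi> n, \<psi> n} \<subseteq> input_indices k" if "n \<ge> 1" for n
    using input_ensembles_dim(4)[OF \<phi> j that] input_ensembles_dim(4)[OF \<psi> j that] by simp
  show "disjoint_family_on (\<lambda>n. {\<phi> n, \<psi> n}) {1..}"
    using input_ensembles_eq_iff[OF \<phi> \<psi>] input_ensembles_eq_iff[OF \<psi> \<phi>]
      input_ensembles_eq_iff[OF \<phi> \<phi>] input_ensembles_eq_iff[OF \<psi> \<psi>]
    by (auto simp: disjoint_family_on_def)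
  show "(\<lambda>x. x (\<phi> n) $ a * x (\<psi> n) $ b) \<in>
      borel_measurable (\<Pi>\<^sub>M \<iota>\<in>{\<phi> n, \<psi> n}. borel_vec (input_dim m d \<iota>))" for n
    using a b input_ensembles_dim(1)[OF \<phi>, of n] input_ensembles_dim(1)[OF \<psi>, of n]
    by (intro borel_measurable_times measurable_input_component) auto
  \<comment> \<open>The fourth moment of a component, the same for every member.\<close>
  let ?c = "\<lambda>\<phi> a. \<integral>x. normal_density (input_mean (\<phi> 1) $ a)
      (sqrt (input_cov (\<phi> 1) $$ (a, a))) x * x ^ 4 \<partial>lborel"
  fix n :: nat assume n: "n \<ge> 1"
  let ?X = "\<lambda>\<omega>. \<xi> (\<phi> n) \<omega> $ a" and ?Y = "\<lambda>\<omega>. \<xi> (\<psi> n) \<omega> $ b"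
  note X = component_moments[OF \<phi> j n a] and Y = component_moments[OF \<psi> j n b]
  have [measurable]: "?X \<in> borel_measurable P" "?Y \<in> borel_measurable P"
    using X(1) Y(1) by auto
  have int4: "integrable P (\<lambda>\<omega>. ?X \<omega> ^ 4 + ?Y \<omega> ^ 4)"
    using X(2)[of 4] Y(2)[of 4] by simp
  have le: "(x * w)\<^sup>2 \<le> x ^ 4 + w ^ 4" for x w :: real
  proof -
    have "2 * (x\<^sup>2 * w\<^sup>2) \<le> x ^ 4 + w ^ 4"
      using sum_squares_bound[of "x\<^sup>2" "w\<^sup>2"] by (simp add: mult.assoc flip: power_mult)
    moreover have "0 \<le> x\<^sup>2 * w\<^sup>2"
      by simp
    ultimately show ?thesis
      unfolding power_mult_distrib by linarith
  qed
  show sq: "integrable P (\<lambda>\<omega>. (?X \<omega> * ?Y \<omega>)\<^sup>2)"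
    by (rule Bochner_Integration.integrable_bound[OF int4]) (use le in auto)
  have "expectation (\<lambda>\<omega>. (?X \<omega> * ?Y \<omega>)\<^sup>2) \<le> expectation (\<lambda>\<omega>. ?X \<omega> ^ 4 + ?Y \<omega> ^ 4)"
    using sq int4 le by (intro integral_mono) auto
  then show "expectation (\<lambda>\<omega>. (?X \<omega> * ?Y \<omega>)\<^sup>2) \<le> ?c \<phi> a + ?c \<psi> b"
    using X(2)[of 4] Y(2)[of 4] X(3)[of 4] Y(3)[of 4] by simp
  show "expectation (\<lambda>\<omega>. ?X \<omega> * ?Y \<omega>) = input_mean (\<phi> 1) $ a * input_mean (\<psi> 1) $ b
      + (if \<phi> = \<psi> then input_cov (\<phi> 1) $$ (a, b) else 0)"
    by (rule product_moments[OF \<phi> \<psi> j n a b])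
qed (use N in auto)

end


section \<open>Measurability of the iterates\<close>

instance input_index :: countable
  by countable_datatype

text \<open>All inputs are read off a single real function on a countable index set. For such
  functions a map with measurable coordinates is Borel measurable, so continuity of the iterates in
  the coordinates gives their measurability.\<close>

definition decode_inputs ::
    "nat \<Rightarrow> (nat \<Rightarrow> nat) \<Rightarrow> (input_index \<times> nat \<Rightarrow> real) \<Rightarrow> input_index \<Rightarrow> real vec" where
  "decode_inputs m d g \<iota> = vec (input_dim m d \<iota>) (\<lambda>a. g (\<iota>, a))"

lemma tendsto_coordinate: "((\<lambda>g. g x) \<longlongrightarrow> g0 x) (nhds (g0 :: 'i :: countable \<Rightarrow> real))"
proof -
  have "continuous_on UNIV (\<lambda>g :: 'i \<Rightarrow> real. g x)"
    by (rule continuous_on_product_coordinates)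
  then have "isCont (\<lambda>g :: 'i \<Rightarrow> real. g x) g0"
    using continuous_on_eq_continuous_at[OF open_UNIV] by blast
  then show ?thesis
    using tendsto_at_iff_tendsto_nhds[of "\<lambda>g. g x" g0] by (simp add: isCont_def)
qed

context assimilation
begin

abbreviation "fd_iterate \<tau> \<xi> N j \<equiv>
  enks_iterate k m d M H \<mu> y R \<gamma> x0 (\<lambda>j n. \<xi> (Init j n)) (\<lambda>j i n. \<xi> (Model j i n))
    (\<lambda>j i n. \<xi> (Obs j i n)) \<tau> N j"

text \<open>Continuity in the inputs, valid for every real \<tau>. The criterion
  \<open>conv_in_prob_pointwise_at_right\<close> asks for measurability at all steps.\<close>

lemma fd_iterate_tendsto:
  assumes \<xi>: "\<And>\<iota>. \<iota> \<in> input_indices k \<Longrightarrow> vec_tendsto (input_dim m d \<iota>) (\<lambda>t. \<xi>t t \<iota>) (\<xi> \<iota>) F"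
    and l: "l \<le> k"
  shows "vec_tendsto m (\<lambda>t. fd_iterate \<tau> (\<xi>t t) N j l) (fd_iterate \<tau> \<xi> N j l) F"
  unfolding enks_iterate_eq
proof (rule iterate_tendsto[OF _ _ _ _ _ l])
  fix j i n :: nat assume "j \<ge> 1" "n \<ge> 1"
  then show "vec_tendsto m (\<lambda>t. \<xi>t t (Init j n)) (\<xi> (Init j n)) F"
    and "i \<in> {1..k} \<Longrightarrow> vec_tendsto m (\<lambda>t. \<xi>t t (Model j i n)) (\<xi> (Model j i n)) F"
    and "i \<in> {1..k} \<Longrightarrow> vec_tendsto (d i + m) (\<lambda>t. \<xi>t t (Obs j i n)) (\<xi> (Obs j i n)) F"
    using \<xi>[of "Init j n"] \<xi>[of "Model j i n"] \<xi>[of "Obs j i n"]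
    by (auto simp: input_indices_def)
qed (blast intro: C1_map_tendsto_diff_quot_const[OF C1_M] aug_obs_tendsto_diff_quot_const[OF C1_H])+

lemma fd_iterate_tendsto_linearized:
  assumes \<xi>: "\<And>\<iota>. \<iota> \<in> input_indices k \<Longrightarrow> \<xi> \<iota> \<in> carrier_vec (input_dim m d \<iota>)"
    and l: "l \<le> k"
  shows "vec_tendsto m (\<lambda>\<tau>. fd_iterate \<tau> \<xi> N j l)
    (iterate tangent_model tangent_obs (\<lambda>j n. \<xi> (Init j n)) (\<lambda>j i n. \<xi> (Model j i n))
      (\<lambda>j i n. \<xi> (Obs j i n)) N j l) (at_right 0)"
  unfolding enks_iterate_eq
proof (rule iterate_tendsto[OF _ _ _ _ _ l])
  have pos: "\<forall>\<^sub>F \<tau> in at_right 0. (0 :: real) < \<tau>"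
    by (simp add: eventually_at_right_less)
  fix i z0 u0 and z u :: "real \<Rightarrow> real vec"
  assume i: "i \<in> {1..k}" and z: "vec_tendsto m z z0 (at_right 0)" and u: "vec_tendsto m u u0 (at_right 0)"
  show "vec_tendsto m (\<lambda>\<tau>. diff_quot \<tau> (M i) (z \<tau>) (u \<tau>)) (tangent_model i z0 u0) (at_right 0)"
    unfolding tangent_model_def
    by (rule C1_map_tendsto_diff_quot[OF C1_M[OF i] z u tendsto_ident_at pos])
  show "vec_tendsto (d i + m) (\<lambda>\<tau>. diff_quot \<tau> (aug_obs (H i)) (z \<tau>) (u \<tau>)) (tangent_obs i z0 u0)
      (at_right 0)"
    unfolding tangent_obs_def
    by (rule aug_obs_tendsto_diff_quot[OF C1_H[OF i] z u tendsto_ident_at pos])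
next
  fix j i n :: nat assume "j \<ge> 1" "n \<ge> 1"
  then show "vec_tendsto m (\<lambda>\<tau>. \<xi> (Init j n)) (\<xi> (Init j n)) (at_right 0)"
    and "i \<in> {1..k} \<Longrightarrow> vec_tendsto m (\<lambda>\<tau>. \<xi> (Model j i n)) (\<xi> (Model j i n)) (at_right 0)"
    and "i \<in> {1..k} \<Longrightarrow> vec_tendsto (d i + m) (\<lambda>\<tau>. \<xi> (Obs j i n)) (\<xi> (Obs j i n)) (at_right 0)"
    using \<xi>[of "Init j n"] \<xi>[of "Model j i n"] \<xi>[of "Obs j i n"]
    by (auto simp: input_indices_def intro!: vec_tendsto_const)
qed

text \<open>Each iterate is a continuous function of the coordinates of its inputs.\<close>

lemma measurable_fd_iterate:
  fixes P :: "'w measure" and \<xi> :: "input_index \<Rightarrow> 'w \<Rightarrow> real vec"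
  assumes \<xi>: "\<And>\<iota>. \<iota> \<in> input_indices k \<Longrightarrow> \<xi> \<iota> \<in> P \<rightarrow>\<^sub>M borel_vec (input_dim m d \<iota>)"
    and l: "l \<le> k"
  shows "(\<lambda>\<omega>. fd_iterate \<tau> (\<lambda>\<iota>. \<xi> \<iota> \<omega>) N j l) \<in> P \<rightarrow>\<^sub>M borel_vec m"
proof -
  define \<Phi> where "\<Phi> g = fd_iterate \<tau> (decode_inputs m d g) N j l" for g
  define code where "code \<omega> = (\<lambda>(\<iota>, a).
    if \<iota> \<in> input_indices k \<and> a < input_dim m d \<iota> then \<xi> \<iota> \<omega> $ a else 0)" for \<omega>
  have \<Phi>: "vec_tendsto m \<Phi> (\<Phi> g) (nhds g)" for g
    unfolding \<Phi>_def
  proof (rule fd_iterate_tendsto[OF _ l])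
    fix \<iota>
    show "vec_tendsto (input_dim m d \<iota>) (\<lambda>g. decode_inputs m d g \<iota>) (decode_inputs m d g \<iota>) (nhds g)"
      by (rule vec_tendstoI[where f = "\<lambda>g a. g (\<iota>, a)"])
        (auto simp: decode_inputs_def tendsto_coordinate)
  qed
  have meas_\<Phi>: "(\<lambda>g. \<Phi> g $ a) \<in> borel_measurable borel" if "a < m" for a
  proof (rule borel_measurable_continuous_onI)
    show "continuous_on UNIV (\<lambda>g. \<Phi> g $ a)"
      unfolding continuous_on_def
      using tendsto_mono[OF at_within_le_nhds vec_tendstoD(3)[OF \<Phi> that]] by blast
  qed
  have meas_code: "code \<in> borel_measurable P"
  proof (rule measurable_coordinatewise_then_product)
    fix x :: "input_index \<times> nat"
    obtain \<iota> a where x: "x = (\<iota>, a)"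
      by (cases x)
    show "(\<lambda>\<omega>. code \<omega> x) \<in> borel_measurable P"
    proof (cases "\<iota> \<in> input_indices k \<and> a < input_dim m d \<iota>")
      case True
      then show ?thesis
        unfolding code_def x
        using measurable_compose[OF \<xi> measurable_borel_vec_component] by simp
    next
      case False
      then have "(\<lambda>\<omega>. code \<omega> x) = (\<lambda>_. 0)"
        by (auto simp: code_def x)
      then show ?thesis
        by simp
    qed
  qed
  have eq: "fd_iterate \<tau> (\<lambda>\<iota>. \<xi> \<iota> \<omega>) N j l \<in> carrier_vec m \<and>
      (\<forall>a<m. fd_iterate \<tau> (\<lambda>\<iota>. \<xi> \<iota> \<omega>) N j l $ a = \<Phi> (code \<omega>) $ a)" if \<omega>: "\<omega> \<in> space P" for \<omega>
  proof -
    have "decode_inputs m d (code \<omega>) \<iota> = \<xi> \<iota> \<omega>" and "\<xi> \<iota> \<omega> \<in> carrier_vec (input_dim m d \<iota>)"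
      if \<iota>: "\<iota> \<in> input_indices k" for \<iota>
    proof -
      show "\<xi> \<iota> \<omega> \<in> carrier_vec (input_dim m d \<iota>)"
        using measurable_space[OF \<xi>[OF \<iota>] \<omega>] by simp
      then show "decode_inputs m d (code \<omega>) \<iota> = \<xi> \<iota> \<omega>"
        using \<iota> by (intro eq_vecI) (auto simp: decode_inputs_def code_def)
    qed
    \<comment> \<open>Continuity used as a congruence rule: the decoded inputs agree with \<xi> only
      on \<open>input_indices k\<close>, but a constant family then converges to the iterate of
      \<xi>, and uniqueness of limits equates the entries. Any nontrivial filter would
      serve.\<close>
    then have "vec_tendsto m (\<lambda>_. \<Phi> (code \<omega>)) (fd_iterate \<tau> (\<lambda>\<iota>. \<xi> \<iota> \<omega>) N j l) (at_right (0::real))"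
      unfolding \<Phi>_def by (intro fd_iterate_tendsto[OF _ l]) (simp add: vec_tendsto_const)
    note lim = vec_tendstoD[OF this]
    show ?thesis
      using lim(1) tendsto_unique[OF trivial_limit_at_right_real lim(3) tendsto_const] by auto
  qed
  show ?thesis
  proof (rule measurable_borel_vecI)
    fix a assume a: "a < m"
    have "(\<lambda>\<omega>. \<Phi> (code \<omega>) $ a) \<in> borel_measurable P"
      by (rule measurable_compose[OF meas_code meas_\<Phi>[OF a]])
    then show "(\<lambda>\<omega>. fd_iterate \<tau> (\<lambda>\<iota>. \<xi> \<iota> \<omega>) N j l $ a) \<in> borel_measurable P"
      using eq a by (subst measurable_cong) auto
  qed (use eq in auto)
qed

end


section \<open>Convergence in probability\<close>

lemma tendsto_blocks_norm:
  assumes "\<And>l. l \<le> k \<Longrightarrow> vec_tendsto m (\<lambda>t. X t l) (x l) F"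
  shows "((\<lambda>t. blocks_norm k (\<lambda>l. X t l - x l)) \<longlongrightarrow> 0) F"
proof -
  have "((\<lambda>t. sqrt (\<Sum>l\<le>k. (vnorm (X t l - x l))\<^sup>2)) \<longlongrightarrow> sqrt (\<Sum>l\<le>k. 0\<^sup>2)) F"
    using assms by (intro tendsto_intros tendsto_vnorm_diff) auto
  then show ?thesis
    by (simp add: blocks_norm_def)
qed

lemma random_blocksD:
  assumes "random_blocks P m k X" "l \<le> k"
  shows "\<omega> \<in> space P \<Longrightarrow> X \<omega> l \<in> carrier_vec m"
    "a < m \<Longrightarrow> (\<lambda>\<omega>. X \<omega> l $ a) \<in> borel_measurable P"
proof -
  have X: "(\<lambda>\<omega>. X \<omega> l) \<in> P \<rightarrow>\<^sub>M borel_vec m"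
    using assms unfolding random_blocks_def by simp
  show "\<omega> \<in> space P \<Longrightarrow> X \<omega> l \<in> carrier_vec m"
    using measurable_space[OF X] by simp
  show "a < m \<Longrightarrow> (\<lambda>\<omega>. X \<omega> l $ a) \<in> borel_measurable P"
    by (rule measurable_compose[OF X measurable_borel_vec_component])
qed

lemma measurable_blocks_norm_diff:
  assumes X: "random_blocks P m k X" and Y: "random_blocks P m k Y"
  shows "(\<lambda>\<omega>. blocks_norm k (\<lambda>l. X \<omega> l - Y \<omega> l)) \<in> borel_measurable P"
proof -
  have "blocks_norm k (\<lambda>l. X \<omega> l - Y \<omega> l) =
      sqrt (\<Sum>l\<le>k. (sqrt (\<Sum>a<m. (X \<omega> l $ a - Y \<omega> l $ a)\<^sup>2))\<^sup>2)" if \<omega>: "\<omega> \<in> space P" for \<omega>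
  proof -
    have "vnorm (X \<omega> l - Y \<omega> l) = sqrt (\<Sum>a<m. (X \<omega> l $ a - Y \<omega> l $ a)\<^sup>2)" if "l \<le> k" for l
      using vnorm_eq[of "X \<omega> l - Y \<omega> l" m] random_blocksD(1)[OF X that \<omega>]
        random_blocksD(1)[OF Y that \<omega>] by simp
    then show ?thesis
      by (simp add: blocks_norm_def)
  qed
  moreover have "(\<lambda>\<omega>. sqrt (\<Sum>l\<le>k. (sqrt (\<Sum>a<m. (X \<omega> l $ a - Y \<omega> l $ a)\<^sup>2))\<^sup>2))
      \<in> borel_measurable P"
    using random_blocksD(2)[OF X] random_blocksD(2)[OF Y]
    by (intro measurable_compose[OF _ borel_measurable_sqrt] borel_measurable_sum
        borel_measurable_power borel_measurable_diff) auto
  ultimately show ?thesis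
    by (subst measurable_cong) auto
qed

text \<open>Dominated convergence for the indicators of the deviation events. Both this theorem and
  measurability of a pointwise limit are statements about sequences, so the continuous parameter is
  sampled.\<close>

lemma conv_in_prob_pointwise_at_right:
  assumes P: "prob_space P"
    and X: "\<And>\<tau> :: real. random_blocks P m k (X \<tau>)"
    and lim: "\<And>\<omega> l. \<omega> \<in> space P \<Longrightarrow> l \<le> k \<Longrightarrow> vec_tendsto m (\<lambda>\<tau>. X \<tau> \<omega> l) (Y \<omega> l) (at_right 0)"
  shows "conv_in_prob P m k (at_right 0) X Y"
  unfolding conv_in_prob_def
proof (intro conjI allI impI)
  interpret prob_space P by fact
  show "\<forall>\<^sub>F \<tau> in at_right 0. random_blocks P m k (X \<tau>)"
    using X by simp
  have seq: "filterlim (\<lambda>n. 1 / real (Suc n)) (at_right 0) sequentially"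
    by real_asymp
  show Y: "random_blocks P m k Y"
    unfolding random_blocks_def
  proof (intro allI impI measurable_borel_vecI)
    fix l assume l: "l \<le> k"
    show "Y \<omega> l \<in> carrier_vec m" if "\<omega> \<in> space P" for \<omega>
      by (rule vec_tendstoD(1)[OF lim[OF that l]])
    fix a assume a: "a < m"
    show "(\<lambda>\<omega>. Y \<omega> l $ a) \<in> borel_measurable P"
    proof (rule borel_measurable_LIMSEQ_real)
      show "(\<lambda>\<omega>. X (1 / real (Suc n)) \<omega> l $ a) \<in> borel_measurable P" for n
        by (rule random_blocksD(2)[OF X l a])
      show "(\<lambda>n. X (1 / real (Suc n)) \<omega> l $ a) \<longlonglongrightarrow> Y \<omega> l $ a" if "\<omega> \<in> space P" for \<omega>
        by (rule filterlim_compose[OF vec_tendstoD(3)[OF lim[OF that l] a] seq])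
    qed
  qed
  fix \<epsilon> :: real assume "\<epsilon> > 0"
  let ?A = "\<lambda>\<tau>. {\<omega> \<in> space P. blocks_norm k (\<lambda>l. X \<tau> \<omega> l - Y \<omega> l) > \<epsilon>}"
  have A: "?A \<tau> \<in> sets P" for \<tau>
    using measurable_blocks_norm_diff[OF X[of \<tau>] Y] by measurable
  show "((\<lambda>\<tau>. measure P (?A \<tau>)) \<longlongrightarrow> 0) (at_right 0)"
  \<comment> \<open>The 1 is only some upper bound for the sampled steps.\<close>
  proof (rule tendsto_at_right_sequentially[of 0 1])
    fix S :: "nat \<Rightarrow> real"
    assume S: "\<And>n. 0 < S n" "S \<longlonglongrightarrow> 0"
    then have S0: "filterlim S (at_right 0) sequentially"
      using less_imp_neq[OF S(1), symmetric] by (simp add: filterlim_at)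
    have "(\<lambda>n. \<integral>\<omega>. indicator (?A (S n)) \<omega> \<partial>P) \<longlonglongrightarrow> (\<integral>\<omega>. (0::real) \<partial>P)"
    proof (rule integral_dominated_convergence[where w = "\<lambda>_. 1"])
      show "AE \<omega> in P. (\<lambda>n. indicator (?A (S n)) \<omega> :: real) \<longlonglongrightarrow> 0"
      proof (rule AE_I2)
        fix \<omega> assume \<omega>: "\<omega> \<in> space P"
        have "((\<lambda>\<tau>. blocks_norm k (\<lambda>l. X \<tau> \<omega> l - Y \<omega> l)) \<longlongrightarrow> 0) (at_right 0)"
          by (rule tendsto_blocks_norm[OF lim[OF \<omega>]])
        then have "(\<lambda>n. blocks_norm k (\<lambda>l. X (S n) \<omega> l - Y \<omega> l)) \<longlonglongrightarrow> 0"
          using S0 by (rule filterlim_compose)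
        then have "\<forall>\<^sub>F n in sequentially. blocks_norm k (\<lambda>l. X (S n) \<omega> l - Y \<omega> l) < \<epsilon>"
          using \<open>\<epsilon> > 0\<close> by (rule order_tendstoD)
        then have "\<forall>\<^sub>F n in sequentially. (indicator (?A (S n)) \<omega> :: real) = 0"
          by eventually_elim auto
        then show "(\<lambda>n. indicator (?A (S n)) \<omega> :: real) \<longlonglongrightarrow> 0"
          by (rule tendsto_eventually)
      qed
    qed (use A in \<open>auto simp: indicator_def\<close>)
    then show "(\<lambda>n. measure P (?A (S n))) \<longlonglongrightarrow> 0"
      using A by simp
  qed simp
qed

lemma filterlim_sizes_at_top:
  assumes "j' \<in> {1..j}"
  shows "filterlim (\<lambda>N. N j') at_top (sizes_at_top j)"
proof -
  have "filterlim (\<lambda>N. Min (N ` {1..j})) at_top (sizes_at_top j)"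
    unfolding sizes_at_top_def
    by (rule filterlim_mono[OF filterlim_filtercomap order_refl inf_le1])
  then show ?thesis
    by (rule filterlim_at_top_mono) (use assms in \<open>auto intro!: always_eventually\<close>)
qed

text \<open>The parameter of the deterministic theorem is the pair of sizes and outcome; along
  \<open>prob_filter\<close> its hypotheses are the weak laws for averages and for products.\<close>

lemma (in random_inputs) linearized_iterate_conv:
  assumes "j \<ge> 1" "l \<le> k"
  shows "vec_tendsto m (\<lambda>t. iterate tangent_model tangent_obs (\<lambda>j n. \<xi> (Init j n) (snd t))
      (\<lambda>j i n. \<xi> (Model j i n) (snd t)) (\<lambda>j i n. \<xi> (Obs j i n) (snd t)) (fst t) j l)
    (lm_iterate k m M M' H H' xb \<mu> y B Q R \<gamma> x0 j l) (prob_filter P (sizes_at_top j))"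
proof (rule iterate_large_sample[where N = fst and \<xi> = "\<lambda>t \<iota>. \<xi> \<iota> (snd t)", OF _ _ _ _ \<open>l \<le> k\<close>])
  show "filterlim (\<lambda>t. fst t j') at_top (prob_filter P (sizes_at_top j))" if "j' \<in> {1..j}" for j'
    by (rule filterlim_compose[OF filterlim_sizes_at_top[OF that] filterlim_fst_prob_filter])
  show "\<forall>\<^sub>F t in prob_filter P (sizes_at_top j).
      \<forall>\<iota>\<in>input_indices k. \<xi> \<iota> (snd t) \<in> carrier_vec (input_dim m d \<iota>)"
    using eventually_prob_filter_space
    by (rule eventually_mono) (use normal_vec_measurable(2)[OF normal] in auto)
next
  fix j' \<phi> a
  assume j': "j' \<in> {1..j}" and \<phi>: "\<phi> \<in> input_ensembles j'" and a: "a < input_dim m d (\<phi> 1)"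
  then show "((\<lambda>t. (\<Sum>n=1..fst t j'. \<xi> (\<phi> n) (snd t) $ a) / real (fst t j')) \<longlongrightarrow>
      input_mean (\<phi> 1) $ a) (prob_filter P (sizes_at_top j))"
    by (intro mean_law[OF \<phi> _ a filterlim_sizes_at_top]) auto
  fix \<psi> b
  assume \<psi>: "\<psi> \<in> input_ensembles j'" and b: "b < input_dim m d (\<psi> 1)"
  then show "((\<lambda>t. (\<Sum>n=1..fst t j'. \<xi> (\<phi> n) (snd t) $ a * \<xi> (\<psi> n) (snd t) $ b) / real (fst t j'))
      \<longlongrightarrow> input_mean (\<phi> 1) $ a * input_mean (\<psi> 1) $ b
        + (if \<phi> = \<psi> then input_cov (\<phi> 1) $$ (a, b) else 0)) (prob_filter P (sizes_at_top j))"
    using j' by (intro product_law[OF \<phi> \<psi> _ a b filterlim_sizes_at_top]) auto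
qed

theorem corollary6p13:
  fixes P :: "'w measure"
    and k m :: nat and d :: "nat \<Rightarrow> nat"
    and M H :: "nat \<Rightarrow> real vec \<Rightarrow> real vec"
    and M' H' :: "nat \<Rightarrow> real vec \<Rightarrow> real mat"
    and xb :: "real vec" and \<mu> y :: "nat \<Rightarrow> real vec"
    and B :: "real mat" and Q R :: "nat \<Rightarrow> real mat"
    and \<gamma> :: real and x0 :: "nat \<Rightarrow> real vec"
    and X0 :: "nat \<Rightarrow> nat \<Rightarrow> 'w \<Rightarrow> real vec"
    and V W :: "nat \<Rightarrow> nat \<Rightarrow> nat \<Rightarrow> 'w \<Rightarrow> real vec"
    and \<kappa> s :: real and j :: nat
  assumes "k \<ge> 1" and "m \<ge> 1" and "\<And>i. i \<in> {1..k} \<Longrightarrow> d i \<ge> 1"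
    and "\<And>i. i \<in> {1..k} \<Longrightarrow> C1_map m m (M i) (M' i)"
    and "\<And>i. i \<in> {1..k} \<Longrightarrow> C1_map m (d i) (H i) (H' i)"
    and "xb \<in> carrier_vec m"
    and "\<And>i. i \<in> {1..k} \<Longrightarrow> \<mu> i \<in> carrier_vec m"
    and "\<And>i. i \<in> {1..k} \<Longrightarrow> y i \<in> carrier_vec (d i)"
    and "sym_pos_def m B"
    and "\<And>i. i \<in> {1..k} \<Longrightarrow> sym_pos_def m (Q i)"
    and "\<And>i. i \<in> {1..k} \<Longrightarrow> sym_pos_def (d i) (R i)"
    and "\<gamma> > 0"
    and "\<And>l. l \<in> {0..k} \<Longrightarrow> x0 l \<in> carrier_vec m"
    and "\<kappa> > 0" and "s \<ge> 0"
    and "\<And>i x. i \<in> {1..k} \<Longrightarrow> x \<in> carrier_vec m \<Longrightarrow>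
           vnorm (M i x) \<le> growth_bound \<kappa> s x \<and>
           spectral_norm (M' i x) \<le> growth_bound \<kappa> s x \<and>
           vnorm (H i x) \<le> growth_bound \<kappa> s x \<and>
           spectral_norm (H' i x) \<le> growth_bound \<kappa> s x"
    and "prob_space P"
    and "\<And>j n. j \<ge> 1 \<Longrightarrow> n \<ge> 1 \<Longrightarrow> normal_vec P m xb B (X0 j n)"
    and "\<And>j i n. j \<ge> 1 \<Longrightarrow> i \<in> {1..k} \<Longrightarrow> n \<ge> 1 \<Longrightarrow> normal_vec P m (0\<^sub>v m) (Q i) (V j i n)"
    and "\<And>j i n. j \<ge> 1 \<Longrightarrow> i \<in> {1..k} \<Longrightarrow> n \<ge> 1 \<Longrightarrow>
           normal_vec P (d i + m) (0\<^sub>v (d i + m)) (aug_cov (d i) m \<gamma> (R i)) (W j i n)"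
    and "prob_space.indep_vars P (\<lambda>\<iota>. borel_vec (input_dim m d \<iota>))
           (input_family X0 V W) (input_indices k)"
    and "j \<ge> 1"
  shows "\<exists>L :: (nat \<Rightarrow> nat) \<Rightarrow> 'w \<Rightarrow> nat \<Rightarrow> real vec.
      (\<forall>N \<in> admissible_sizes.
         conv_in_prob P m k (at_right 0)
           (\<lambda>\<tau> \<omega>. enks_iterate k m d M H \<mu> y R \<gamma> x0
              (\<lambda>j n. X0 j n \<omega>) (\<lambda>j i n. V j i n \<omega>) (\<lambda>j i n. W j i n \<omega>) \<tau> N j)
           (L N))
      \<and> conv_in_prob P m k (sizes_at_top j) L
          (\<lambda>\<omega>. lm_iterate k m M M' H H' xb \<mu> y B Q R \<gamma> x0 j)"
proof -
  interpret prob_space P by fact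
  interpret assimilation k m d M H M' H' xb \<mu> y B Q R \<gamma> x0
    by unfold_locales fact+
  let ?\<xi> = "input_family X0 V W"
  interpret random_inputs k m d M H M' H' xb \<mu> y B Q R \<gamma> x0 P ?\<xi>
  proof unfold_locales
    fix \<iota> assume "\<iota> \<in> input_indices k"
    then show "normal_vec P (input_dim m d \<iota>) (input_mean \<iota>) (input_cov \<iota>) (?\<xi> \<iota>)"
      using assms(18-20) unfolding input_indices_def by auto
  qed fact
  \<comment> \<open>The same inputs are kept, so the limit in \<tau> can be taken outcome by
    outcome.\<close>
  define L where "L N \<omega> = iterate tangent_model tangent_obs (\<lambda>j n. ?\<xi> (Init j n) \<omega>)
    (\<lambda>j i n. ?\<xi> (Model j i n) \<omega>) (\<lambda>j i n. ?\<xi> (Obs j i n) \<omega>) N j" for N \<omega>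
  have first: "conv_in_prob P m k (at_right 0) (\<lambda>\<tau> \<omega>. fd_iterate \<tau> (\<lambda>\<iota>. ?\<xi> \<iota> \<omega>) N j) (L N)" for N
  proof (rule conv_in_prob_pointwise_at_right[OF \<open>prob_space P\<close>])
    show "random_blocks P m k (\<lambda>\<omega>. fd_iterate \<tau> (\<lambda>\<iota>. ?\<xi> \<iota> \<omega>) N j)" for \<tau>
      unfolding random_blocks_def
      by (intro allI impI measurable_fd_iterate normal_vec_measurable(1)[OF normal])
    show "vec_tendsto m (\<lambda>\<tau>. fd_iterate \<tau> (\<lambda>\<iota>. ?\<xi> \<iota> \<omega>) N j l) (L N \<omega> l) (at_right 0)"
      if "\<omega> \<in> space P" "l \<le> k" for \<omega> l
      unfolding L_def
      by (rule fd_iterate_tendsto_linearized[OF _ that(2)])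
        (rule normal_vec_measurable(2)[OF normal that(1)])
  qed
  then have L: "random_blocks P m k (L N)" for N
    unfolding conv_in_prob_def by blast
  have lim: "vec_tendsto m (\<lambda>t. L (fst t) (snd t) l)
      (lm_iterate k m M M' H H' xb \<mu> y B Q R \<gamma> x0 j l) (prob_filter P (sizes_at_top j))"
    if "l \<le> k" for l
    unfolding L_def by (rule linearized_iterate_conv[OF \<open>j \<ge> 1\<close> that])
  \<comment> \<open>Blockwise limits along \<open>prob_filter\<close> are combined into the norm of
    all blocks and translated back into probabilities of deviations.\<close>
  have "conv_in_prob P m k (sizes_at_top j) L (\<lambda>\<omega>. lm_iterate k m M M' H H' xb \<mu> y B Q R \<gamma> x0 j)"
    unfolding conv_in_prob_def
  proof (intro conjI allI impI)
    show "\<forall>\<^sub>F N in sizes_at_top j. random_blocks P m k (L N)"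
      using L by simp
    show "random_blocks P m k (\<lambda>\<omega>. lm_iterate k m M M' H H' xb \<mu> y B Q R \<gamma> x0 j)"
      unfolding random_blocks_def using vec_tendstoD(1)[OF lim] by simp
  qed (rule tendsto_prob_filterD[OF \<open>prob_space P\<close> tendsto_blocks_norm[OF lim]])
  with first show ?thesis
    by (intro exI[of _ L]) simp
qed

end
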